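(* Let $M$ be a Riemannian surface and let $\Sigma\subseteq M\times\mathbb{R}$ be an $H$-graph, $H>0$, over a compact regular domain $\Omega\subset M$ with $h=0$ and $\nu=\nu_0$ in $\partial\Omega$ for some $-1<\nu_0\leq0$. Suppose that $c=\inf\{K_M(p):p\in\Omega\}$ satisfies $4H^2+c>0$. Let $\kappa_g$ be the geodesic curvature of $\partial\Omega$ in $M$ with respect to the outer conormal vector field. (1) If there exists $0<m\leq\frac12$ such that $|h|\leq m\cdot\alpha(c,H,\nu_0)$ in $\Sigma$, then \[\kappa_g\geq\frac{(4-8m)H^2+c(1-\nu_0^2)}{4mH\sqrt{1-\nu_0^2}}.\] (2) In any of the following situations, $\partial\Omega$ is convex with respect to the outer conormal vector field (that is, $\kappa_g\geq 0$): i) $c\geq0$ and $h\leq\frac12\alpha(c,H,\nu_0)$ in $\Sigma$, or ii) $c<0$ and $h\leq\frac{4H^2+c(1-\nu_0^2)}{8H^2}\alpha(c,H,\nu_0)$ in $\Sigma$.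
   Context: $M\times\mathbb{R}$ carries the product metric; $K_M$ is the Gaussian curvature of $M$. The mean curvature is half the trace of the shape operator $A=-\nabla N$, where $N$ is the unit normal to $\Sigma$ for which it equals $H>0$. The height function is $h(p,t)=t$ and the angle function is $\nu=\langle N,E_3\rangle$ with $E_3=\partial_t$. An $H$-graph over $\Omega$ is a graph over $\Omega$ with constant mean curvature $H$; $\Sigma$ is assumed to extend smoothly (as a surface) to its boundary $\partial\Sigma=\partial\Omega\times\{0\}$, so that conditions "in $\partial\Omega$" on $h$ and $\nu$ mean conditions along $\partial\Sigma$. A regular domain is one with smooth boundary. The constant $\alpha(c,H,\nu_0)$, for $4H^2+c>0$, is \[\alpha(c,H,\nu_0)=\begin{cases}\frac{4H}{\sqrt{-4cH^2-c^2}}\left(\arctan\left(\frac{\sqrt{-c}}{\sqrt{c+4H^2}}\right)+\arctan\left(\frac{\nu_0\sqrt{-c}}{\sqrt{c+4H^2}}\right)\right)&\text{if }c<0,\\ \frac{1+\nu_0}{H}&\text{if }c=0,\\ \frac{4H}{\sqrt{4cH^2+c^2}}\left(\operatorname{arctanh}\left(\frac{\sqrt{c}}{\sqrt{c+4H^2}}\right)+\operatorname{arctanh}\left(\frac{\nu_0\sqrt{c}}{\sqrt{c+4H^2}}\right)\right)&\text{if }c>0.\end{cases}\] Geodesic curvature with respect to the outer conormal: if $\gamma$ is a unit speed parametrization of $\partial\Omega$ and $n$ is the unit normal to $\partial\Omega$ in $M$ pointing out of $\Omega$, then $\kappa_g=\langle\nabla_{\gamma'}\gamma',n\rangle$ (so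 a round disk of radius $R$ in $\mathbb{R}^2$ has $\kappa_g=-1/R$).
   Formalization: In part (2), when ν₀=0, it is additionally assumed that ν<0 over the interior of Ω; otherwise the claim fails: the lower unit hemisphere over the unit disk (H=1, c=0, ν₀=0) has h≤0 and κ_g=−1. *)

theory Defs
  imports "HOL-Analysis.Analysis"
begin

section \<open>Smooth maps between open subsets of Euclidean spaces\<close>

text \<open>Both notions are only meant for open sets \<open>S\<close>.\<close>

primrec Ck_on :: "nat \<Rightarrow> 'a::euclidean_space set \<Rightarrow> ('a \<Rightarrow> 'b::real_normed_vector) \<Rightarrow> bool" where
  "Ck_on 0 S f \<longleftrightarrow> continuous_on S f"
| "Ck_on (Suc k) S f \<longleftrightarrow> (\<forall>x\<in>S. f differentiable (at x)) \<and>
     (\<forall>v. Ck_on k S (\<lambda>x. frechet_derivative f (at x) v))"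

definition smooth_on :: "'a::euclidean_space set \<Rightarrow> ('a \<Rightarrow> 'b::real_normed_vector) \<Rightarrow> bool" where
  "smooth_on S f \<longleftrightarrow> (\<forall>k. Ck_on k S f)"

section \<open>Riemannian manifolds\<close>

text \<open>
  A Riemannian manifold without boundary on the points of a type \<open>'a\<close>, modelled on the Euclidean
  space \<open>'e\<close>, is given by a family of charts. Tangent vectors at a point are represented by their
  components in a chart: \<open>metric M i x v w\<close> is the inner product of the vectors with components
  \<open>v\<close> and \<open>w\<close> in chart \<open>i\<close>, at the point with coordinates \<open>x\<close>.
\<close>

record ('a, 'e, 'i) riem =
  charts :: "'i set"
  chart_dom :: "'i \<Rightarrow> 'a set"
  coord :: "'i \<Rightarrow> 'a \<Rightarrow> 'e"
  metric :: "'i \<Rightarrow> 'e \<Rightarrow> 'e \<Rightarrow> 'e \<Rightarrow> real"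

definition chart_im :: "('a, 'e, 'i) riem \<Rightarrow> 'i \<Rightarrow> 'e set" where
  "chart_im M i = coord M i ` chart_dom M i"

definition param :: "('a, 'e, 'i) riem \<Rightarrow> 'i \<Rightarrow> 'e \<Rightarrow> 'a" where
  "param M i = inv_into (chart_dom M i) (coord M i)"

definition transition :: "('a, 'e, 'i) riem \<Rightarrow> 'i \<Rightarrow> 'i \<Rightarrow> 'e \<Rightarrow> 'e" where
  "transition M i j = coord M j \<circ> param M i"

definition riemannian_manifold ::
    "('a::{second_countable_topology,t2_space}, 'e::euclidean_space, 'i) riem \<Rightarrow> bool" where
  "riemannian_manifold M \<longleftrightarrow>
     (\<Union>i\<in>charts M. chart_dom M i) = UNIV \<and>
     (\<forall>i\<in>charts M. open (chart_dom M i) \<and> open (chart_im M i) \<and>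
        homeomorphism (chart_dom M i) (chart_im M i) (coord M i) (param M i)) \<and>
     (\<forall>i\<in>charts M. \<forall>j\<in>charts M.
        smooth_on (coord M i ` (chart_dom M i \<inter> chart_dom M j)) (transition M i j)) \<and>
     (\<forall>i\<in>charts M.
        (\<forall>x\<in>chart_im M i. bilinear (metric M i x) \<and>
           (\<forall>v w. metric M i x v w = metric M i x w v) \<and>
           (\<forall>v. v \<noteq> 0 \<longrightarrow> metric M i x v v > 0)) \<and>
        (\<forall>v w. smooth_on (chart_im M i) (\<lambda>x. metric M i x v w))) \<and>
     (\<forall>i\<in>charts M. \<forall>j\<in>charts M. \<forall>p\<in>chart_dom M i \<inter> chart_dom M j. \<forall>v w.
        metric M i (coord M i p) v w =
        metric M j (coord M j p) (frechet_derivative (transition M i j) (at (coord M i p)) v)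
                                 (frechet_derivative (transition M i j) (at (coord M i p)) w))"

text \<open>A chart around \<open>p\<close>, used only for quantities that do not depend on the chart.\<close>

definition chart_at :: "('a, 'e, 'i) riem \<Rightarrow> 'a \<Rightarrow> 'i" where
  "chart_at M p = (SOME i. i \<in> charts M \<and> p \<in> chart_dom M i)"

text \<open>
  The Levi-Civita connection in a chart: \<open>christoffel M i x v w\<close> is the covariant derivative
  in direction \<open>v\<close> of the vector field with constant components \<open>w\<close>, characterised by the Koszul
  formula.
\<close>

definition christoffel ::
    "('a, 'e::euclidean_space, 'i) riem \<Rightarrow> 'i \<Rightarrow> 'e \<Rightarrow> 'e \<Rightarrow> 'e \<Rightarrow> 'e" where
  "christoffel M i x v w = (THE z. \<forall>y. 2 * metric M i x z y =
       frechet_derivative (\<lambda>x. metric M i x w y) (at x) v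
     + frechet_derivative (\<lambda>x. metric M i x v y) (at x) w
     - frechet_derivative (\<lambda>x. metric M i x v w) (at x) y)"

text \<open>\<open>R(u, v) w = \<nabla>\<^sub>u \<nabla>\<^sub>v w - \<nabla>\<^sub>v \<nabla>\<^sub>u w\<close> for vector fields with constant components in the chart.\<close>

definition curvature ::
    "('a, 'e::euclidean_space, 'i) riem \<Rightarrow> 'i \<Rightarrow> 'e \<Rightarrow> 'e \<Rightarrow> 'e \<Rightarrow> 'e \<Rightarrow> 'e" where
  "curvature M i x u v w =
       frechet_derivative (\<lambda>x. christoffel M i x v w) (at x) u
     + christoffel M i x u (christoffel M i x v w)
     - frechet_derivative (\<lambda>x. christoffel M i x u w) (at x) v
     - christoffel M i x v (christoffel M i x u w)"

definition sectional_curvature ::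
    "('a, 'e::euclidean_space, 'i) riem \<Rightarrow> 'i \<Rightarrow> 'e \<Rightarrow> 'e \<Rightarrow> 'e \<Rightarrow> real" where
  "sectional_curvature M i x u v =
     metric M i x (curvature M i x u v v) u /
     (metric M i x u u * metric M i x v v - (metric M i x u v)\<^sup>2)"

definition gauss_curvature :: "('a, real^2, 'i) riem \<Rightarrow> 'a \<Rightarrow> real" where
  "gauss_curvature M p = (let i = chart_at M p
     in sectional_curvature M i (coord M i p) (axis 1 1) (axis 2 1))"

text \<open>The product \<open>M \<times> \<real>\<close> with the product metric.\<close>

definition prod_line :: "('a, 'e, 'i) riem \<Rightarrow> ('a \<times> real, 'e \<times> real, 'i) riem" where
  "prod_line M = \<lparr>
     charts = charts M,
     chart_dom = (\<lambda>i. chart_dom M i \<times> UNIV),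
     coord = (\<lambda>i (p, t). (coord M i p, t)),
     metric = (\<lambda>i (x, t) (v, a) (w, b). metric M i x v w + a * b)\<rparr>"

section \<open>Embedded surfaces with boundary\<close>

text \<open>
  \<open>S\<close> is the surface, \<open>B\<close> its boundary. A patch is a smooth immersion \<open>F\<close> of an open subset \<open>W\<close> of
  the plane which maps \<open>W \<inter> Q\<close> homeomorphically onto an open piece of \<open>S\<close>, where \<open>Q\<close> is the whole
  plane or a closed half plane. In the second case \<open>F\<close> extends \<open>S\<close> smoothly beyond its boundary.
\<close>

definition surface_patch ::
    "('a::topological_space, 'e::euclidean_space, 'i) riem \<Rightarrow> 'a set \<Rightarrow> 'a set \<Rightarrow>
     (real^2) set \<Rightarrow> 'i \<Rightarrow> (real^2) set \<Rightarrow> (real^2 \<Rightarrow> 'a) \<Rightarrow> bool" where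
  "surface_patch P S B Q i W F \<longleftrightarrow>
     Q \<in> {UNIV, {x. 0 \<le> x $ 1}} \<and> i \<in> charts P \<and> open W \<and> F ` W \<subseteq> chart_dom P i \<and>
     smooth_on W (coord P i \<circ> F) \<and>
     (\<forall>x\<in>W. inj (frechet_derivative (coord P i \<circ> F) (at x))) \<and>
     (\<exists>U G. open U \<and> homeomorphism (W \<inter> Q) (S \<inter> U) F G \<and> F ` (W \<inter> frontier Q) = B \<inter> U)"

definition smooth_surface ::
    "('a::topological_space, 'e::euclidean_space, 'i) riem \<Rightarrow> 'a set \<Rightarrow> 'a set \<Rightarrow> bool" where
  "smooth_surface P S B \<longleftrightarrow> B \<subseteq> S \<and>
     (\<forall>q\<in>S. \<exists>Q i W F. surface_patch P S B Q i W F \<and> q \<in> F ` (W \<inter> Q))"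

text \<open>
  In a surface, a regular domain is an embedded surface with smooth boundary, of codimension zero.
\<close>

definition compact_regular_domain ::
    "('a::topological_space, real^2, 'i) riem \<Rightarrow> 'a set \<Rightarrow> bool" where
  "compact_regular_domain M \<Omega> \<longleftrightarrow>
     compact \<Omega> \<and> connected \<Omega> \<and> \<Omega> \<noteq> {} \<and> smooth_surface M \<Omega> (frontier \<Omega>)"

text \<open>
  \<open>N i q\<close> are the components in chart \<open>i\<close> of a vector at \<open>q\<close>. A continuous unit normal to a smooth
  surface is automatically smooth, up to the boundary.
\<close>

definition unit_normal_field ::
    "('a::topological_space, 'e::euclidean_space, 'i) riem \<Rightarrow> 'a set \<Rightarrow> 'a set \<Rightarrow>
     ('i \<Rightarrow> 'a \<Rightarrow> 'e) \<Rightarrow> bool" where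
  "unit_normal_field P S B N \<longleftrightarrow>
     (\<forall>i\<in>charts P. continuous_on (S \<inter> chart_dom P i) (N i)) \<and>
     (\<forall>i\<in>charts P. \<forall>j\<in>charts P. \<forall>q\<in>S \<inter> chart_dom P i \<inter> chart_dom P j.
        N j q = frechet_derivative (transition P i j) (at (coord P i q)) (N i q)) \<and>
     (\<forall>i\<in>charts P. \<forall>q\<in>S \<inter> chart_dom P i. metric P i (coord P i q) (N i q) (N i q) = 1) \<and>
     (\<forall>Q i W F. surface_patch P S B Q i W F \<longrightarrow> (\<forall>x\<in>W \<inter> Q. \<forall>v.
        metric P i (coord P i (F x)) (N i (F x))
          (frechet_derivative (coord P i \<circ> F) (at x) v) = 0))"

text \<open>
  \<open>A\<close> is the shape operator \<open>-\<nabla>N\<close> at \<open>F x\<close>, expressed in the basis of the tangent plane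
  given by the parametrisation \<open>F\<close>.
\<close>

definition is_shape_operator ::
    "('a, 'e::euclidean_space, 'i) riem \<Rightarrow> ('i \<Rightarrow> 'a \<Rightarrow> 'e) \<Rightarrow> 'i \<Rightarrow> (real^2 \<Rightarrow> 'a) \<Rightarrow> real^2 \<Rightarrow>
     (real^2 \<Rightarrow> real^2) \<Rightarrow> bool" where
  "is_shape_operator P N i F x A \<longleftrightarrow> linear A \<and>
     (\<lambda>y. N i (F y)) differentiable (at x) \<and>
     (\<forall>v. frechet_derivative (coord P i \<circ> F) (at x) (A v) =
        - (frechet_derivative (\<lambda>y. N i (F y)) (at x) v +
           christoffel P i (coord P i (F x))
             (frechet_derivative (coord P i \<circ> F) (at x) v) (N i (F x))))"

text \<open>On the boundary the mean curvature is determined by continuity.\<close>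

definition has_constant_mean_curvature ::
    "('a::topological_space, 'e::euclidean_space, 'i) riem \<Rightarrow> 'a set \<Rightarrow> 'a set \<Rightarrow>
     ('i \<Rightarrow> 'a \<Rightarrow> 'e) \<Rightarrow> real \<Rightarrow> bool" where
  "has_constant_mean_curvature P S B N H \<longleftrightarrow>
     (\<forall>Q i W F. surface_patch P S B Q i W F \<longrightarrow> (\<forall>x\<in>W \<inter> interior Q.
        \<exists>A. is_shape_operator P N i F x A \<and> trace (matrix A) / 2 = H))"

section \<open>Graphs in \<open>M \<times> \<real>\<close>\<close>

definition graph_over :: "'a set \<Rightarrow> ('a \<Rightarrow> real) \<Rightarrow> ('a \<times> real) set" where
  "graph_over \<Omega> u = (\<lambda>p. (p, u p)) ` \<Omega>"

definition height :: "'a \<times> real \<Rightarrow> real" where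
  "height = snd"

text \<open>
  \<open>u\<close> need not be smooth on the boundary of \<open>\<Omega>\<close>: the surface is, but its tangent planes there may
  be vertical.
\<close>

definition H_graph ::
    "('a::topological_space, real^2, 'i) riem \<Rightarrow> real \<Rightarrow> 'a set \<Rightarrow> ('a \<Rightarrow> real) \<Rightarrow>
     ('i \<Rightarrow> 'a \<times> real \<Rightarrow> (real^2) \<times> real) \<Rightarrow> bool" where
  "H_graph M H \<Omega> u N \<longleftrightarrow>
     continuous_on \<Omega> u \<and>
     (\<forall>i\<in>charts M. smooth_on (coord M i ` (chart_dom M i \<inter> interior \<Omega>)) (u \<circ> param M i)) \<and>
     smooth_surface (prod_line M) (graph_over \<Omega> u) (graph_over (frontier \<Omega>) u) \<and>
     unit_normal_field (prod_line M) (graph_over \<Omega> u) (graph_over (frontier \<Omega>) u) N \<and>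
     has_constant_mean_curvature (prod_line M) (graph_over \<Omega> u) (graph_over (frontier \<Omega>) u) N H"

text \<open>The vertical field \<open>\<partial>\<^sub>t\<close> has components \<open>(0, 1)\<close> in every chart.\<close>

definition angle_function ::
    "('a, real^2, 'i) riem \<Rightarrow> ('i \<Rightarrow> 'a \<times> real \<Rightarrow> (real^2) \<times> real) \<Rightarrow> 'a \<times> real \<Rightarrow> real" where
  "angle_function M N q = (let P = prod_line M; i = chart_at P q
     in metric P i (coord P i q) (N i q) (0, 1))"

section \<open>Geodesic curvature of the boundary of a domain\<close>

definition velocity ::
    "('a, 'e::euclidean_space, 'i) riem \<Rightarrow> 'i \<Rightarrow> (real \<Rightarrow> 'a) \<Rightarrow> real \<Rightarrow> 'e" where
  "velocity M i \<gamma> t = vector_derivative (coord M i \<circ> \<gamma>) (at t)"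

definition acceleration ::
    "('a, 'e::euclidean_space, 'i) riem \<Rightarrow> 'i \<Rightarrow> (real \<Rightarrow> 'a) \<Rightarrow> real \<Rightarrow> 'e" where
  "acceleration M i \<gamma> t = vector_derivative (velocity M i \<gamma>) (at t) +
     christoffel M i (coord M i (\<gamma> t)) (velocity M i \<gamma> t) (velocity M i \<gamma> t)"

definition unit_speed_curve ::
    "('a::topological_space, 'e::euclidean_space, 'i) riem \<Rightarrow> real set \<Rightarrow> (real \<Rightarrow> 'a) \<Rightarrow> bool" where
  "unit_speed_curve M J \<gamma> \<longleftrightarrow> open J \<and> continuous_on J \<gamma> \<and>
     (\<forall>i\<in>charts M. smooth_on (J \<inter> \<gamma> -` chart_dom M i) (coord M i \<circ> \<gamma>) \<and>
        (\<forall>t\<in>J \<inter> \<gamma> -` chart_dom M i.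
           metric M i (coord M i (\<gamma> t)) (velocity M i \<gamma> t) (velocity M i \<gamma> t) = 1))"

text \<open>
  For a vector transversal to the boundary, pointing out of \<open>\<Omega>\<close> means that moving in its direction
  one leaves \<open>\<Omega>\<close>.
\<close>

definition outer_unit_normal ::
    "('a, 'e::euclidean_space, 'i) riem \<Rightarrow> 'a set \<Rightarrow> 'i \<Rightarrow> (real \<Rightarrow> 'a) \<Rightarrow> real \<Rightarrow> 'e \<Rightarrow> bool" where
  "outer_unit_normal M \<Omega> i \<gamma> t n \<longleftrightarrow>
     metric M i (coord M i (\<gamma> t)) n n = 1 \<and>
     metric M i (coord M i (\<gamma> t)) n (velocity M i \<gamma> t) = 0 \<and>
     (\<forall>\<^sub>F s in at_right 0. param M i (coord M i (\<gamma> t) + s *\<^sub>R n) \<notin> \<Omega>)"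

text \<open>
  The geodesic curvature of the boundary of \<open>\<Omega>\<close> at \<open>p\<close> with respect to the outer conormal is \<open>k\<close>.
  For a regular domain in a surface there is exactly one such \<open>k\<close> at every boundary point; it
  depends neither on the unit speed parametrisation nor on the chart.
\<close>

definition has_boundary_geodesic_curvature ::
    "('a::topological_space, real^2, 'i) riem \<Rightarrow> 'a set \<Rightarrow> 'a \<Rightarrow> real \<Rightarrow> bool" where
  "has_boundary_geodesic_curvature M \<Omega> p k \<longleftrightarrow>
     (\<exists>J \<gamma> t i n. unit_speed_curve M J \<gamma> \<and> \<gamma> ` J \<subseteq> frontier \<Omega> \<and> t \<in> J \<and> \<gamma> t = p \<and>
        i \<in> charts M \<and> p \<in> chart_dom M i \<and> outer_unit_normal M \<Omega> i \<gamma> t n \<and>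
        k = metric M i (coord M i p) (acceleration M i \<gamma> t) n)"

section \<open>The constant bounding the height\<close>

definition height_const :: "real \<Rightarrow> real \<Rightarrow> real \<Rightarrow> real" where
  "height_const c H \<nu>0 =
     (if c < 0 then
        4 * H / sqrt (- 4 * c * H\<^sup>2 - c\<^sup>2) *
          (arctan (sqrt (- c) / sqrt (c + 4 * H\<^sup>2)) +
           arctan (\<nu>0 * sqrt (- c) / sqrt (c + 4 * H\<^sup>2)))
      else if c = 0 then (1 + \<nu>0) / H
      else
        4 * H / sqrt (4 * c * H\<^sup>2 + c\<^sup>2) *
          (artanh (sqrt c / sqrt (c + 4 * H\<^sup>2)) +
           artanh (\<nu>0 * sqrt c / sqrt (c + 4 * H\<^sup>2))))"

end

theory Submission
  imports Defs
begin

text \<open>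
  Let \<open>f\<close> be the odd function with \<open>f'(t) = 4H / (4H\<^sup>2 + c (1 - t\<^sup>2))\<close>, so that the height constant is
  \<open>f(\<nu>0) + f(1)\<close>, and let \<open>\<psi> = h + m f(\<nu>)\<close>. The equations \<open>\<Delta>h = 2H\<nu>\<close> and
  \<open>\<Delta>\<nu> = - (|A|\<^sup>2 + K (1 - \<nu>\<^sup>2)) \<nu>\<close> give, at a critical point of \<open>\<psi>\<close> with \<open>-1 < \<nu> < 0\<close>,
  \<open>\<Delta>\<psi> \<ge> - 2H\<nu> (1 - m) (1 - 2m) / m\<close>, where \<open>\<nabla>h\<close> is a principal direction. For
  \<open>m < 1/2\<close> this is positive, so \<open>\<psi>\<close> attains its maximum over the boundary or where \<open>\<nu> = -1\<close>; in
  the latter case the height bound applies. Hence \<open>\<psi> \<le> m f(\<nu>0)\<close>, with equality over the boundary,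
  and the sign of the conormal derivative of \<open>\<psi>\<close> there is the curvature estimate. The second
  statement is the first one with \<open>m\<close> chosen such that the bound is nonnegative.
\<close>

section \<open>Smooth maps\<close>

text \<open>For c = 0 the constants can be read off models: f(t) = t / H, a round sphere of radius
  1/H has h + f(\<nu>) constant, and a horizontal cylinder of radius 1/(2H) has h + f(\<nu>)/2
  constant. These are the two zeros m = 1 and m = 1/2 of (1 - m)(1 - 2m). Since strictness is lost
  at m = 1/2, that value is reached as a limit from below. The obstacle is the boundary. The normal
  is only known to be continuous there and the tangent plane may be vertical, so neither the graph
  function nor \<nu> can be differentiated at boundary points. Interior computations are therefore
  made over the base, for the graph function in a chart; boundary computations are made in a patch,
  and derivatives of \<nu> enter only through continuous extensions. At a critical point the Hessian
  does not depend on the connection, so all second derivatives are taken with the base connection,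
  although they are traced with the induced metric. If \<open>\<nu>0 = 0\<close>, then \<nu> could
  approach 0 through positive values near a part of the boundary. The reflection of the vertical
  axis turns this into the case \<nu> < 0, provided that the height is bounded from below as
  well.\<close>

abbreviation fd :: "('a::real_normed_vector \<Rightarrow> 'b::real_normed_vector) \<Rightarrow> 'a \<Rightarrow> 'a \<Rightarrow> 'b" where
  "fd f x \<equiv> frechet_derivative f (at x)"

lemma fd_has_derivative: "f differentiable (at x) \<Longrightarrow> (f has_derivative fd f x) (at x)"
  by (simp add: frechet_derivative_works)

lemma fd_eq: "(f has_derivative f') (at x) \<Longrightarrow> fd f x = f'"
  by (rule frechet_derivative_at[symmetric])

lemma fd_linear: "f differentiable (at x) \<Longrightarrow> linear (fd f x)"
  by (rule linear_frechet_derivative)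

lemma fd_cong:
  assumes "open S" "x \<in> S" "\<And>y. y \<in> S \<Longrightarrow> f y = g y" "f differentiable (at x)"
  shows "fd f x = fd g x"
  using frechet_derivative_transform_within_open[OF assms(4,1,2)] assms(3) by blast

lemma differentiable_cong_open:
  assumes "open S" "x \<in> S" "\<And>y. y \<in> S \<Longrightarrow> f y = g y" "f differentiable (at x)"
  shows "g differentiable (at x)"
  using assms has_derivative_transform_within_open unfolding differentiable_def by metis

lemma Ck_on_cong:
  assumes "open S" "\<And>x. x \<in> S \<Longrightarrow> f x = g x" "Ck_on k S f"
  shows "Ck_on k S g"
  using assms(2,3)
proof (induction k arbitrary: f g)
  case 0
  then show ?case using continuous_on_cong[of S S f g] by auto
next
  case (Suc k)
  have 1: "g differentiable (at x)" if "x \<in> S" for x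
    using differentiable_cong_open[OF assms(1) that] Suc.prems that by (metis Ck_on.simps(2))
  have 2: "fd f x = fd g x" if "x \<in> S" for x
    by (rule fd_cong[OF assms(1) that Suc.prems(1)]) (use Suc.prems that in auto)
  have "Ck_on k S (\<lambda>x. fd g x v)" for v
    by (rule Suc.IH[of "\<lambda>x. fd f x v"]) (use Suc.prems(2) 2 in auto)
  then show ?case using 1 by auto
qed

lemma Ck_on_subset: "Ck_on k S f \<Longrightarrow> T \<subseteq> S \<Longrightarrow> Ck_on k T f"
  by (induction k arbitrary: f) (auto intro: continuous_on_subset)

lemma Ck_on_Suc_imp: "Ck_on (Suc k) S f \<Longrightarrow> Ck_on k S f"
proof (induction k arbitrary: f)
  case 0
  then show ?case
    by (auto simp: continuous_on_eq_continuous_within 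
        intro!: differentiable_imp_continuous_within intro: differentiable_at_withinI)
next
  case (Suc k)
  then show ?case by (metis Ck_on.simps(2))
qed

lemma Ck_on_const [simp]: "Ck_on k S (\<lambda>x. c)"
  by (induction k arbitrary: c) auto

lemma Ck_on_linear:
  assumes "open S" "bounded_linear L" "Ck_on k S f"
  shows "Ck_on k S (\<lambda>x. L (f x))"
  using assms(3)
proof (induction k arbitrary: f)
  case 0
  then show ?case using bounded_linear.continuous_on[OF assms(2)] by auto
next
  case (Suc k)
  have d: "((\<lambda>x. L (f x)) has_derivative (\<lambda>v. L (fd f x v))) (at x)" if "x \<in> S" for x
    using bounded_linear.has_derivative[OF assms(2) fd_has_derivative] Suc.prems that by auto
  have "Ck_on k S (\<lambda>x. fd (\<lambda>x. L (f x)) x v)" for v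
    by (rule Ck_on_cong[OF assms(1) _ Suc.IH[of "\<lambda>x. fd f x v"]])
      (use Suc.prems in \<open>auto simp: fd_eq[OF d]\<close>)
  then show ?case using d by (auto simp: differentiable_def)
qed

lemma Ck_on_add:
  assumes "open S" "Ck_on k S f" "Ck_on k S g"
  shows "Ck_on k S (\<lambda>x. f x + g x)"
  using assms(2,3)
proof (induction k arbitrary: f g)
  case 0
  then show ?case by (auto intro: continuous_on_add)
next
  case (Suc k)
  have d: "((\<lambda>x. f x + g x) has_derivative (\<lambda>v. fd f x v + fd g x v)) (at x)" if "x \<in> S" for x
    using Suc.prems that by (intro has_derivative_add fd_has_derivative) auto
  have "Ck_on k S (\<lambda>x. fd (\<lambda>x. f x + g x) x v)" for v
    by (rule Ck_on_cong[OF assms(1) _ Suc.IH[of "\<lambda>x. fd f x v" "\<lambda>x. fd g x v"]])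
      (use Suc.prems in \<open>auto simp: fd_eq[OF d]\<close>)
  then show ?case using d by (auto simp: differentiable_def)
qed

lemma Ck_on_bilinear:
  assumes "open S" "bounded_bilinear B" "Ck_on k S f" "Ck_on k S g"
  shows "Ck_on k S (\<lambda>x. B (f x) (g x))"
  using assms(3,4)
proof (induction k arbitrary: f g)
  case 0
  then show ?case by (auto intro: bounded_bilinear.continuous_on[OF assms(2)])
next
  case (Suc k)
  have d: "((\<lambda>x. B (f x) (g x)) has_derivative (\<lambda>v. B (f x) (fd g x v) + B (fd f x v) (g x))) (at x)"
    if "x \<in> S" for x
    using Suc.prems that by (intro bounded_bilinear.FDERIV[OF assms(2)] fd_has_derivative) auto
  have "Ck_on k S (\<lambda>x. fd (\<lambda>x. B (f x) (g x)) x v)" for v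
  proof (rule Ck_on_cong[OF assms(1)])
    show "Ck_on k S (\<lambda>x. B (f x) (fd g x v) + B (fd f x v) (g x))"
      using Suc.prems by (intro Ck_on_add[OF assms(1)] Suc.IH) (auto intro: Ck_on_Suc_imp)
  qed (auto simp: fd_eq[OF d])
  then show ?case using d by (auto simp: differentiable_def)
qed

lemma Ck_on_sum:
  assumes "open S" "\<And>i. i \<in> I \<Longrightarrow> Ck_on k S (f i)"
  shows "Ck_on k S (\<lambda>x. \<Sum>i\<in>I. f i x)"
  using assms(2) by (induction I rule: infinite_finite_induct) (auto intro: Ck_on_add[OF assms(1)])

lemma linear_basis_expand:
  fixes f :: "'a::euclidean_space \<Rightarrow> 'b::real_vector"
  assumes "linear f"
  shows "f v = (\<Sum>b\<in>Basis. (v \<bullet> b) *\<^sub>R f b)"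
proof -
  have "f v = f (\<Sum>b\<in>Basis. (v \<bullet> b) *\<^sub>R b)" by (simp add: euclidean_representation)
  also have "\<dots> = (\<Sum>b\<in>Basis. (v \<bullet> b) *\<^sub>R f b)"
    by (simp add: linear_sum[OF assms] linear_scale[OF assms])
  finally show ?thesis .
qed

lemma Ck_on_compose:
  fixes f :: "'a::euclidean_space \<Rightarrow> 'b::euclidean_space"
  assumes "open S" "open T" "f ` S \<subseteq> T" "Ck_on k S f" "Ck_on k T h"
  shows "Ck_on k S (\<lambda>x. h (f x))"
  using assms(4,5)
proof (induction k arbitrary: h)
  case 0
  then show ?case using assms(3) continuous_on_compose2 by (metis Ck_on.simps(1))
next
  case (Suc k)
  have d: "((\<lambda>x. h (f x)) has_derivative (\<lambda>v. fd h (f x) (fd f x v))) (at x)" if "x \<in> S" for x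
    using has_derivative_compose[OF fd_has_derivative fd_has_derivative, of f x h] Suc.prems that assms(3)
    by (auto simp: image_subset_iff)
  have "Ck_on k S (\<lambda>x. fd (\<lambda>x. h (f x)) x v)" for v
  proof (rule Ck_on_cong[OF assms(1)])
    \<comment> \<open>The definition of \<open>Ck_on\<close> speaks of derivatives in fixed
      directions only. Expanding the moving direction \<open>fd f x v\<close> in the basis leaves
      fixed directions with smooth coefficients.\<close>
    show "Ck_on k S (\<lambda>x. \<Sum>b\<in>Basis. (fd f x v \<bullet> b) *\<^sub>R fd h (f x) b)"
      using Suc.prems
      by (intro Ck_on_sum Ck_on_bilinear[OF assms(1) bounded_bilinear_scaleR]
          Ck_on_linear[OF assms(1) bounded_linear_inner_left] Suc.IH assms(1))
        (auto intro: Ck_on_Suc_imp)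
    show "(\<Sum>b\<in>Basis. (fd f x v \<bullet> b) *\<^sub>R fd h (f x) b) = fd (\<lambda>x. h (f x)) x v" if "x \<in> S" for x
      using fd_eq[OF d[OF that]] linear_basis_expand[OF fd_linear, of h "f x" "fd f x v"]
        Suc.prems that assms(3) by auto
  qed
  then show ?case using d by (auto simp: differentiable_def)
qed

text \<open>The derivative is a multiple of the square of the function itself, so the induction
  hypothesis applies to it.\<close>

lemma Ck_on_inverse_real: "Ck_on k (- {0}) (inverse :: real \<Rightarrow> real)"
proof (induction k)
  case 0
  then show ?case by (auto intro!: continuous_intros)
next
  case (Suc k)
  have op: "open (- {0::real})" by (simp add: open_Compl)
  have d: "(inverse has_derivative (\<lambda>v. - (inverse x * v * inverse x))) (at x)" if "x \<noteq> 0" for x :: real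
    using has_derivative_inverse'[OF that] .
  have "Ck_on k (- {0}) (\<lambda>x. fd inverse x v)" for v :: real
  proof (rule Ck_on_cong[OF op])
    show "Ck_on k (- {0}) (\<lambda>x. (- v) * (inverse x * inverse x :: real))"
      using Suc by (intro Ck_on_linear[OF op bounded_linear_mult_right]
          Ck_on_bilinear[OF op bounded_bilinear_mult])
  qed (auto simp: fd_eq[OF d])
  then show ?case using d by (auto simp: differentiable_def)
qed

lemma Ck_on_sqrt: "Ck_on k {0<..} sqrt"
proof (induction k)
  case 0
  then show ?case by (auto intro!: continuous_intros)
next
  case (Suc k)
  have d: "(sqrt has_derivative (*) (inverse (sqrt x) / 2)) (at x)" if "x > 0" for x :: real
    using DERIV_real_sqrt[OF that] by (simp add: has_field_derivative_def)
  have "Ck_on k {0<..} (\<lambda>x. fd sqrt x v)" for v :: real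
  proof (rule Ck_on_cong)
    have "Ck_on k {0<..} (\<lambda>x. inverse (sqrt x))"
      by (rule Ck_on_compose[OF _ _ _ Suc Ck_on_inverse_real]) (auto simp: open_Compl)
    then show "Ck_on k {0<..} (\<lambda>x. (v / 2) * inverse (sqrt x))"
      by (intro Ck_on_linear[OF _ bounded_linear_mult_right]) auto
  qed (auto simp: fd_eq[OF d])
  then show ?case using d by (auto simp: differentiable_def)
qed

lemma smooth_on_differentiable: "smooth_on S f \<Longrightarrow> x \<in> S \<Longrightarrow> f differentiable (at x)"
  unfolding smooth_on_def by (metis Ck_on.simps(2))

lemma smooth_on_fd: "smooth_on S f \<Longrightarrow> smooth_on S (\<lambda>x. fd f x v)"
  unfolding smooth_on_def by (metis Ck_on.simps(2))

lemma smooth_on_has_derivative: "smooth_on S f \<Longrightarrow> x \<in> S \<Longrightarrow> (f has_derivative fd f x) (at x)"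
  by (rule fd_has_derivative[OF smooth_on_differentiable])

lemma smooth_on_continuous_on: "smooth_on S f \<Longrightarrow> continuous_on S f"
  unfolding smooth_on_def by (metis Ck_on.simps(1))

lemma smooth_on_subset: "smooth_on S f \<Longrightarrow> T \<subseteq> S \<Longrightarrow> smooth_on T f"
  unfolding smooth_on_def by (metis Ck_on_subset)

lemma smooth_on_cong: "open S \<Longrightarrow> smooth_on S f \<Longrightarrow> (\<And>x. x \<in> S \<Longrightarrow> f x = g x) \<Longrightarrow> smooth_on S g"
  unfolding smooth_on_def by (metis Ck_on_cong)

lemma smooth_on_const: "smooth_on S (\<lambda>x. c)"
  by (simp add: smooth_on_def)

lemma smooth_on_linear: "open S \<Longrightarrow> bounded_linear L \<Longrightarrow> smooth_on S f \<Longrightarrow> smooth_on S (\<lambda>x. L (f x))"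
  by (simp add: smooth_on_def Ck_on_linear)

lemma smooth_on_id: "open S \<Longrightarrow> smooth_on S (\<lambda>x. x)"
proof -
  assume "open S"
  have "Ck_on k S (\<lambda>x. x)" for k
    by (cases k) (auto intro: continuous_on_id)
  then show ?thesis by (simp add: smooth_on_def)
qed

lemma smooth_on_add:
  "open S \<Longrightarrow> smooth_on S f \<Longrightarrow> smooth_on S g \<Longrightarrow> smooth_on S (\<lambda>x. f x + g x)"
  by (simp add: smooth_on_def Ck_on_add)

lemma smooth_on_minus: "open S \<Longrightarrow> smooth_on S f \<Longrightarrow> smooth_on S (\<lambda>x. - f x)"
  by (rule smooth_on_linear) (auto intro: bounded_linear_minus bounded_linear_ident)

lemma smooth_on_diff:
  assumes "open S" "smooth_on S f" "smooth_on S g"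
  shows "smooth_on S (\<lambda>x. f x - g x)"
  using smooth_on_add[OF assms(1,2) smooth_on_minus[OF assms(1,3)]] by simp

lemma smooth_on_mult:
  fixes f g :: "_ \<Rightarrow> real"
  shows "open S \<Longrightarrow> smooth_on S f \<Longrightarrow> smooth_on S g \<Longrightarrow> smooth_on S (\<lambda>x. f x * g x)"
  by (simp add: smooth_on_def Ck_on_bilinear[OF _ bounded_bilinear_mult])

lemma smooth_on_scaleR:
  "open S \<Longrightarrow> smooth_on S f \<Longrightarrow> smooth_on S g \<Longrightarrow> smooth_on S (\<lambda>x. f x *\<^sub>R g x)"
  by (simp add: smooth_on_def Ck_on_bilinear[OF _ bounded_bilinear_scaleR])

lemma smooth_on_sum:
  "open S \<Longrightarrow> (\<And>i. i \<in> I \<Longrightarrow> smooth_on S (f i)) \<Longrightarrow> smooth_on S (\<lambda>x. \<Sum>i\<in>I. f i x)"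
  by (simp add: smooth_on_def Ck_on_sum)

lemma smooth_on_compose:
  fixes f :: "'a::euclidean_space \<Rightarrow> 'b::euclidean_space"
  shows "open S \<Longrightarrow> open T \<Longrightarrow> smooth_on S f \<Longrightarrow> smooth_on T h \<Longrightarrow> f ` S \<subseteq> T \<Longrightarrow>
    smooth_on S (\<lambda>x. h (f x))"
  by (simp add: smooth_on_def Ck_on_compose)

lemma smooth_on_inverse:
  fixes f :: "_ \<Rightarrow> real"
  assumes "open S" "smooth_on S f" "\<And>x. x \<in> S \<Longrightarrow> f x \<noteq> 0"
  shows "smooth_on S (\<lambda>x. inverse (f x))"
  by (rule smooth_on_compose[where T = "- {0}"])
    (use assms Ck_on_inverse_real in \<open>auto simp: smooth_on_def open_Compl\<close>)

lemma smooth_on_divide: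
  fixes f g :: "_ \<Rightarrow> real"
  assumes "open S" "smooth_on S f" "smooth_on S g" "\<And>x. x \<in> S \<Longrightarrow> g x \<noteq> 0"
  shows "smooth_on S (\<lambda>x. f x / g x)"
  using smooth_on_mult[OF assms(1,2) smooth_on_inverse[OF assms(1,3,4)]] by (simp add: divide_inverse)

lemma smooth_on_sqrt:
  fixes f :: "_ \<Rightarrow> real"
  assumes "open S" "smooth_on S f" "\<And>x. x \<in> S \<Longrightarrow> f x > 0"
  shows "smooth_on S (\<lambda>x. sqrt (f x))"
  by (rule smooth_on_compose[where T = "{0<..}"])
    (use assms Ck_on_sqrt in \<open>auto simp: smooth_on_def\<close>)

lemma smooth_on_Pair:
  assumes "open S" "smooth_on S f" "smooth_on S g"
  shows "smooth_on S (\<lambda>x. (f x, g x))"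
proof -
  have "smooth_on S (\<lambda>x. (f x, 0) + (0, g x))"
    by (intro smooth_on_add smooth_on_linear[where L = "\<lambda>y. (y, 0)"]
        smooth_on_linear[where L = "\<lambda>y. (0, y)"] assms
        bounded_linear_Pair bounded_linear_ident bounded_linear_zero)
  then show ?thesis by simp
qed

lemmas smooth_intros = smooth_on_const smooth_on_id smooth_on_add smooth_on_minus smooth_on_diff
  smooth_on_mult smooth_on_scaleR smooth_on_sum smooth_on_inverse smooth_on_divide smooth_on_sqrt
  smooth_on_Pair smooth_on_fd

text \<open>Schwarz: both mixed derivatives are limits of the same second difference quotient.\<close>

lemma second_difference:
  fixes f :: "'a::euclidean_space \<Rightarrow> real"
  assumes S: "smooth_on S f" and t: "t > 0"
    and sub: "\<And>a b. 0 \<le> a \<Longrightarrow> a \<le> t \<Longrightarrow> 0 \<le> b \<Longrightarrow> b \<le> t \<Longrightarrow> x + a *\<^sub>R u + b *\<^sub>R v \<in> S"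
  obtains a b where "0 \<le> a" "a \<le> t" "0 \<le> b" "b \<le> t"
    "f (x + t *\<^sub>R u + t *\<^sub>R v) - f (x + t *\<^sub>R u) - f (x + t *\<^sub>R v) + f x =
      t\<^sup>2 * fd (\<lambda>y. fd f y u) (x + a *\<^sub>R u + b *\<^sub>R v) v"
proof -
  \<comment> \<open>The second difference is the increment of \<open>\<phi>\<close> over the
    interval from 0 to \<open>t\<close>. The mean value theorem in direction \<open>u\<close>, and
    then in direction \<open>v\<close>, produces the intermediate point.\<close>
  define \<phi> where "\<phi> s = f (x + s *\<^sub>R u + t *\<^sub>R v) - f (x + s *\<^sub>R u)" for s
  have d1: "((\<lambda>s. f (x + s *\<^sub>R u + b *\<^sub>R v)) has_real_derivative fd f (x + s *\<^sub>R u + b *\<^sub>R v) u) (at s)"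
    if "0 \<le> s" "s \<le> t" "0 \<le> b" "b \<le> t" for s b
  proof -
    have lin: "linear (fd f (x + s *\<^sub>R u + b *\<^sub>R v))"
      by (rule fd_linear[OF smooth_on_differentiable[OF S sub[OF that]]])
    have "((\<lambda>s. f (x + s *\<^sub>R u + b *\<^sub>R v)) has_derivative
        (\<lambda>h. fd f (x + s *\<^sub>R u + b *\<^sub>R v) (h *\<^sub>R u))) (at s)"
      by (rule has_derivative_compose[of "\<lambda>s. x + s *\<^sub>R u + b *\<^sub>R v" "\<lambda>h. h *\<^sub>R u" s UNIV f])
        (auto intro!: derivative_eq_intros smooth_on_has_derivative[OF S sub[OF that]])
    then show ?thesis
      by (simp add: has_field_derivative_def linear_scale[OF lin] mult_commute_abs)
  qed
  have "(\<phi> has_real_derivative fd f (x + s *\<^sub>R u + t *\<^sub>R v) u - fd f (x + s *\<^sub>R u) u) (at s)"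
    if "0 \<le> s" "s \<le> t" for s
    unfolding \<phi>_def using DERIV_diff[OF d1[OF that, of t] d1[OF that, of 0]] t by simp
  from MVT2[OF t this] obtain a where a: "0 < a" "a < t"
    "\<phi> t - \<phi> 0 = t * (fd f (x + a *\<^sub>R u + t *\<^sub>R v) u - fd f (x + a *\<^sub>R u) u)"
    by auto
  have d2: "((\<lambda>s. fd f (x + a *\<^sub>R u + s *\<^sub>R v) u) has_real_derivative
      fd (\<lambda>y. fd f y u) (x + a *\<^sub>R u + s *\<^sub>R v) v) (at s)" if "0 \<le> s" "s \<le> t" for s
  proof -
    have *: "x + a *\<^sub>R u + s *\<^sub>R v \<in> S" using a that by (intro sub) auto
    have lin: "linear (fd (\<lambda>y. fd f y u) (x + a *\<^sub>R u + s *\<^sub>R v))"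
      by (rule fd_linear[OF smooth_on_differentiable[OF smooth_on_fd[OF S] *]])
    have "((\<lambda>s. fd f (x + a *\<^sub>R u + s *\<^sub>R v) u) has_derivative
        (\<lambda>h. fd (\<lambda>y. fd f y u) (x + a *\<^sub>R u + s *\<^sub>R v) (h *\<^sub>R v))) (at s)"
      by (rule has_derivative_compose[of "\<lambda>s. x + a *\<^sub>R u + s *\<^sub>R v" "\<lambda>h. h *\<^sub>R v" s UNIV "\<lambda>y. fd f y u"])
        (auto intro!: derivative_eq_intros smooth_on_has_derivative[OF smooth_on_fd[OF S] *])
    then show ?thesis
      by (simp add: has_field_derivative_def linear_scale[OF lin] mult_commute_abs)
  qed
  from MVT2[OF t d2] obtain b where b: "0 < b" "b < t"
    "fd f (x + a *\<^sub>R u + t *\<^sub>R v) u - fd f (x + a *\<^sub>R u) u =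
      t * fd (\<lambda>y. fd f y u) (x + a *\<^sub>R u + b *\<^sub>R v) v"
    by auto
  show ?thesis
    by (rule that[of a b]) (use a b in \<open>auto simp: \<phi>_def power2_eq_square algebra_simps\<close>)
qed

lemma fd_fd_commute_real:
  fixes f :: "'a::euclidean_space \<Rightarrow> real"
  assumes S: "open S" "smooth_on S f" "x \<in> S"
  shows "fd (\<lambda>y. fd f y u) x v = fd (\<lambda>y. fd f y v) x u"
proof -
  define E where "E u v y = fd (\<lambda>y. fd f y u) y v" for u v y
  have cont: "continuous_on S (E u v)" for u v
    unfolding E_def by (intro smooth_on_continuous_on smooth_on_fd S)
  have "\<bar>E u v x - E v u x\<bar> < \<epsilon>" if "\<epsilon> > 0" for \<epsilon>
  proof -
    have "\<exists>d>0. \<forall>y. dist y x < d \<longrightarrow> y \<in> S \<and> \<bar>E u v y - E u v x\<bar> < \<epsilon> / 2" for u v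
    proof -
      obtain d1 where d1: "d1 > 0" "\<forall>y\<in>S. dist y x < d1 \<longrightarrow> dist (E u v y) (E u v x) < \<epsilon> / 2"
        using cont[of u v] S(3) half_gt_zero[OF \<open>\<epsilon> > 0\<close>] unfolding continuous_on_iff by meson
      obtain d2 where d2: "d2 > 0" "ball x d2 \<subseteq> S" using S openE by blast
      show ?thesis
        by (rule exI[of _ "min d1 d2"])
          (use d1 d2 in \<open>auto simp: dist_real_def ball_def dist_commute subset_iff\<close>)
    qed
    then obtain d1 d2 where d: "d1 > 0" "d2 > 0"
      "\<And>y. dist y x < d1 \<Longrightarrow> y \<in> S \<and> \<bar>E u v y - E u v x\<bar> < \<epsilon> / 2"
      "\<And>y. dist y x < d2 \<Longrightarrow> y \<in> S \<and> \<bar>E v u y - E v u x\<bar> < \<epsilon> / 2"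
      by metis
    \<comment> \<open>Chosen so that the parallelogram with sides \<open>t *\<^sub>R u\<close> and
      \<open>t *\<^sub>R v\<close> stays inside both discs of continuity; the summand 1 covers
      vanishing \<open>u\<close> and \<open>v\<close>.\<close>
    define t where "t = min d1 d2 / (2 * (norm u + norm v + 1))"
    have pos: "norm u + norm v + 1 > 0" by (smt (verit) norm_ge_zero)
    have t: "t > 0" using d pos by (simp add: t_def)
    have near: "dist (x + a *\<^sub>R u + b *\<^sub>R v) x < min d1 d2"
      if "0 \<le> a" "a \<le> t" "0 \<le> b" "b \<le> t" for a b
    proof -
      have "dist (x + a *\<^sub>R u + b *\<^sub>R v) x = norm (a *\<^sub>R u + b *\<^sub>R v)" by (simp add: dist_norm)
      also have "\<dots> \<le> a * norm u + b * norm v" using norm_triangle_ineq[of "a *\<^sub>R u" "b *\<^sub>R v"] that by simp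
      also have "\<dots> \<le> t * norm u + t * norm v" using that by (intro add_mono mult_right_mono) auto
      also have "\<dots> < t * (2 * (norm u + norm v + 1))"
        using t by (simp add: algebra_simps) (smt (verit) mult_nonneg_nonneg norm_ge_zero)
      also have "\<dots> = min d1 d2" using pos unfolding t_def by (simp add: field_simps)
      finally show ?thesis .
    qed
    have sub1: "x + a *\<^sub>R u + b *\<^sub>R v \<in> S" if "0 \<le> a" "a \<le> t" "0 \<le> b" "b \<le> t" for a b
      using near[OF that] d(3) by auto
    have sub2: "x + a *\<^sub>R v + b *\<^sub>R u \<in> S" if "0 \<le> a" "a \<le> t" "0 \<le> b" "b \<le> t" for a b
      using sub1[of b a] that by (simp add: ac_simps)
    obtain a b where ab: "0 \<le> a" "a \<le> t" "0 \<le> b" "b \<le> t"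
      "f (x + t *\<^sub>R u + t *\<^sub>R v) - f (x + t *\<^sub>R u) - f (x + t *\<^sub>R v) + f x =
        t\<^sup>2 * E u v (x + a *\<^sub>R u + b *\<^sub>R v)"
      using second_difference[OF S(2) t sub1] unfolding E_def by blast
    obtain a' b' where ab': "0 \<le> a'" "a' \<le> t" "0 \<le> b'" "b' \<le> t"
      "f (x + t *\<^sub>R v + t *\<^sub>R u) - f (x + t *\<^sub>R v) - f (x + t *\<^sub>R u) + f x =
        t\<^sup>2 * E v u (x + a' *\<^sub>R v + b' *\<^sub>R u)"
      using second_difference[OF S(2) t sub2] unfolding E_def by blast
    \<comment> \<open>Exchanging \<open>u\<close> and \<open>v\<close> does not change the second
      difference, so the two intermediate values agree. Each of them is within \<epsilon>/2 of the
      mixed derivative at \<open>x\<close>.\<close>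
    have eq: "E u v (x + a *\<^sub>R u + b *\<^sub>R v) = E v u (x + b' *\<^sub>R u + a' *\<^sub>R v)"
      using ab(5) ab'(5) t by (simp add: ac_simps algebra_simps)
    show ?thesis
      using d(3)[of "x + a *\<^sub>R u + b *\<^sub>R v"] d(4)[of "x + b' *\<^sub>R u + a' *\<^sub>R v"] near[OF ab(1-4)]
        near[OF ab'(3,4,1,2)] eq by (smt (verit) field_sum_of_halves min_less_iff_conj)
  qed
  then show ?thesis unfolding E_def by (metis abs_le_zero_iff dense_ge less_le_not_le linorder_not_le right_minus_eq)
qed

lemma fd_fd_commute:
  fixes f :: "'a::euclidean_space \<Rightarrow> 'b::euclidean_space"
  assumes S: "open S" "smooth_on S f" "x \<in> S"
  shows "fd (\<lambda>y. fd f y u) x v = fd (\<lambda>y. fd f y v) x u"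
proof (rule euclidean_eqI)
  fix b :: 'b assume "b \<in> Basis"
  have L: "bounded_linear (\<lambda>y::'b. y \<bullet> b)" by (rule bounded_linear_inner_left)
  have *: "fd (\<lambda>y. f y \<bullet> b) z w = fd f z w \<bullet> b" if "z \<in> S" for z w
    using fd_eq[OF bounded_linear.has_derivative[OF L smooth_on_has_derivative[OF S(2) that]]] by simp
  have **: "fd (\<lambda>y. fd (\<lambda>y. f y \<bullet> b) y u) x v = fd (\<lambda>y. fd f y u) x v \<bullet> b" for u v
  proof -
    have "((\<lambda>y. fd f y u \<bullet> b) has_derivative (\<lambda>v. fd (\<lambda>y. fd f y u) x v \<bullet> b)) (at x)"
      by (rule bounded_linear.has_derivative[OF L smooth_on_has_derivative[OF smooth_on_fd[OF S(2)] S(3)]])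
    then have "((\<lambda>y. fd (\<lambda>y. f y \<bullet> b) y u) has_derivative (\<lambda>v. fd (\<lambda>y. fd f y u) x v \<bullet> b)) (at x)"
      by (rule has_derivative_transform_within_open[OF _ S(1,3)]) (simp add: *)
    then show ?thesis by (simp add: fd_eq)
  qed
  show "fd (\<lambda>y. fd f y u) x v \<bullet> b = fd (\<lambda>y. fd f y v) x u \<bullet> b"
    using fd_fd_commute_real[OF S(1) smooth_on_linear[OF S(1) L S(2)] S(3), of u v] ** by simp
qed

section \<open>Bilinear families\<close>

lemma bilinear_basis_expand:
  fixes B :: "'a::euclidean_space \<Rightarrow> 'c::euclidean_space \<Rightarrow> 'b::real_vector"
  assumes "bilinear B"
  shows "B v w = (\<Sum>i\<in>Basis. \<Sum>j\<in>Basis. ((v \<bullet> i) * (w \<bullet> j)) *\<^sub>R B i j)"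
proof -
  have "B v w = (\<Sum>i\<in>Basis. (v \<bullet> i) *\<^sub>R B i w)"
    using linear_basis_expand[of "\<lambda>v. B v w" v] assms by (simp add: bilinear_def)
  also have "\<dots> = (\<Sum>i\<in>Basis. \<Sum>j\<in>Basis. ((v \<bullet> i) * (w \<bullet> j)) *\<^sub>R B i j)"
  proof (rule sum.cong[OF refl])
    fix i :: 'a
    have "B i w = (\<Sum>j\<in>Basis. (w \<bullet> j) *\<^sub>R B i j)"
      using linear_basis_expand[of "B i" w] assms by (simp add: bilinear_def)
    then show "(v \<bullet> i) *\<^sub>R B i w = (\<Sum>j\<in>Basis. ((v \<bullet> i) * (w \<bullet> j)) *\<^sub>R B i j)"
      by (simp add: scaleR_sum_right)
  qed
  finally show ?thesis .
qed

lemma fd_bilinear_family: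
  fixes B :: "'e::euclidean_space \<Rightarrow> 'f::real_vector \<Rightarrow> 'h::real_vector \<Rightarrow> 'b::real_normed_vector"
  assumes V: "open V" "x \<in> V" and B: "\<And>x. x \<in> V \<Longrightarrow> bilinear (B x)"
    and d: "\<And>v w. (\<lambda>x. B x v w) differentiable (at x)"
  shows "bilinear (\<lambda>v w. fd (\<lambda>x. B x v w) x u)"
proof -
  have 1: "fd (\<lambda>x. B x (v + v') w) x u = fd (\<lambda>x. B x v w) x u + fd (\<lambda>x. B x v' w) x u" for v v' w
  proof -
    have "((\<lambda>x. B x (v + v') w) has_derivative (\<lambda>u. fd (\<lambda>x. B x v w) x u + fd (\<lambda>x. B x v' w) x u)) (at x)"
      by (rule has_derivative_transform_within_open[OF has_derivative_add[OF fd_has_derivative fd_has_derivative] V])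
        (use d B in \<open>auto simp: bilinear_ladd\<close>)
    then show ?thesis by (simp add: fd_eq)
  qed
  have 2: "fd (\<lambda>x. B x v (w + w')) x u = fd (\<lambda>x. B x v w) x u + fd (\<lambda>x. B x v w') x u" for v w w'
  proof -
    have "((\<lambda>x. B x v (w + w')) has_derivative (\<lambda>u. fd (\<lambda>x. B x v w) x u + fd (\<lambda>x. B x v w') x u)) (at x)"
      by (rule has_derivative_transform_within_open[OF has_derivative_add[OF fd_has_derivative fd_has_derivative] V])
        (use d B in \<open>auto simp: bilinear_radd\<close>)
    then show ?thesis by (simp add: fd_eq)
  qed
  have 3: "fd (\<lambda>x. B x (a *\<^sub>R v) w) x u = a *\<^sub>R fd (\<lambda>x. B x v w) x u" for v w a
  proof -
    have "((\<lambda>x. B x (a *\<^sub>R v) w) has_derivative (\<lambda>u. a *\<^sub>R fd (\<lambda>x. B x v w) x u)) (at x)"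
      by (rule has_derivative_transform_within_open[OF has_derivative_scaleR_right[OF fd_has_derivative] V])
        (use d B in \<open>auto simp: bilinear_lmul\<close>)
    then show ?thesis by (simp add: fd_eq)
  qed
  have 4: "fd (\<lambda>x. B x v (a *\<^sub>R w)) x u = a *\<^sub>R fd (\<lambda>x. B x v w) x u" for v w a
  proof -
    have "((\<lambda>x. B x v (a *\<^sub>R w)) has_derivative (\<lambda>u. a *\<^sub>R fd (\<lambda>x. B x v w) x u)) (at x)"
      by (rule has_derivative_transform_within_open[OF has_derivative_scaleR_right[OF fd_has_derivative] V])
        (use d B in \<open>auto simp: bilinear_rmul\<close>)
    then show ?thesis by (simp add: fd_eq)
  qed
  show ?thesis unfolding bilinear_def using 1 2 3 4 by (auto intro!: linearI)
qed

text \<open>The product rule for a form whose base point moves together with its arguments.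
  Differentiability in the base point is assumed for fixed arguments only, so both arguments are
  expanded in the basis before differentiating.\<close>

lemma bilinear_family_has_derivative:
  fixes B :: "'e::euclidean_space \<Rightarrow> 'f::euclidean_space \<Rightarrow> 'h::euclidean_space \<Rightarrow> 'b::real_normed_vector"
  assumes V: "open V" "c t \<in> V" and B: "\<And>x. x \<in> V \<Longrightarrow> bilinear (B x)"
    and d: "\<And>v w. (\<lambda>x. B x v w) differentiable (at (c t))"
    and c: "(c has_derivative c') (at t)" and a: "(a has_derivative a') (at t)"
    and b: "(b has_derivative b') (at t)"
  shows "((\<lambda>s. B (c s) (a s) (b s)) has_derivative
    (\<lambda>\<tau>. fd (\<lambda>x. B x (a t) (b t)) (c t) (c' \<tau>) + B (c t) (a' \<tau>) (b t) + B (c t) (a t) (b' \<tau>))) (at t)"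
proof -
  have near: "\<forall>\<^sub>F s in at t. c s \<in> V"
    using has_derivative_continuous[OF c] V unfolding continuous_at by (rule topological_tendstoD)
  have eq: "\<forall>\<^sub>F s in at t. (\<Sum>i\<in>Basis. \<Sum>j\<in>Basis. ((a s \<bullet> i) * (b s \<bullet> j)) *\<^sub>R B (c s) i j) = B (c s) (a s) (b s)"
    using near by eventually_elim (simp add: bilinear_basis_expand[OF B, of _ "a _"])
  have dB: "((\<lambda>s. B (c s) i j) has_derivative (\<lambda>\<tau>. fd (\<lambda>x. B x i j) (c t) (c' \<tau>))) (at t)" for i j
    by (rule has_derivative_compose[OF c fd_has_derivative[OF d]])
  have fdB: "fd (\<lambda>x. B x v w) (c t) u = (\<Sum>i\<in>Basis. \<Sum>j\<in>Basis. ((v \<bullet> i) * (w \<bullet> j)) *\<^sub>R fd (\<lambda>x. B x i j) (c t) u)"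
    for u v w
    using bilinear_basis_expand[OF fd_bilinear_family[OF V(1,2) B d], of v w u] by simp
  have main: "((\<lambda>s. \<Sum>i\<in>Basis. \<Sum>j\<in>Basis. ((a s \<bullet> i) * (b s \<bullet> j)) *\<^sub>R B (c s) i j) has_derivative
      (\<lambda>\<tau>. \<Sum>i\<in>Basis. \<Sum>j\<in>Basis. ((a t \<bullet> i) * (b t \<bullet> j)) *\<^sub>R fd (\<lambda>x. B x i j) (c t) (c' \<tau>) +
        ((a t \<bullet> i) * (b' \<tau> \<bullet> j) + (a' \<tau> \<bullet> i) * (b t \<bullet> j)) *\<^sub>R B (c t) i j)) (at t)"
    by (intro has_derivative_sum has_derivative_scaleR has_derivative_mult dB
        bounded_linear.has_derivative[OF bounded_linear_inner_left] a b)
  have "((\<lambda>s. B (c s) (a s) (b s)) has_derivative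
      (\<lambda>\<tau>. \<Sum>i\<in>Basis. \<Sum>j\<in>Basis. ((a t \<bullet> i) * (b t \<bullet> j)) *\<^sub>R fd (\<lambda>x. B x i j) (c t) (c' \<tau>) +
        ((a t \<bullet> i) * (b' \<tau> \<bullet> j) + (a' \<tau> \<bullet> i) * (b t \<bullet> j)) *\<^sub>R B (c t) i j)) (at t)"
    by (rule has_derivative_transform_eventually[OF main eq])
      (use bilinear_basis_expand[OF B[OF V(2)], of "a t" "b t"] in simp_all)
  moreover have "(\<Sum>i\<in>Basis. \<Sum>j\<in>Basis. ((a t \<bullet> i) * (b t \<bullet> j)) *\<^sub>R fd (\<lambda>x. B x i j) (c t) (c' \<tau>) +
        ((a t \<bullet> i) * (b' \<tau> \<bullet> j) + (a' \<tau> \<bullet> i) * (b t \<bullet> j)) *\<^sub>R B (c t) i j)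
      = fd (\<lambda>x. B x (a t) (b t)) (c t) (c' \<tau>) + B (c t) (a' \<tau>) (b t) + B (c t) (a t) (b' \<tau>)" for \<tau>
    unfolding bilinear_basis_expand[OF B[OF V(2)], of "a' \<tau>"] bilinear_basis_expand[OF B[OF V(2)], of "a t"]
    unfolding fdB[of "a t" "b t"]
    by (simp add: sum.distrib scaleR_add_left algebra_simps)
  ultimately show ?thesis by simp
qed

section \<open>Riemannian metrics in a chart\<close>

abbreviation e\<^sub>1 :: "real^2" where "e\<^sub>1 \<equiv> axis 1 1"
abbreviation e\<^sub>2 :: "real^2" where "e\<^sub>2 \<equiv> axis 2 1"

lemma vec2_expand: "v = v $ 1 *\<^sub>R e\<^sub>1 + v $ 2 *\<^sub>R e\<^sub>2" for v :: "real^2"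
  by (simp add: vec_eq_iff forall_2 axis_def)

lemma linear2_expand:
  fixes f :: "real^2 \<Rightarrow> 'b::real_vector"
  assumes "linear f" shows "f v = v $ 1 *\<^sub>R f e\<^sub>1 + v $ 2 *\<^sub>R f e\<^sub>2"
  by (subst vec2_expand[of v]) (simp add: linear_add[OF assms] linear_scale[OF assms])

lemma bilinear2_expand:
  fixes B :: "real^2 \<Rightarrow> real^2 \<Rightarrow> 'b::real_vector"
  assumes "bilinear B"
  shows "B v w = (v$1 * w$1) *\<^sub>R B e\<^sub>1 e\<^sub>1 + (v$1 * w$2) *\<^sub>R B e\<^sub>1 e\<^sub>2 +
    (v$2 * w$1) *\<^sub>R B e\<^sub>2 e\<^sub>1 + (v$2 * w$2) *\<^sub>R B e\<^sub>2 e\<^sub>2"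
  using linear2_expand[of "\<lambda>v. B v w" v] linear2_expand[of "B e\<^sub>1" w] linear2_expand[of "B e\<^sub>2" w] assms
  by (simp add: bilinear_def scaleR_add_right)

definition gram :: "(real^2 \<Rightarrow> real^2 \<Rightarrow> real) \<Rightarrow> real" where
  "gram B = B e\<^sub>1 e\<^sub>1 * B e\<^sub>2 e\<^sub>2 - (B e\<^sub>1 e\<^sub>2)\<^sup>2"

text \<open>The vector representing the covector with components \<open>a\<close>, \<open>b\<close> with respect to \<open>B\<close>.\<close>

definition gram_sharp :: "(real^2 \<Rightarrow> real^2 \<Rightarrow> real) \<Rightarrow> real \<Rightarrow> real \<Rightarrow> real^2" where
  "gram_sharp B a b = ((B e\<^sub>2 e\<^sub>2 * a - B e\<^sub>1 e\<^sub>2 * b) / gram B) *\<^sub>R e\<^sub>1 +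
     ((B e\<^sub>1 e\<^sub>1 * b - B e\<^sub>1 e\<^sub>2 * a) / gram B) *\<^sub>R e\<^sub>2"

lemma gram_pos:
  assumes B: "bilinear B" "\<And>v w. B v w = B w v" and pos: "\<And>v. v \<noteq> 0 \<Longrightarrow> B v v > 0"
  shows "gram B > 0"
proof -
  \<comment> \<open>\<open>B e\<^sub>2 e\<^sub>2\<close> times the component of
    \<open>e\<^sub>1\<close> orthogonal to \<open>e\<^sub>2\<close>; the factor avoids a division.
    Its squared length is \<open>B e\<^sub>2 e\<^sub>2\<close> times the Gram determinant.\<close>
  define z where "z = B e\<^sub>2 e\<^sub>2 *\<^sub>R e\<^sub>1 - B e\<^sub>1 e\<^sub>2 *\<^sub>R e\<^sub>2"
  have G: "B e\<^sub>2 e\<^sub>2 > 0" by (rule pos) (simp add: axis_eq_0_iff)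
  then have "z $ 1 \<noteq> 0" by (simp add: z_def axis_def)
  then have "z \<noteq> 0" by auto
  then have "B z z > 0" by (rule pos)
  also have "B z z = B e\<^sub>2 e\<^sub>2 * gram B"
    using B(2)[of e\<^sub>2 e\<^sub>1]
    by (simp add: z_def gram_def bilinear_lsub[OF B(1)] bilinear_rsub[OF B(1)] bilinear_lmul[OF B(1)]
        bilinear_rmul[OF B(1)] power2_eq_square algebra_simps)
  finally show ?thesis using G by (simp add: zero_less_mult_iff)
qed

lemma gram_sharp_eq:
  assumes B: "bilinear B" "\<And>v w. B v w = B w v" and pos: "gram B > 0"
  shows "B (gram_sharp B a b) v = a * v $ 1 + b * v $ 2"
proof -
  have d: "gram B \<noteq> 0" using pos by simp
  have lin: "linear (B z)" for z using B(1) by (simp add: bilinear_def)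
  note bil = bilinear_ladd[OF B(1)] bilinear_lmul[OF B(1)]
  have 1: "B (gram_sharp B a b) e\<^sub>1 = a"
    unfolding gram_sharp_def using d B(2)[of e\<^sub>2 e\<^sub>1]
    by (simp add: bil field_simps) (simp add: gram_def power2_eq_square algebra_simps)
  have 2: "B (gram_sharp B a b) e\<^sub>2 = b"
    unfolding gram_sharp_def using d B(2)[of e\<^sub>2 e\<^sub>1]
    by (simp add: bil field_simps) (simp add: gram_def power2_eq_square algebra_simps)
  show ?thesis using linear2_expand[OF lin, of "gram_sharp B a b" v] 1 2 by simp
qed

section \<open>The metric of a surface in one chart and its Levi-Civita connection\<close>

locale riem_chart =
  fixes M :: "('a, real^2, 'i) riem" and i :: 'i and V :: "(real^2) set"
  assumes open_V: "open V"
    and bilinear_g: "x \<in> V \<Longrightarrow> bilinear (metric M i x)"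
    and g_sym: "x \<in> V \<Longrightarrow> metric M i x v w = metric M i x w v"
    and g_pos: "x \<in> V \<Longrightarrow> v \<noteq> 0 \<Longrightarrow> metric M i x v v > 0"
    and g_smooth: "smooth_on V (\<lambda>x. metric M i x v w)"
begin

abbreviation "g \<equiv> metric M i"
abbreviation "\<Gamma> \<equiv> christoffel M i"
abbreviation "R \<equiv> curvature M i"

lemma g_add_left: "x \<in> V \<Longrightarrow> g x (a + b) w = g x a w + g x b w"
  and g_add_right: "x \<in> V \<Longrightarrow> g x w (a + b) = g x w a + g x w b"
  and g_scale_left: "x \<in> V \<Longrightarrow> g x (s *\<^sub>R a) w = s * g x a w"
  and g_scale_right: "x \<in> V \<Longrightarrow> g x w (s *\<^sub>R a) = s * g x w a"
  and g_minus_left: "x \<in> V \<Longrightarrow> g x (- a) w = - g x a w"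
  and g_minus_right: "x \<in> V \<Longrightarrow> g x w (- a) = - g x w a"
  and g_diff_left: "x \<in> V \<Longrightarrow> g x (a - b) w = g x a w - g x b w"
  and g_diff_right: "x \<in> V \<Longrightarrow> g x w (a - b) = g x w a - g x w b"
  and g_zero_left: "x \<in> V \<Longrightarrow> g x 0 w = 0"
  and g_zero_right: "x \<in> V \<Longrightarrow> g x w 0 = 0"
  using bilinear_ladd[OF bilinear_g] bilinear_radd[OF bilinear_g] bilinear_lmul[OF bilinear_g]
    bilinear_rmul[OF bilinear_g] bilinear_lneg[OF bilinear_g] bilinear_rneg[OF bilinear_g]
    bilinear_lsub[OF bilinear_g] bilinear_rsub[OF bilinear_g] bilinear_lzero[OF bilinear_g]
    bilinear_rzero[OF bilinear_g]
  by auto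

lemmas g_simps = g_add_left g_add_right g_scale_left g_scale_right g_minus_left g_minus_right
  g_diff_left g_diff_right g_zero_left g_zero_right

lemma g_nonneg: "x \<in> V \<Longrightarrow> g x v v \<ge> 0"
  using g_pos[of x v] g_zero_left by (cases "v = 0") auto

lemma g_eq_zero: "x \<in> V \<Longrightarrow> g x v v = 0 \<longleftrightarrow> v = 0"
  using g_pos[of x v] g_zero_left by (cases "v = 0") auto

lemma g_nondegenerate: "x \<in> V \<Longrightarrow> (\<And>y. g x z y = g x z' y) \<Longrightarrow> z = z'"
  using g_eq_zero[of x "z - z'"] by (simp add: g_simps)

definition "gdet x = gram (g x)"

abbreviation "sharp x \<equiv> gram_sharp (g x)"

lemma gdet_pos: "x \<in> V \<Longrightarrow> gdet x > 0"
  unfolding gdet_def by (rule gram_pos[OF bilinear_g g_sym g_pos])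

lemma g_sharp: "x \<in> V \<Longrightarrow> g x (sharp x a b) v = a * v $ 1 + b * v $ 2"
  by (rule gram_sharp_eq[OF bilinear_g g_sym gdet_pos[unfolded gdet_def]])

lemma smooth_gdet: "smooth_on V gdet"
proof -
  have "smooth_on V (\<lambda>x. g x e\<^sub>1 e\<^sub>1 * g x e\<^sub>2 e\<^sub>2 - g x e\<^sub>1 e\<^sub>2 * g x e\<^sub>1 e\<^sub>2)"
    by (intro smooth_intros open_V g_smooth)
  then show ?thesis by (simp add: gdet_def[abs_def] gram_def power2_eq_square)
qed

lemma smooth_sharp:
  assumes "open S" "S \<subseteq> V" "smooth_on S a" "smooth_on S b"
  shows "smooth_on S (\<lambda>x. sharp x (a x) (b x))"
  unfolding gram_sharp_def gdet_def[symmetric]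
  by (intro smooth_intros assms smooth_on_subset[OF g_smooth] smooth_on_subset[OF smooth_gdet])
    (use gdet_pos assms(2) in force)+

lemma g_differentiable: "x \<in> V \<Longrightarrow> (\<lambda>x. g x v w) differentiable (at x)"
  by (rule smooth_on_differentiable[OF g_smooth])

lemma fd_g_bilinear: "x \<in> V \<Longrightarrow> bilinear (\<lambda>v w. fd (\<lambda>x. g x v w) x u)"
  by (rule fd_bilinear_family[OF open_V _ bilinear_g g_differentiable])

lemma fd_g_sym: "x \<in> V \<Longrightarrow> fd (\<lambda>x. g x v w) x u = fd (\<lambda>x. g x w v) x u"
  by (rule fun_cong[OF fd_cong[OF open_V _ _ g_differentiable]]) (auto simp: g_sym)

definition "koszul x v w y =
  (fd (\<lambda>x. g x w y) x v + fd (\<lambda>x. g x v y) x w - fd (\<lambda>x. g x v w) x y) / 2"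

lemma koszul_linear: assumes "x \<in> V" shows "linear (koszul x v w)"
proof -
  have *: "linear (\<lambda>y. fd (\<lambda>x. g x w y) x v)" for v w
    using fd_g_bilinear[OF assms, of v] by (simp add: bilinear_def)
  have **: "linear (fd (\<lambda>x. g x v w) x)"
    by (rule fd_linear[OF g_differentiable[OF assms]])
  show ?thesis
    by (rule linearI) (simp_all add: koszul_def linear_add[OF *] linear_add[OF **]
        linear_scale[OF *] linear_scale[OF **] field_simps)
qed

text \<open>Nondegeneracy turns the definite description into a formula in the metric and its first
  derivatives, from which the smoothness of the connection is read off.\<close>

lemma christoffel_sharp:
  assumes "x \<in> V" shows "\<Gamma> x v w = sharp x (koszul x v w e\<^sub>1) (koszul x v w e\<^sub>2)"
proof -
  have *: "g x (sharp x (koszul x v w e\<^sub>1) (koszul x v w e\<^sub>2)) y = koszul x v w y" for y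
    using g_sharp[OF assms] linear2_expand[OF koszul_linear[OF assms], of v w y]
    by (simp add: mult.commute)
  show ?thesis
    unfolding christoffel_def
  proof (rule the_equality)
    show "\<forall>y. 2 * g x (sharp x (koszul x v w e\<^sub>1) (koszul x v w e\<^sub>2)) y =
       fd (\<lambda>x. g x w y) x v + fd (\<lambda>x. g x v y) x w - fd (\<lambda>x. g x v w) x y"
      unfolding * by (simp add: koszul_def)
    fix z assume "\<forall>y. 2 * g x z y =
       fd (\<lambda>x. g x w y) x v + fd (\<lambda>x. g x v y) x w - fd (\<lambda>x. g x v w) x y"
    then have "g x z y = koszul x v w y" for y
      by (metis koszul_def nonzero_mult_div_cancel_left zero_neq_numeral)
    then show "z = sharp x (koszul x v w e\<^sub>1) (koszul x v w e\<^sub>2)"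
      by (intro g_nondegenerate[OF assms]) (simp add: *)
  qed
qed

lemma g_christoffel:
  assumes "x \<in> V"
  shows "g x (\<Gamma> x v w) y = koszul x v w y"
  using g_sharp[OF assms] linear2_expand[OF koszul_linear[OF assms], of v w y]
  by (simp add: christoffel_sharp assms mult.commute)

lemma christoffel_sym: "x \<in> V \<Longrightarrow> \<Gamma> x v w = \<Gamma> x w v"
  by (rule g_nondegenerate) (auto simp: g_christoffel koszul_def fd_g_sym[of x v w])

lemma christoffel_bilinear: assumes "x \<in> V" shows "bilinear (\<Gamma> x)"
proof -
  have l1: "fd (\<lambda>x. g x w (a + b)) x v = fd (\<lambda>x. g x w a) x v + fd (\<lambda>x. g x w b) x v"
    "fd (\<lambda>x. g x (a + b) w) x v = fd (\<lambda>x. g x a w) x v + fd (\<lambda>x. g x b w) x v"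
    "fd (\<lambda>x. g x w (s *\<^sub>R a)) x v = s * fd (\<lambda>x. g x w a) x v"
    "fd (\<lambda>x. g x (s *\<^sub>R a) w) x v = s * fd (\<lambda>x. g x a w) x v" for a b v w s
    using bilinear_ladd[OF fd_g_bilinear[OF assms, of v]] bilinear_radd[OF fd_g_bilinear[OF assms, of v]]
      bilinear_lmul[OF fd_g_bilinear[OF assms, of v]] bilinear_rmul[OF fd_g_bilinear[OF assms, of v]]
    by auto
  have l2: "fd (\<lambda>x. g x v w) x (a + b) = fd (\<lambda>x. g x v w) x a + fd (\<lambda>x. g x v w) x b"
    "fd (\<lambda>x. g x v w) x (s *\<^sub>R a) = s * fd (\<lambda>x. g x v w) x a" for a b v w s
    using linear_add[OF fd_linear[OF g_differentiable[OF assms]]]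
      linear_scale[OF fd_linear[OF g_differentiable[OF assms]]] by auto
  have 1: "\<Gamma> x (a + b) w = \<Gamma> x a w + \<Gamma> x b w" for a b w
    by (rule g_nondegenerate[OF assms])
      (simp add: g_simps assms g_christoffel koszul_def l1 l2 field_simps)
  have 2: "\<Gamma> x (s *\<^sub>R a) w = s *\<^sub>R \<Gamma> x a w" for a s w
    by (rule g_nondegenerate[OF assms])
      (simp add: g_simps assms g_christoffel koszul_def l1 l2 field_simps)
  show ?thesis
    unfolding bilinear_def using 1 2 christoffel_sym[OF assms] by (auto intro!: linearI)
qed

lemma metric_compatible:
  assumes "x \<in> V"
  shows "fd (\<lambda>x. g x w y) x v = g x (\<Gamma> x v w) y + g x w (\<Gamma> x v y)"
  unfolding g_sym[OF assms, of w "\<Gamma> x v y"]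
  by (simp add: g_christoffel assms koszul_def fd_g_sym[OF assms, of y w] fd_g_sym[OF assms, of y v]
      fd_g_sym[OF assms, of v w] field_simps)

lemma smooth_christoffel: "smooth_on V (\<lambda>x. \<Gamma> x v w)"
proof (rule smooth_on_cong[OF open_V])
  have k: "smooth_on V (\<lambda>x. koszul x v w y)" for y
    unfolding koszul_def by (intro smooth_intros open_V g_smooth) auto
  show "smooth_on V (\<lambda>x. sharp x (koszul x v w e\<^sub>1) (koszul x v w e\<^sub>2))"
    by (intro smooth_sharp open_V k) auto
qed (simp add: christoffel_sharp)

lemma christoffel_differentiable: "x \<in> V \<Longrightarrow> (\<lambda>x. \<Gamma> x v w) differentiable (at x)"
  by (rule smooth_on_differentiable[OF smooth_christoffel])

lemma fd_christoffel_bilinear: "x \<in> V \<Longrightarrow> bilinear (\<lambda>v w. fd (\<lambda>x. \<Gamma> x v w) x u)"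
  by (rule fd_bilinear_family[OF open_V _ christoffel_bilinear christoffel_differentiable])

text \<open>Compatibility absorbs the derivative of the metric into Christoffel terms, so each
  argument is differentiated covariantly along \<open>c\<close>. It serves vector fields on the
  chart, transition maps and surface patches alike.\<close>

lemma has_derivative_g:
  assumes "c t \<in> V" "(c has_derivative c') (at t)" "(a has_derivative a') (at t)"
    "(b has_derivative b') (at t)"
  shows "((\<lambda>s. g (c s) (a s) (b s)) has_derivative
    (\<lambda>\<tau>. g (c t) (a' \<tau> + \<Gamma> (c t) (c' \<tau>) (a t)) (b t) +
      g (c t) (a t) (b' \<tau> + \<Gamma> (c t) (c' \<tau>) (b t)))) (at t)"
  using bilinear_family_has_derivative[of V c t "\<lambda>x. g x", OF open_V assms(1) bilinear_g
      g_differentiable[OF assms(1)] assms(2-4)]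
  by (simp add: metric_compatible assms(1) g_simps algebra_simps)

lemma has_derivative_christoffel:
  assumes "c t \<in> V" "(c has_derivative c') (at t)" "(a has_derivative a') (at t)"
    "(b has_derivative b') (at t)"
  shows "((\<lambda>s. \<Gamma> (c s) (a s) (b s)) has_derivative
    (\<lambda>\<tau>. fd (\<lambda>x. \<Gamma> x (a t) (b t)) (c t) (c' \<tau>) + \<Gamma> (c t) (a' \<tau>) (b t) + \<Gamma> (c t) (a t) (b' \<tau>))) (at t)"
  by (rule bilinear_family_has_derivative[OF open_V assms(1) christoffel_bilinear
      christoffel_differentiable[OF assms(1)] assms(2-4)])

section \<open>The curvature tensor and the Gauss curvature in a chart\<close>

lemma curvature_antisym: "R x u v w = - R x v u w"
  by (simp add: curvature_def)

lemma curvature_linear: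
  assumes "x \<in> V"
  shows "linear (\<lambda>u. R x u v w)" "linear (\<lambda>v. R x u v w)" "linear (R x u v)"
proof -
  note b = bilinear_ladd[OF christoffel_bilinear[OF assms]] bilinear_radd[OF christoffel_bilinear[OF assms]]
    bilinear_lmul[OF christoffel_bilinear[OF assms]] bilinear_rmul[OF christoffel_bilinear[OF assms]]
    bilinear_ladd[OF fd_christoffel_bilinear[OF assms]] bilinear_radd[OF fd_christoffel_bilinear[OF assms]]
    bilinear_lmul[OF fd_christoffel_bilinear[OF assms]] bilinear_rmul[OF fd_christoffel_bilinear[OF assms]]
    linear_add[OF fd_linear[OF christoffel_differentiable[OF assms]]]
    linear_scale[OF fd_linear[OF christoffel_differentiable[OF assms]]]
  show "linear (\<lambda>u. R x u v w)" "linear (\<lambda>v. R x u v w)" "linear (R x u v)"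
    by (auto intro!: linearI simp: curvature_def b algebra_simps)
qed

text \<open>The second derivatives of \<open>g x w w\<close> commute. The part
  \<open>g x (\<Gamma> x v w) (\<Gamma> x u w)\<close> is symmetric in \<open>u\<close> and
  \<open>v\<close>, and the rest of the difference is the curvature term.\<close>

lemma curvature_skew_diag:
  assumes x: "x \<in> V" shows "g x (R x u v w) w = 0"
proof -
  have d1: "fd (\<lambda>x. g x w w) y v = 2 * g y (\<Gamma> y v w) w" if "y \<in> V" for y v
    using metric_compatible[OF that, of w w v] g_sym[OF that, of w] by simp
  have d2: "fd (\<lambda>y. fd (\<lambda>x. g x w w) y v) x u =
      2 * (g x (fd (\<lambda>x. \<Gamma> x v w) x u + \<Gamma> x u (\<Gamma> x v w)) w + g x (\<Gamma> x v w) (\<Gamma> x u w))" for u v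
  proof -
    have "((\<lambda>y. g y (\<Gamma> y v w) w) has_derivative (\<lambda>u. g x (fd (\<lambda>x. \<Gamma> x v w) x u + \<Gamma> x u (\<Gamma> x v w)) w +
        g x (\<Gamma> x v w) (0 + \<Gamma> x u w))) (at x)"
      by (rule has_derivative_g[OF x has_derivative_ident
            fd_has_derivative[OF christoffel_differentiable[OF x]] has_derivative_const])
    from has_derivative_mult_right[OF this, of 2]
    have "((\<lambda>y. 2 * g y (\<Gamma> y v w) w) has_derivative (\<lambda>u. 2 * (g x (fd (\<lambda>x. \<Gamma> x v w) x u + \<Gamma> x u (\<Gamma> x v w)) w +
        g x (\<Gamma> x v w) (\<Gamma> x u w)))) (at x)"
      by simp
    then have "((\<lambda>y. fd (\<lambda>x. g x w w) y v) has_derivative (\<lambda>u. 2 * (g x (fd (\<lambda>x. \<Gamma> x v w) x u + \<Gamma> x u (\<Gamma> x v w)) w +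
        g x (\<Gamma> x v w) (\<Gamma> x u w)))) (at x)"
      by (rule has_derivative_transform_within_open[OF _ open_V x]) (simp add: d1)
    then show ?thesis by (simp add: fd_eq)
  qed
  have "fd (\<lambda>y. fd (\<lambda>x. g x w w) y v) x u = fd (\<lambda>y. fd (\<lambda>x. g x w w) y u) x v"
    by (rule fd_fd_commute[OF open_V g_smooth x])
  then show ?thesis
    unfolding d2 curvature_def using g_sym[OF x, of "\<Gamma> x v w"] by (simp add: g_simps x)
qed

lemma curvature_skew:
  assumes x: "x \<in> V" shows "g x (R x u v w) z = - g x (R x u v z) w"
  using curvature_skew_diag[OF x, of u v "w + z"] curvature_skew_diag[OF x, of u v w]
    curvature_skew_diag[OF x, of u v z]
  by (simp add: g_simps x linear_add[OF curvature_linear(3)[OF x]])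

definition "K x = sectional_curvature M i x e\<^sub>1 e\<^sub>2"

text \<open>In the plane the two skew symmetries leave a single component. Passing from
  \<open>e\<^sub>1\<close>, \<open>e\<^sub>2\<close> to \<open>u\<close>, \<open>v\<close> costs the
  determinant \<open>\<delta>\<close> once for each pair of arguments, and
  \<open>\<delta>\<^sup>2\<close> is also the factor by which the Gram determinant changes.\<close>

lemma gauss_equation_2d:
  assumes x: "x \<in> V"
  shows "g x (R x u v v) u = K x * (g x u u * g x v v - (g x u v)\<^sup>2)"
proof -
  define \<delta> where "\<delta> = u $ 1 * v $ 2 - u $ 2 * v $ 1"
  have R11: "R x e e w = 0" for e w by (simp add: curvature_def)
  have "R x u v w = \<delta> *\<^sub>R R x e\<^sub>1 e\<^sub>2 w" for w
    using linear2_expand[OF curvature_linear(1)[OF x, where v = v and w = w], of u]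
      linear2_expand[OF curvature_linear(2)[OF x, where u = e\<^sub>1 and w = w], of v]
      linear2_expand[OF curvature_linear(2)[OF x, where u = e\<^sub>2 and w = w], of v] curvature_antisym[of x e\<^sub>2 e\<^sub>1 w]
    by (simp add: R11 \<delta>_def algebra_simps)
  then have "g x (R x u v v) u = \<delta> * g x (R x e\<^sub>1 e\<^sub>2 v) u" by (simp add: g_simps x)
  also have "g x (R x e\<^sub>1 e\<^sub>2 v) u = \<delta> * g x (R x e\<^sub>1 e\<^sub>2 e\<^sub>2) e\<^sub>1"
  proof -
    have bl: "bilinear (\<lambda>v u. g x (R x e\<^sub>1 e\<^sub>2 v) u)"
      unfolding bilinear_def
      by (auto intro!: linearI simp: g_simps x linear_add[OF curvature_linear(3)[OF x]]
          linear_scale[OF curvature_linear(3)[OF x]])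
    show ?thesis
      using bilinear2_expand[OF bl, of v u] curvature_skew_diag[OF x]
        curvature_skew[OF x, of e\<^sub>1 e\<^sub>2 e\<^sub>1 e\<^sub>2]
      by (simp add: \<delta>_def algebra_simps)
  qed
  also have "g x (R x e\<^sub>1 e\<^sub>2 e\<^sub>2) e\<^sub>1 = K x * gdet x"
    using gdet_pos[OF x] by (simp add: K_def sectional_curvature_def gdet_def gram_def)
  finally have "g x (R x u v v) u = K x * (\<delta>\<^sup>2 * gdet x)" by (simp add: power2_eq_square)
  also have "\<delta>\<^sup>2 * gdet x = g x u u * g x v v - (g x u v)\<^sup>2"
    using bilinear2_expand[OF bilinear_g[OF x], of u u] bilinear2_expand[OF bilinear_g[OF x], of u v]
      bilinear2_expand[OF bilinear_g[OF x], of v v] g_sym[OF x, of e\<^sub>2 e\<^sub>1]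
    by (simp add: \<delta>_def gdet_def gram_def power2_eq_square algebra_simps)
  finally show ?thesis .
qed

lemma continuous_on_g:
  assumes "continuous_on S c" "c ` S \<subseteq> V" "continuous_on S a" "continuous_on S b"
  shows "continuous_on S (\<lambda>x. g (c x) (a x) (b x))"
proof -
  have *: "continuous_on S (\<lambda>x. g (c x) v w)" for v w
    by (rule continuous_on_compose2[OF smooth_on_continuous_on[OF g_smooth] assms(1,2)])
  have "continuous_on S (\<lambda>x. (a x $ 1 * b x $ 1) *\<^sub>R g (c x) e\<^sub>1 e\<^sub>1 + (a x $ 1 * b x $ 2) *\<^sub>R g (c x) e\<^sub>1 e\<^sub>2 +
      (a x $ 2 * b x $ 1) *\<^sub>R g (c x) e\<^sub>2 e\<^sub>1 + (a x $ 2 * b x $ 2) *\<^sub>R g (c x) e\<^sub>2 e\<^sub>2)"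
    by (intro continuous_intros * assms)
  then show ?thesis
    by (rule continuous_on_eq)
      (rule bilinear2_expand[OF bilinear_g, symmetric], use assms(2) in blast)
qed

lemma continuous_on_christoffel:
  assumes "continuous_on S c" "c ` S \<subseteq> V" "continuous_on S a" "continuous_on S b"
  shows "continuous_on S (\<lambda>x. \<Gamma> (c x) (a x) (b x))"
proof -
  have *: "continuous_on S (\<lambda>x. \<Gamma> (c x) v w)" for v w
    by (rule continuous_on_compose2[OF smooth_on_continuous_on[OF smooth_christoffel] assms(1,2)])
  have "continuous_on S (\<lambda>x. (a x $ 1 * b x $ 1) *\<^sub>R \<Gamma> (c x) e\<^sub>1 e\<^sub>1 + (a x $ 1 * b x $ 2) *\<^sub>R \<Gamma> (c x) e\<^sub>1 e\<^sub>2 +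
      (a x $ 2 * b x $ 1) *\<^sub>R \<Gamma> (c x) e\<^sub>2 e\<^sub>1 + (a x $ 2 * b x $ 2) *\<^sub>R \<Gamma> (c x) e\<^sub>2 e\<^sub>2)"
    by (intro continuous_intros * assms)
  then show ?thesis
    by (rule continuous_on_eq)
      (rule bilinear2_expand[OF christoffel_bilinear, symmetric], use assms(2) in blast)
qed

lemma continuous_on_K: "continuous_on V K"
proof -
  have g: "smooth_on V (\<lambda>x. g x (a x) b)" if "smooth_on V a" for a b
  proof (rule smooth_on_cong[OF open_V])
    show "smooth_on V (\<lambda>x. (a x \<bullet> e\<^sub>1) * g x e\<^sub>1 b + (a x \<bullet> e\<^sub>2) * g x e\<^sub>2 b)"
      by (intro smooth_intros open_V g_smooth smooth_on_linear[OF _ bounded_linear_inner_left that])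
    show "(a x \<bullet> e\<^sub>1) * g x e\<^sub>1 b + (a x \<bullet> e\<^sub>2) * g x e\<^sub>2 b = g x (a x) b" if "x \<in> V" for x
      using linear2_expand[of "\<lambda>v. g x v b" "a x"] bilinear_g[OF that]
      by (simp add: bilinear_def inner_axis)
  qed
  have ch: "smooth_on V (\<lambda>x. \<Gamma> x v (a x))" if "smooth_on V a" for a v
  proof (rule smooth_on_cong[OF open_V])
    show "smooth_on V (\<lambda>x. (a x \<bullet> e\<^sub>1) *\<^sub>R \<Gamma> x v e\<^sub>1 + (a x \<bullet> e\<^sub>2) *\<^sub>R \<Gamma> x v e\<^sub>2)"
      by (intro smooth_intros open_V smooth_christoffel smooth_on_linear[OF _ bounded_linear_inner_left that])
    show "(a x \<bullet> e\<^sub>1) *\<^sub>R \<Gamma> x v e\<^sub>1 + (a x \<bullet> e\<^sub>2) *\<^sub>R \<Gamma> x v e\<^sub>2 = \<Gamma> x v (a x)" if "x \<in> V" for x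
      using linear2_expand[of "\<Gamma> x v" "a x"] christoffel_bilinear[OF that]
      by (simp add: bilinear_def inner_axis)
  qed
  have "smooth_on V (\<lambda>x. g x (R x e\<^sub>1 e\<^sub>2 e\<^sub>2) e\<^sub>1)"
    unfolding curvature_def
    by (rule g, intro smooth_on_diff smooth_on_add smooth_on_fd ch open_V smooth_christoffel)
  then have "smooth_on V (\<lambda>x. g x (R x e\<^sub>1 e\<^sub>2 e\<^sub>2) e\<^sub>1 / gdet x)"
    by (intro smooth_intros open_V smooth_gdet) (use gdet_pos in force)+
  then show ?thesis
    by (intro smooth_on_continuous_on) (simp add: K_def[abs_def] sectional_curvature_def gdet_def gram_def)
qed

end

section \<open>Change of charts\<close>

locale chart_change = A: riem_chart M i V + B: riem_chart M j V'
  for M :: "('a, real^2, 'i) riem" and i V j V' +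
  fixes \<phi> :: "real^2 \<Rightarrow> real^2" and U :: "(real^2) set"
  assumes open_U: "open U" and U_sub: "U \<subseteq> V" and \<phi>_im: "\<phi> ` U \<subseteq> V'"
    and \<phi>_smooth: "smooth_on U \<phi>"
    and isometry: "x \<in> U \<Longrightarrow> metric M i x v w = metric M j (\<phi> x) (fd \<phi> x v) (fd \<phi> x w)"
begin

abbreviation "\<phi>2 x v w \<equiv> fd (\<lambda>y. fd \<phi> y w) x v"

lemma in_V: "x \<in> U \<Longrightarrow> x \<in> V" "x \<in> U \<Longrightarrow> \<phi> x \<in> V'"
  using U_sub \<phi>_im by auto

lemma linear_\<phi>: "x \<in> U \<Longrightarrow> linear (fd \<phi> x)"
  by (rule fd_linear[OF smooth_on_differentiable[OF \<phi>_smooth]])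

lemma surj_\<phi>: assumes "x \<in> U" shows "surj (fd \<phi> x)"
proof (rule linear_injective_imp_surjective[OF linear_\<phi>[OF assms]])
  have "v = 0" if "fd \<phi> x v = 0" for v
    using A.g_eq_zero[OF in_V(1)[OF assms], of v] isometry[OF assms, of v v] that
      B.g_zero_left[OF in_V(2)[OF assms]] by simp
  then show "inj (fd \<phi> x)"
    using linear_injective_0[OF linear_\<phi>[OF assms]] by blast
qed simp

lemma \<phi>2_sym: "x \<in> U \<Longrightarrow> \<phi>2 x v w = \<phi>2 x w v"
  by (rule fd_fd_commute[OF open_U \<phi>_smooth])

lemma d\<phi>: "x \<in> U \<Longrightarrow> (\<phi> has_derivative fd \<phi> x) (at x)"
  by (rule smooth_on_has_derivative[OF \<phi>_smooth])

lemma dd\<phi>: "x \<in> U \<Longrightarrow> ((\<lambda>y. fd \<phi> y w) has_derivative (\<lambda>v. \<phi>2 x v w)) (at x)"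
  using smooth_on_has_derivative[OF smooth_on_fd[OF \<phi>_smooth]] .

text \<open>The right-hand side \<open>T\<close> is symmetric because second derivatives commute,
  and compatible with the metric because the isometry can be differentiated. The uniqueness argument
  for the Levi-Civita connection then identifies it.\<close>

lemma christoffel_change:
  assumes x: "x \<in> U"
  shows "fd \<phi> x (A.\<Gamma> x v w) = B.\<Gamma> (\<phi> x) (fd \<phi> x v) (fd \<phi> x w) + \<phi>2 x v w"
proof -
  note xV = in_V[OF x]
  define T where "T v w = B.\<Gamma> (\<phi> x) (fd \<phi> x v) (fd \<phi> x w) + \<phi>2 x v w" for v w
  have T_sym: "T v w = T w v" for v w
    by (simp add: T_def \<phi>2_sym[OF x, of v w] B.christoffel_sym[OF xV(2), of "fd \<phi> x v"])
  have compat: "A.g x (A.\<Gamma> x v w) y + A.g x w (A.\<Gamma> x v y) =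
      B.g (\<phi> x) (T v w) (fd \<phi> x y) + B.g (\<phi> x) (fd \<phi> x w) (T v y)" for v w y
  proof -
    have "((\<lambda>x. A.g x w y) has_derivative (\<lambda>v. B.g (\<phi> x) (\<phi>2 x v w + B.\<Gamma> (\<phi> x) (fd \<phi> x v) (fd \<phi> x w)) (fd \<phi> x y) +
        B.g (\<phi> x) (fd \<phi> x w) (\<phi>2 x v y + B.\<Gamma> (\<phi> x) (fd \<phi> x v) (fd \<phi> x y)))) (at x)"
      by (rule has_derivative_transform_within_open[OF B.has_derivative_g[OF xV(2) d\<phi>[OF x] dd\<phi>[OF x] dd\<phi>[OF x]] open_U x])
        (simp add: isometry)
    then have "fd (\<lambda>x. A.g x w y) x v = B.g (\<phi> x) (T v w) (fd \<phi> x y) + B.g (\<phi> x) (fd \<phi> x w) (T v y)"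
      by (simp add: fd_eq T_def add.commute)
    then show ?thesis using A.metric_compatible[OF xV(1), of w y v] by simp
  qed
  define S where "S v w y = A.g x (A.\<Gamma> x v w) y - B.g (\<phi> x) (T v w) (fd \<phi> x y)" for v w y
  have s1: "S v w y = S w v y" for v w y
    using A.christoffel_sym[OF xV(1)] T_sym by (simp add: S_def)
  have s2: "S v w y = - S v y w" for v w y
    using compat[of v w y] A.g_sym[OF xV(1), of w] B.g_sym[OF xV(2), of "fd \<phi> x w"]
    by (simp add: S_def)
  \<comment> \<open>The defect \<open>S\<close> is symmetric in its first two arguments and skew in
    its last two; alternating the two symmetries three times gives \<open>S = - S\<close>.\<close>
  have "S v w y = 0" for v w y
    using s1[of v w y] s2[of w v y] s1[of w y v] s2[of y w v] s1[of y v w] s2[of v y w] by simp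
  then have eq: "A.g x (A.\<Gamma> x v w) y = B.g (\<phi> x) (T v w) (fd \<phi> x y)" for y
    by (simp add: S_def)
  have "fd \<phi> x (A.\<Gamma> x v w) = T v w"
  proof (rule B.g_nondegenerate[OF xV(2)])
    fix z
    obtain y where "z = fd \<phi> x y" using surj_\<phi>[OF x] by (metis surjD)
    then show "B.g (\<phi> x) (fd \<phi> x (A.\<Gamma> x v w)) z = B.g (\<phi> x) (T v w) z"
      using eq[of y] isometry[OF x] by simp
  qed
  then show ?thesis by (simp add: T_def)
qed

lemma curvature_change:
  assumes x: "x \<in> U"
  shows "fd \<phi> x (A.R x u v w) = B.R (\<phi> x) (fd \<phi> x u) (fd \<phi> x v) (fd \<phi> x w)"
proof -
  note xV = in_V[OF x]
  let ?\<Phi> = "fd \<phi> x"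
  note lin = linear_add[OF linear_\<phi>[OF x]] linear_diff[OF linear_\<phi>[OF x]]
  note bil = bilinear_ladd[OF B.christoffel_bilinear[OF xV(2)]] bilinear_radd[OF B.christoffel_bilinear[OF xV(2)]]
  have \<phi>3: "((\<lambda>y. \<phi>2 y v w) has_derivative (\<lambda>u. fd (\<lambda>y. \<phi>2 y v w) x u)) (at x)" for v w
    by (rule smooth_on_has_derivative[OF smooth_on_fd[OF smooth_on_fd[OF \<phi>_smooth]] x])
  have \<phi>3_sym: "fd (\<lambda>y. \<phi>2 y v w) x u = fd (\<lambda>y. \<phi>2 y u w) x v" for u v w
    by (rule fd_fd_commute[OF open_U smooth_on_fd[OF \<phi>_smooth] x])
  have d: "\<phi>2 x u (A.\<Gamma> x v w) + ?\<Phi> (fd (\<lambda>y. A.\<Gamma> y v w) x u) =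
      fd (\<lambda>y. B.\<Gamma> y (?\<Phi> v) (?\<Phi> w)) (\<phi> x) (?\<Phi> u) + B.\<Gamma> (\<phi> x) (\<phi>2 x u v) (?\<Phi> w) +
      B.\<Gamma> (\<phi> x) (?\<Phi> v) (\<phi>2 x u w) + fd (\<lambda>y. \<phi>2 y v w) x u" for u v w
  proof -
    have l: "((\<lambda>y. fd \<phi> y (A.\<Gamma> y v w)) has_derivative (\<lambda>u. fd (\<lambda>y. fd \<phi> y (A.\<Gamma> x v w)) x u + ?\<Phi> (fd (\<lambda>y. A.\<Gamma> y v w) x u))) (at x)"
    proof -
      \<comment> \<open>The product rule is available for bilinear families. A dummy scalar
        argument, which will be the constant 1, makes the linear map \<open>fd \<phi> y\<close>
        bilinear.\<close>
      have b: "bilinear (\<lambda>(s::real) v. s *\<^sub>R fd \<phi> y v)" if "y \<in> U" for y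
        using linear_\<phi>[OF that]
        by (auto simp: bilinear_def intro!: linearI simp: linear_add linear_scale algebra_simps)
      have dd: "(\<lambda>y. (s::real) *\<^sub>R fd \<phi> y v) differentiable (at x)" for s v
        using has_derivative_scaleR_right[OF dd\<phi>[OF x]] by (auto simp: differentiable_def)
      have dg: "(\<lambda>y. A.\<Gamma> y v w) differentiable (at x)" by (rule A.christoffel_differentiable[OF xV(1)])
      show ?thesis
        using bilinear_family_has_derivative[where B = "\<lambda>y (s::real) v. s *\<^sub>R fd \<phi> y v" and c = "\<lambda>y. y" and a = "\<lambda>y. 1", OF open_U x b dd
            has_derivative_ident has_derivative_const fd_has_derivative[OF dg]]
        by simp
    qed
    have r: "((\<lambda>y. fd \<phi> y (A.\<Gamma> y v w)) has_derivative (\<lambda>u. fd (\<lambda>y. B.\<Gamma> y (?\<Phi> v) (?\<Phi> w)) (\<phi> x) (?\<Phi> u) + B.\<Gamma> (\<phi> x) (\<phi>2 x u v) (?\<Phi> w) +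
      B.\<Gamma> (\<phi> x) (?\<Phi> v) (\<phi>2 x u w) + fd (\<lambda>y. \<phi>2 y v w) x u)) (at x)"
      by (rule has_derivative_transform_within_open[OF has_derivative_add[OF
              B.has_derivative_christoffel[OF xV(2) d\<phi>[OF x] dd\<phi>[OF x] dd\<phi>[OF x]] \<phi>3] open_U x])
        (simp add: christoffel_change)
    from has_derivative_unique[OF l r] show ?thesis by metis
  qed
  have e: "?\<Phi> (A.\<Gamma> x u (A.\<Gamma> x v w)) = B.\<Gamma> (\<phi> x) (?\<Phi> u) (B.\<Gamma> (\<phi> x) (?\<Phi> v) (?\<Phi> w)) +
      B.\<Gamma> (\<phi> x) (?\<Phi> u) (\<phi>2 x v w) + \<phi>2 x u (A.\<Gamma> x v w)" for u v w
    by (simp add: christoffel_change[OF x] bil)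
  \<comment> \<open>The bracket collects all terms with derivatives of \<open>\<phi>\<close> of
    order two and three. It is symmetric in \<open>u\<close> and \<open>v\<close>, so it disappears
    from the curvature.\<close>
  have "?\<Phi> (fd (\<lambda>y. A.\<Gamma> y v w) x u + A.\<Gamma> x u (A.\<Gamma> x v w)) =
      fd (\<lambda>y. B.\<Gamma> y (?\<Phi> v) (?\<Phi> w)) (\<phi> x) (?\<Phi> u) + B.\<Gamma> (\<phi> x) (?\<Phi> u) (B.\<Gamma> (\<phi> x) (?\<Phi> v) (?\<Phi> w)) +
      (B.\<Gamma> (\<phi> x) (\<phi>2 x u v) (?\<Phi> w) + (B.\<Gamma> (\<phi> x) (?\<Phi> v) (\<phi>2 x u w) + B.\<Gamma> (\<phi> x) (?\<Phi> u) (\<phi>2 x v w)) +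
       fd (\<lambda>y. \<phi>2 y v w) x u)" for u v w
    using d[where u = u and v = v and w = w] e[where u = u and v = v and w = w] by (simp add: lin algebra_simps)
  from this[of v w u] this[of u w v] show ?thesis
    unfolding curvature_def using \<phi>2_sym[OF x, of u v] \<phi>3_sym[where u = u and v = v and w = w]
    by (simp add: lin algebra_simps)
qed

lemma gauss_curvature_change:
  assumes x: "x \<in> U"
  shows "A.K x = B.K (\<phi> x)"
proof -
  note xV = in_V[OF x]
  have "B.K (\<phi> x) * A.gdet x = A.K x * A.gdet x"
    using A.gauss_equation_2d[OF xV(1), of e\<^sub>1 e\<^sub>2]
      B.gauss_equation_2d[OF xV(2), of "fd \<phi> x e\<^sub>1" "fd \<phi> x e\<^sub>2"]
    by (auto simp: isometry[OF x] curvature_change[OF x] A.gdet_def gram_def)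
  then show ?thesis using A.gdet_pos[OF xV(1)] by simp
qed

end

section \<open>Gauss curvature as a chart-independent continuous function on the manifold\<close>

context
  fixes M :: "('a::{second_countable_topology,t2_space}, real^2, 'i) riem"
  assumes M: "riemannian_manifold M"
begin

lemma riem_chart_manifold: assumes "i \<in> charts M" shows "riem_chart M i (chart_im M i)"
  using M assms unfolding riemannian_manifold_def riem_chart_def by blast

lemma chart_homeo: "i \<in> charts M \<Longrightarrow> homeomorphism (chart_dom M i) (chart_im M i) (coord M i) (param M i)"
  and open_chart_dom: "i \<in> charts M \<Longrightarrow> open (chart_dom M i)"
  and open_chart_im: "i \<in> charts M \<Longrightarrow> open (chart_im M i)"
  using M unfolding riemannian_manifold_def by blast+

lemma chart_at_charts: "chart_at M p \<in> charts M" "p \<in> chart_dom M (chart_at M p)"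
proof -
  have "(\<Union>i\<in>charts M. chart_dom M i) = UNIV" using M unfolding riemannian_manifold_def by blast
  then have "\<exists>i. i \<in> charts M \<and> p \<in> chart_dom M i" by blast
  from someI_ex[OF this] show "chart_at M p \<in> charts M" "p \<in> chart_dom M (chart_at M p)"
    unfolding chart_at_def by auto
qed

lemma param_coord [simp]: "i \<in> charts M \<Longrightarrow> p \<in> chart_dom M i \<Longrightarrow> param M i (coord M i p) = p"
  and coord_param [simp]: "i \<in> charts M \<Longrightarrow> x \<in> chart_im M i \<Longrightarrow> coord M i (param M i x) = x"
  and param_in_dom: "i \<in> charts M \<Longrightarrow> x \<in> chart_im M i \<Longrightarrow> param M i x \<in> chart_dom M i"
  and coord_in_im: "i \<in> charts M \<Longrightarrow> p \<in> chart_dom M i \<Longrightarrow> coord M i p \<in> chart_im M i"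
  using chart_homeo[of i] unfolding homeomorphism_def by auto

lemma open_coord_image:
  assumes "i \<in> charts M" "open S"
  shows "open (coord M i ` (chart_dom M i \<inter> S))"
proof -
  have "openin (top_of_set (chart_im M i)) (coord M i ` (chart_dom M i \<inter> S))"
    using homeomorphism_imp_open_map[OF chart_homeo[OF assms(1)]] assms(2)
    by (metis openin_open_Int)
  then show ?thesis using open_chart_im[OF assms(1)] openin_open_trans by blast
qed

lemma transition_smooth:
  "i \<in> charts M \<Longrightarrow> j \<in> charts M \<Longrightarrow>
    smooth_on (coord M i ` (chart_dom M i \<inter> chart_dom M j)) (transition M i j)"
  using M unfolding riemannian_manifold_def by blast

lemma chart_change_manifold:
  assumes "i \<in> charts M" "j \<in> charts M"
  shows "chart_change M i (chart_im M i) j (chart_im M j) (transition M i j)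
    (coord M i ` (chart_dom M i \<inter> chart_dom M j))"
proof -
  have iso: "\<forall>p\<in>chart_dom M i \<inter> chart_dom M j. \<forall>v w.
        metric M i (coord M i p) v w =
        metric M j (coord M j p) (frechet_derivative (transition M i j) (at (coord M i p)) v)
                                 (frechet_derivative (transition M i j) (at (coord M i p)) w)"
    using M assms unfolding riemannian_manifold_def by blast
  show ?thesis
    unfolding chart_change_def chart_change_axioms_def
    using riem_chart_manifold assms transition_smooth open_coord_image open_chart_dom iso
    by (auto simp: coord_in_im transition_def)
qed

lemma gauss_curvature_chart:
  assumes "i \<in> charts M" "p \<in> chart_dom M i"
  shows "gauss_curvature M p = sectional_curvature M i (coord M i p) e\<^sub>1 e\<^sub>2"
proof -
  let ?j = "chart_at M p"
  interpret C: chart_change M i "chart_im M i" ?j "chart_im M ?j" "transition M i ?j"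
    "coord M i ` (chart_dom M i \<inter> chart_dom M ?j)"
    by (rule chart_change_manifold[OF assms(1) chart_at_charts(1)])
  have "C.A.K (coord M i p) = C.B.K (transition M i ?j (coord M i p))"
    by (rule C.gauss_curvature_change) (use assms chart_at_charts in auto)
  then show ?thesis
    using assms by (simp add: C.A.K_def C.B.K_def transition_def gauss_curvature_def Let_def)
qed

lemma continuous_on_gauss_curvature: "continuous_on UNIV (gauss_curvature M)"
proof -
  have "continuous_on (chart_dom M i) (gauss_curvature M)" if i: "i \<in> charts M" for i
  proof -
    interpret A: riem_chart M i "chart_im M i" by (rule riem_chart_manifold[OF i])
    have "continuous_on (chart_dom M i) (\<lambda>p. A.K (coord M i p))"
      using chart_homeo[OF i] unfolding homeomorphism_def
      by (intro continuous_on_compose2[OF A.continuous_on_K]) auto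
    then show ?thesis
      by (rule continuous_on_eq) (use gauss_curvature_chart[OF i] in \<open>simp add: A.K_def\<close>)
  qed
  then have "continuous_on (\<Union>i\<in>charts M. chart_dom M i) (gauss_curvature M)"
    by (intro continuous_on_open_UN open_chart_dom)
  moreover have "(\<Union>i\<in>charts M. chart_dom M i) = UNIV"
    using chart_at_charts by blast
  ultimately show ?thesis by simp
qed

text \<open>A real infimum is a lower bound only for sets that are bounded below; continuity of the
  curvature and compactness of the domain provide this.\<close>

lemma INF_gauss_curvature_le:
  assumes "compact \<Omega>" "p \<in> \<Omega>"
  shows "(INF p\<in>\<Omega>. gauss_curvature M p) \<le> gauss_curvature M p"
proof (rule cINF_lower[OF _ assms(2)])
  have "compact (gauss_curvature M ` \<Omega>)"
    by (rule compact_continuous_image[OF continuous_on_subset[OF continuous_on_gauss_curvature] assms(1)]) simp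
  then show "bdd_below (gauss_curvature M ` \<Omega>)"
    by (intro bounded_imp_bdd_below compact_imp_bounded)
qed

end

section \<open>Second derivative test\<close>

lemma has_derivative_line:
  fixes f :: "'a::real_normed_vector \<Rightarrow> 'b::real_normed_vector"
  assumes "(f has_derivative f') (at (x + t *\<^sub>R v))"
  shows "((\<lambda>t. f (x + t *\<^sub>R v)) has_derivative (\<lambda>h. h *\<^sub>R f' v)) (at t)"
proof -
  have "((\<lambda>t. f (x + t *\<^sub>R v)) has_derivative (\<lambda>h. f' (h *\<^sub>R v))) (at t)"
    by (rule has_derivative_compose[of "\<lambda>t. x + t *\<^sub>R v" "\<lambda>h. h *\<^sub>R v" t UNIV f])
      (auto intro!: derivative_eq_intros assms)
  then show ?thesis
    using linear_scale[OF has_derivative_linear[OF assms]] by simp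
qed

lemma has_real_derivative_line:
  fixes f :: "'a::real_normed_vector \<Rightarrow> real"
  assumes "(f has_derivative f') (at (x + t *\<^sub>R v))"
  shows "((\<lambda>t. f (x + t *\<^sub>R v)) has_real_derivative f' v) (at t)"
  using has_derivative_line[OF assms] by (simp add: has_field_derivative_def mult_commute_abs)

text \<open>If the second derivative along the line were positive, the first derivative, which
  vanishes at \<open>x\<close>, would be positive just after it and the values would exceed the
  maximum. The form with separate first derivatives fits functions that are not known to be
  smooth.\<close>

lemma local_max_derivatives:
  fixes \<psi> :: "'a::real_normed_vector \<Rightarrow> real"
  assumes S: "open S" "x \<in> S" and max: "\<And>y. y \<in> S \<Longrightarrow> \<psi> y \<le> \<psi> x"
    and d: "\<And>y. y \<in> S \<Longrightarrow> (\<psi> has_derivative \<psi>' y) (at y)"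
    and dd: "((\<lambda>y. \<psi>' y v) has_derivative \<psi>2) (at x)"
  shows "\<psi>' x v = 0" "\<psi>2 v \<le> 0"
proof -
  obtain e where e: "e > 0" "ball x e \<subseteq> S" using S openE by blast
  define r where "r = e / (norm v + 1)"
  have pos: "norm v + 1 > 0" by (smt (verit) norm_ge_zero)
  have r: "r > 0" using e pos by (simp add: r_def)
  have line: "x + t *\<^sub>R v \<in> S" if "\<bar>t\<bar> < r" for t
  proof -
    have "\<bar>t\<bar> * norm v \<le> \<bar>t\<bar> * (norm v + 1)" by (simp add: mult_left_mono)
    also have "\<dots> < e" using that pos by (simp add: r_def field_simps)
    finally have "x + t *\<^sub>R v \<in> ball x e" by (simp add: dist_norm)
    then show ?thesis using e(2) by blast
  qed
  define \<phi> where "\<phi> t = \<psi> (x + t *\<^sub>R v)" for t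
  have d1: "(\<phi> has_real_derivative \<psi>' (x + t *\<^sub>R v) v) (at t)" if "\<bar>t\<bar> < r" for t
    unfolding \<phi>_def by (rule has_real_derivative_line[OF d[OF line[OF that]]])
  show 0: "\<psi>' x v = 0"
    using DERIV_local_max[OF d1[of 0] r] max line r by (simp add: \<phi>_def)
  have d2: "((\<lambda>t. \<psi>' (x + t *\<^sub>R v) v) has_real_derivative \<psi>2 v) (at 0)"
    by (rule has_real_derivative_line) (simp add: dd)
  show "\<psi>2 v \<le> 0"
  proof (rule ccontr)
    assume "\<not> \<psi>2 v \<le> 0"
    then obtain s where s: "s > 0" "\<And>h. 0 < h \<Longrightarrow> h < s \<Longrightarrow> \<psi>' (x + h *\<^sub>R v) v > 0"
      using DERIV_pos_inc_right[OF d2] 0 by auto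
    define t where "t = min r s / 2"
    have t: "0 < t" "t < r" "t < s" using r s(1) by (auto simp: t_def)
    have "\<phi> 0 < \<phi> t"
    proof (rule DERIV_pos_imp_increasing_open[OF t(1)])
      show "\<exists>y. DERIV \<phi> h :> y \<and> y > 0" if "0 < h" "h < t" for h
        using d1[of h] s(2)[of h] that t by auto
      show "continuous_on {0..t} \<phi>"
      proof (rule DERIV_continuous_on)
        show "(\<phi> has_real_derivative \<psi>' (x + y *\<^sub>R v) v) (at y within {0..t})" if "y \<in> {0..t}" for y
          by (rule has_field_derivative_at_within[OF d1]) (use that t in auto)
      qed
    qed
    then show False using max[OF line[of t]] t by (simp add: \<phi>_def)
  qed
qed

section \<open>Graphs of constant mean curvature in a chart\<close>

definition det2 :: "real^2 \<Rightarrow> real^2 \<Rightarrow> real" where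
  "det2 v w = v $ 1 * w $ 2 - v $ 2 * w $ 1"

definition trace2 :: "(real^2 \<Rightarrow> real^2) \<Rightarrow> real" where
  "trace2 L = L e\<^sub>1 $ 1 + L e\<^sub>2 $ 2"

lemma trace_matrix2: "trace (matrix L) = trace2 L" for L :: "real^2 \<Rightarrow> real^2"
  by (simp add: trace_def matrix_def trace2_def UNIV_2)

text \<open>The derivation property of the determinant. It computes the trace from the action of
  \<open>L\<close> on any basis, in particular on eigenvectors.\<close>

lemma trace2_det2:
  assumes "linear L"
  shows "det2 (L v) w + det2 v (L w) = trace2 L * det2 v w"
  unfolding linear2_expand[OF assms, of v] linear2_expand[OF assms, of w]
  by (simp add: det2_def trace2_def algebra_simps)

lemma trace2_commute:
  assumes "linear L" "linear L'"
  shows "trace2 (\<lambda>v. L (L' v)) = trace2 (\<lambda>v. L' (L v))"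
  using linear2_expand[OF assms(1), of "L' e\<^sub>1"] linear2_expand[OF assms(1), of "L' e\<^sub>2"]
    linear2_expand[OF assms(2), of "L e\<^sub>1"] linear2_expand[OF assms(2), of "L e\<^sub>2"]
  by (simp add: trace2_def algebra_simps)

lemma det2_basis:
  assumes "det2 v w \<noteq> 0" obtains a b where "z = a *\<^sub>R v + b *\<^sub>R w"
proof
  show "z = (det2 z w / det2 v w) *\<^sub>R v + (det2 v z / det2 v w) *\<^sub>R w"
    using assms by (simp add: vec_eq_iff forall_2 divide_simps)
      (simp add: det2_def algebra_simps)
qed

text \<open>Here \<open>n\<close> stands for \<nu>, \<open>s\<close> for the squared length of the
  gradient of h, \<open>l\<close> for the principal curvature in its direction and
  \<open>2 * H - l\<close> for the other one. The estimate is exact up to replacing \<open>K\<close>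
  by \<open>c\<close>.\<close>

lemma laplacian_positive:
  fixes n s H c K m :: real
  assumes n: "n < 0" and s: "s = 1 - n\<^sup>2" "s \<ge> 0" and H: "H > 0" and m: "0 < m" "m < 1/2"
    and K: "c \<le> K" and D: "D = 4 * H\<^sup>2 + c * s" "D > 0"
    and f: "f1 = m * (4 * H) / D" "f2 = f1 * (2 * c * n / D)" and l: "l = 1 / f1"
  shows "2 * H / n + f2 * l\<^sup>2 * s - f1 * ((l\<^sup>2 + (2 * H - l)\<^sup>2) / n + n * K * s + (2 * l - 2 * H) * (2 * H - l) * s / n) > 0"
    (is "?E > 0")
proof -
  have f1: "f1 > 0" using m H D f by simp
  have l0: "l > 0" using f1 l by simp
  \<comment> \<open>The relation that eliminates \<open>c\<close>: together with the definition of
    \<open>D\<close> it makes \<open>c * s\<close> a polynomial in \<open>H\<close>,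
    \<open>m\<close> and \<open>l\<close>.\<close>
  have Dl: "D = 4 * H * m * l" using m(1) H D(2) l unfolding f(1) by simp
  have f1l: "f1 * l = 1" using f1 l by simp
  have cs: "c * s = D - 4 * H\<^sup>2" using D by simp
  have f2l: "f2 * l = 2 * c * n / D" using f1l by (simp add: f(2) mult.commute mult.left_commute)
  \<comment> \<open>The factor \<open>l * n\<close> is negative. It removes the denominators
    \<open>f1\<close> and \<open>n\<close> and reverses the inequality to be shown.\<close>
  have "?E * l * n = 2 * H * l + (f2 * l) * l\<^sup>2 * s * n -
      (f1 * l) * ((l\<^sup>2 + (2 * H - l)\<^sup>2) + n\<^sup>2 * K * s + (2 * l - 2 * H) * (2 * H - l) * s)"
    using n by (simp add: field_simps power2_eq_square)
  also have "\<dots> = 2 * H * l + 2 * n\<^sup>2 * l\<^sup>2 * (c * s) / D -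
      ((l\<^sup>2 + (2 * H - l)\<^sup>2) + n\<^sup>2 * K * s + (2 * l - 2 * H) * (2 * H - l) * s)"
    unfolding f2l f1l using D(2) by (simp add: field_simps power2_eq_square)
  \<comment> \<open>The curvature bound \<open>c \<le> K\<close> enters here, with the nonnegative
    weight \<open>n\<^sup>2 * s\<close>.\<close>
  also have "\<dots> \<le> 2 * H * l + 2 * n\<^sup>2 * l\<^sup>2 * (c * s) / D -
      ((l\<^sup>2 + (2 * H - l)\<^sup>2) + n\<^sup>2 * (c * s) + (2 * l - 2 * H) * (2 * H - l) * s)"
    using mult_left_mono[OF mult_right_mono[OF K s(2)], of "n\<^sup>2"] by (simp add: mult.assoc)
  also have "2 * n\<^sup>2 * l\<^sup>2 * (c * s) / D = n\<^sup>2 * (2 * l\<^sup>2 - 2 * l * H / m)"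
    unfolding cs using D(2) Dl m(1) H l0 by (simp add: field_simps power2_eq_square)
  also have "2 * H * l + n\<^sup>2 * (2 * l\<^sup>2 - 2 * l * H / m) -
      ((l\<^sup>2 + (2 * H - l)\<^sup>2) + n\<^sup>2 * (c * s) + (2 * l - 2 * H) * (2 * H - l) * s) =
      - (n\<^sup>2 * (2 * H * l / m) * ((1 - m) * (1 - 2 * m)))"
    unfolding cs Dl unfolding s(1) using m(1) by (simp add: field_simps power2_eq_square)
  also have "\<dots> < 0" using n H l0 m by simp
  finally have "?E * l * n < 0" .
  then show ?thesis using l0 n by (simp add: mult_less_0_iff zero_less_mult_iff)
qed

text \<open>
  A graph with unit normal \<open>(X, \<nu>)\<close>. Projecting its tangent planes to the base turns the shape
  operator into \<open>-\<nabla>X\<close>, and the induced metric into \<open>G\<close>.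
\<close>

locale cmc_graph = riem_chart M i V
  for M :: "('a, real^2, 'i) riem" and i V +
  fixes U :: "(real^2) set" and u \<nu> :: "real^2 \<Rightarrow> real" and X :: "real^2 \<Rightarrow> real^2" and H :: real
    and A :: "real^2 \<Rightarrow> real^2 \<Rightarrow> real^2"
  assumes open_U: "open U" and U_sub: "U \<subseteq> V"
    and u_smooth: "smooth_on U u" and X_smooth: "smooth_on U X"
    and A_def: "x \<in> U \<Longrightarrow> A x v = - (fd X x v + christoffel M i x v (X x))"
    and normal: "x \<in> U \<Longrightarrow> metric M i x (X x) v = - \<nu> x * fd u x v"
    and unit: "x \<in> U \<Longrightarrow> metric M i x (X x) (X x) + (\<nu> x)\<^sup>2 = 1"
    and neg: "x \<in> U \<Longrightarrow> \<nu> x < 0"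
    and \<nu>_deriv: "x \<in> U \<Longrightarrow> (\<nu> has_derivative (\<lambda>v. - fd u x (A x v))) (at x)"
    and mean_curvature: "x \<in> U \<Longrightarrow> trace2 (A x) = 2 * H"
begin

abbreviation "du x v \<equiv> fd u x v"

definition "hess x v w = fd (\<lambda>y. fd u y w) x v - du x (\<Gamma> x v w)"

definition "G x v w = g x v w + du x v * du x w"

lemma in_V: "x \<in> U \<Longrightarrow> x \<in> V" using U_sub by auto

lemma linear_du: "x \<in> U \<Longrightarrow> linear (du x)"
  by (rule fd_linear[OF smooth_on_differentiable[OF u_smooth]])

lemma linear_A: "x \<in> U \<Longrightarrow> linear (A x)"
  using linear_add[OF fd_linear[OF smooth_on_differentiable[OF X_smooth]]]
    linear_scale[OF fd_linear[OF smooth_on_differentiable[OF X_smooth]]]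
    bilinear_ladd[OF christoffel_bilinear[OF in_V]] bilinear_lmul[OF christoffel_bilinear[OF in_V]]
  by (intro linearI) (simp_all add: A_def algebra_simps)

lemma du_simps:
  assumes "x \<in> U"
  shows "du x (a + b) = du x a + du x b" "du x (a - b) = du x a - du x b" "du x (- a) = - du x a"
    "du x (s *\<^sub>R a) = s * du x a" "du x 0 = 0"
  using linear_add[OF linear_du[OF assms]] linear_diff[OF linear_du[OF assms]]
    linear_neg[OF linear_du[OF assms]] linear_scale[OF linear_du[OF assms]]
    linear_0[OF linear_du[OF assms]] by auto

lemma G_simps:
  assumes "x \<in> U"
  shows "G x (a + b) w = G x a w + G x b w" "G x w (a + b) = G x w a + G x w b"
    "G x (a - b) w = G x a w - G x b w" "G x w (a - b) = G x w a - G x w b"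
    "G x (s *\<^sub>R a) w = s * G x a w" "G x w (s *\<^sub>R a) = s * G x w a"
    "G x (- a) w = - G x a w" "G x w (- a) = - G x w a"
  by (simp_all add: G_def g_simps in_V assms du_simps algebra_simps)

lemma G_sym: "x \<in> U \<Longrightarrow> G x v w = G x w v"
  using g_sym[OF in_V, of x v w] by (simp add: G_def)

lemma G_pos: "x \<in> U \<Longrightarrow> v \<noteq> 0 \<Longrightarrow> G x v v > 0"
  using g_pos[OF in_V, of x v] by (simp add: G_def add_pos_nonneg)

lemma du_has_derivative: "x \<in> U \<Longrightarrow> ((\<lambda>y. fd u y w) has_derivative (\<lambda>v. hess x v w + du x (\<Gamma> x v w))) (at x)"
  using smooth_on_has_derivative[OF smooth_on_fd[OF u_smooth]] by (simp add: hess_def)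

lemma hess_sym: "x \<in> U \<Longrightarrow> hess x v w = hess x w v"
  using fd_fd_commute[OF open_U u_smooth, of x] christoffel_sym[OF in_V]
  by (simp add: hess_def)

lemma du_vector_has_derivative:
  assumes x: "x \<in> U" and a: "(a has_derivative a') (at x)"
  shows "((\<lambda>y. du y (a y)) has_derivative (\<lambda>v. hess x v (a x) + du x (a' v + \<Gamma> x v (a x)))) (at x)"
proof -
  have b: "bilinear (\<lambda>(s::real) v. s *\<^sub>R du y v)" if "y \<in> U" for y
    using du_simps[OF that] by (auto simp: bilinear_def intro!: linearI simp: algebra_simps)
  have d: "(\<lambda>y. (s::real) *\<^sub>R du y v) differentiable (at x)" for s v
    using has_derivative_scaleR_right[OF du_has_derivative[OF x]] by (auto simp: differentiable_def)
  have "((\<lambda>y. du y (a y)) has_derivative (\<lambda>v. fd (\<lambda>y. du y (a x)) x v + du x (a' v))) (at x)"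
    using bilinear_family_has_derivative[where B = "\<lambda>y (s::real) v. s *\<^sub>R du y v" and c = "\<lambda>y. y" and a = "\<lambda>y. 1", OF open_U x b d
        has_derivative_ident has_derivative_const a] by simp
  then show ?thesis using x by (simp add: hess_def du_simps algebra_simps)
qed

text \<open>Both sides of \<open>normal\<close> are differentiated covariantly; the terms with
  \<open>\<Gamma> x v w\<close> cancel by \<open>normal\<close> itself. This is the second
  fundamental form of the graph, and the symmetry of \<open>hess\<close> will make \<open>A\<close>
  selfadjoint for \<open>G\<close>.\<close>

lemma hess_eq: assumes x: "x \<in> U" shows "\<nu> x * hess x v w = G x (A x v) w"
proof -
  have l: "((\<lambda>y. g y (X y) w) has_derivative (\<lambda>v. g x (fd X x v + \<Gamma> x v (X x)) w + g x (X x) (0 + \<Gamma> x v w))) (at x)"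
    by (rule has_derivative_g[OF in_V[OF x] has_derivative_ident smooth_on_has_derivative[OF X_smooth x] has_derivative_const])
  have "((\<lambda>y. - (\<nu> y * fd u y w)) has_derivative (\<lambda>v. - (\<nu> x * (hess x v w + du x (\<Gamma> x v w)) + - du x (A x v) * du x w))) (at x)"
    by (rule has_derivative_minus[OF has_derivative_mult[OF \<nu>_deriv[OF x] du_has_derivative[OF x]]])
  then have r: "((\<lambda>y. g y (X y) w) has_derivative (\<lambda>v. - (\<nu> x * (hess x v w + du x (\<Gamma> x v w)) + - du x (A x v) * du x w))) (at x)"
    by (rule has_derivative_transform_within_open[OF _ open_U x]) (simp add: normal)
  have "g x (- A x v) w + g x (X x) (\<Gamma> x v w) = - (\<nu> x * (hess x v w + du x (\<Gamma> x v w)) + - du x (A x v) * du x w)"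
  proof -
    have "fd X x v + \<Gamma> x v (X x) = - A x v" using A_def[OF x, of v] by simp
    then show ?thesis
      using fun_cong[OF has_derivative_unique[OF l r], of v] by simp
  qed
  then show ?thesis
    using normal[OF x, of "\<Gamma> x v w"] by (simp add: G_def g_simps in_V[OF x] algebra_simps)
qed

lemma A_selfadjoint: "x \<in> U \<Longrightarrow> G x (A x v) w = G x v (A x w)"
  using hess_eq[of x v w] hess_eq[of x w v] hess_sym[of x v w] G_sym[of x v "A x w"] by simp

section \<open>The covariant derivative of the shape operator\<close>

definition "DA x v w = - (fd (\<lambda>y. fd X y w) x v + fd (\<lambda>y. \<Gamma> y w (X x)) x v + \<Gamma> x w (fd X x v))"

text \<open>The covariant derivative of the endomorphism field \<open>A\<close> taken with the
  connection of the base, not with that of the induced metric \<open>G\<close>.\<close>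

definition "nabA x v w = DA x v w + \<Gamma> x v (A x w) - A x (\<Gamma> x v w)"

lemma A_has_derivative:
  assumes x: "x \<in> U" shows "((\<lambda>y. A y w) has_derivative (\<lambda>v. DA x v w)) (at x)"
proof -
  have "((\<lambda>y. \<Gamma> y w (X y)) has_derivative (\<lambda>v. fd (\<lambda>y. \<Gamma> y w (X x)) x v + \<Gamma> x w (fd X x v))) (at x)"
    using has_derivative_christoffel[OF in_V[OF x] has_derivative_ident has_derivative_const smooth_on_has_derivative[OF X_smooth x]]
      bilinear_lzero[OF christoffel_bilinear[OF in_V[OF x]]] by simp
  from has_derivative_minus[OF has_derivative_add[OF smooth_on_has_derivative[OF smooth_on_fd[OF X_smooth] x] this]]
  have "((\<lambda>y. - (fd X y w + \<Gamma> y w (X y))) has_derivative (\<lambda>v. DA x v w)) (at x)"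
    unfolding DA_def by (simp only: add.assoc)
  then show ?thesis
    by (rule has_derivative_transform_within_open[OF _ open_U x]) (simp only: A_def)
qed

text \<open>As \<open>A\<close> is minus the covariant derivative of \<open>X\<close>, this is the
  Ricci identity for \<open>X\<close>: exchanging two covariant derivatives costs the curvature of
  the base.\<close>

lemma codazzi:
  assumes x: "x \<in> U" shows "nabA x v w - nabA x w v = - R x v w (X x)"
proof -
  note b = bilinear_radd[OF christoffel_bilinear[OF in_V[OF x]]]
    bilinear_rneg[OF christoffel_bilinear[OF in_V[OF x]]] bilinear_rsub[OF christoffel_bilinear[OF in_V[OF x]]]
  have 1: "fd (\<lambda>y. fd X y w) x v = fd (\<lambda>y. fd X y v) x w"
    by (rule fd_fd_commute[OF open_U X_smooth x])
  have 2: "fd X x v = - A x v - \<Gamma> x v (X x)" for v using A_def[OF x, of v] by simp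
  show ?thesis
    using christoffel_sym[OF in_V[OF x], of v w]
    by (simp add: nabA_def DA_def curvature_def 1 2 b)
qed

text \<open>The derivative of the constant trace vanishes, and the two connection terms form a
  commutator, which has trace zero.\<close>

lemma nabA_trace: assumes x: "x \<in> U" shows "linear (nabA x v)" "trace2 (nabA x v) = 0"
proof -
  note lA = linear_A[OF x]
  have l\<Gamma>: "linear (\<Gamma> x v)" using christoffel_bilinear[OF in_V[OF x]] by (simp add: bilinear_def)
  have lDA: "linear (DA x v)"
  proof (rule linearI)
    fix a b :: "real^2" and s :: real
    have "((\<lambda>y. A y (a + b)) has_derivative (\<lambda>v. DA x v a + DA x v b)) (at x)"
      by (rule has_derivative_transform_within_open[OF has_derivative_add[OF A_has_derivative[OF x] A_has_derivative[OF x]] open_U x])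
        (simp add: linear_add[OF linear_A])
    from fun_cong[OF has_derivative_unique[OF A_has_derivative[OF x] this]]
    show "DA x v (a + b) = DA x v a + DA x v b" by simp
    have "((\<lambda>y. A y (s *\<^sub>R a)) has_derivative (\<lambda>v. s *\<^sub>R DA x v a)) (at x)"
      by (rule has_derivative_transform_within_open[OF has_derivative_scaleR_right[OF A_has_derivative[OF x]] open_U x])
        (simp add: linear_scale[OF linear_A])
    from fun_cong[OF has_derivative_unique[OF A_has_derivative[OF x] this]]
    show "DA x v (s *\<^sub>R a) = s *\<^sub>R DA x v a" by simp
  qed
  show "linear (nabA x v)"
    by (rule linearI) (simp_all add: nabA_def linear_add[OF lA] linear_add[OF l\<Gamma>] linear_add[OF lDA]
        linear_scale[OF lA] linear_scale[OF l\<Gamma>] linear_scale[OF lDA] algebra_simps)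
  have "((\<lambda>y. A y e\<^sub>1 $ 1 + A y e\<^sub>2 $ 2) has_derivative (\<lambda>v. DA x v e\<^sub>1 $ 1 + DA x v e\<^sub>2 $ 2)) (at x)"
    by (intro has_derivative_add bounded_linear.has_derivative[OF bounded_linear_vec_nth] A_has_derivative x)
  then have "(\<lambda>v. DA x v e\<^sub>1 $ 1 + DA x v e\<^sub>2 $ 2) = (\<lambda>v. 0)"
  proof (rule has_derivative_unique)
    show "((\<lambda>y. A y e\<^sub>1 $ 1 + A y e\<^sub>2 $ 2) has_derivative (\<lambda>v. 0)) (at x)"
      by (rule has_derivative_transform_within_open[OF has_derivative_const open_U x])
        (use mean_curvature[unfolded trace2_def] in simp)
  qed
  from fun_cong[OF this, of v] show "trace2 (nabA x v) = 0"
    using trace2_commute[OF lA l\<Gamma>] unfolding trace2_def nabA_def vector_add_component vector_minus_component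
    by linarith
qed

text \<open>\<open>A\<close> is selfadjoint for \<open>G\<close>, but the base connection is
  compatible with \<open>g\<close> only. Differentiating \<open>du \<otimes> du\<close> in
  \<open>G\<close> produces the terms with \<open>hess\<close>.\<close>

lemma nabA_selfadjoint:
  assumes x: "x \<in> U"
  shows "G x (nabA x v w) z + hess x v (A x w) * du x z + du x (A x w) * hess x v z =
    G x w (nabA x v z) + hess x v w * du x (A x z) + du x w * hess x v (A x z)"
proof -
  note xV = in_V[OF x]
  have D: "((\<lambda>y. G y (a y) (b y)) has_derivative (\<lambda>v. G x (a' v + \<Gamma> x v (a x)) (b x) + G x (a x) (b' v + \<Gamma> x v (b x)) +
      hess x v (a x) * du x (b x) + du x (a x) * hess x v (b x))) (at x)"
    if "(a has_derivative a') (at x)" "(b has_derivative b') (at x)" for a a' b b'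
  proof -
    have "((\<lambda>y. G y (a y) (b y)) has_derivative (\<lambda>v. (g x (a' v + \<Gamma> x v (a x)) (b x) + g x (a x) (b' v + \<Gamma> x v (b x))) +
      (du x (a x) * (hess x v (b x) + du x (b' v + \<Gamma> x v (b x))) +
       (hess x v (a x) + du x (a' v + \<Gamma> x v (a x))) * du x (b x)))) (at x)"
      unfolding G_def
      by (intro has_derivative_add has_derivative_mult du_vector_has_derivative x that
          has_derivative_g[OF xV has_derivative_ident])
    then show ?thesis by (rule has_derivative_eq_rhs) (simp add: G_def algebra_simps)
  qed
  have l: "((\<lambda>y. G y (A y w) z) has_derivative (\<lambda>v. G x (DA x v w + \<Gamma> x v (A x w)) z + G x (A x w) (0 + \<Gamma> x v z) +
      hess x v (A x w) * du x z + du x (A x w) * hess x v z)) (at x)"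
    by (rule D[OF A_has_derivative[OF x] has_derivative_const])
  have "((\<lambda>y. G y w (A y z)) has_derivative (\<lambda>v. G x (0 + \<Gamma> x v w) (A x z) + G x w (DA x v z + \<Gamma> x v (A x z)) +
      hess x v w * du x (A x z) + du x w * hess x v (A x z))) (at x)"
    by (rule D[OF has_derivative_const A_has_derivative[OF x]])
  then have r: "((\<lambda>y. G y (A y w) z) has_derivative (\<lambda>v. G x (0 + \<Gamma> x v w) (A x z) + G x w (DA x v z + \<Gamma> x v (A x z)) +
      hess x v w * du x (A x z) + du x w * hess x v (A x z))) (at x)"
    by (rule has_derivative_transform_within_open[OF _ open_U x]) (simp add: A_selfadjoint)
  from fun_cong[OF has_derivative_unique[OF l r], of v]
  show ?thesis
    using A_selfadjoint[OF x, of "\<Gamma> x v w" z] A_selfadjoint[OF x, of w "\<Gamma> x v z"]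
    by (simp add: nabA_def G_simps[OF x])
qed

lemma \<nu>_second_derivative:
  assumes x: "x \<in> U"
  shows "((\<lambda>y. - du y (A y w)) has_derivative
    (\<lambda>v. - (hess x v (A x w) + du x (nabA x v w) + du x (A x (\<Gamma> x v w))))) (at x)"
  by (rule has_derivative_eq_rhs[OF has_derivative_minus[OF du_vector_has_derivative[OF x A_has_derivative[OF x]]]])
    (simp add: nabA_def du_simps[OF x])

text \<open>The gradient of the height for the induced metric, projected to the base, is
  \<open>- \<nu> x *\<^sub>R X x\<close>. So statements about the direction of this gradient become
  statements about \<open>X\<close>.\<close>

lemma du_eq_G: assumes x: "x \<in> U" shows "du x z = - \<nu> x * G x (X x) z"
proof -
  have *: "G x (X x) z = - \<nu> x * du x z + du x (X x) * du x z" by (simp add: G_def normal[OF x])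
  have **: "\<nu> x * du x (X x) = (\<nu> x)\<^sup>2 - 1" using normal[OF x, of "X x"] unit[OF x] by simp
  have "- \<nu> x * G x (X x) z = (\<nu> x)\<^sup>2 * du x z - (\<nu> x * du x (X x)) * du x z"
    unfolding * by (simp add: algebra_simps power2_eq_square)
  then show ?thesis unfolding ** by (simp add: algebra_simps)
qed

text \<open>
  The \<open>G\<close>-Laplacian of \<open>u + f(\<nu>)\<close> at a critical point, where \<open>f1\<close> and \<open>f2\<close> are the derivatives of
  \<open>f\<close>: there \<open>X\<close> is a principal direction with curvature \<open>1 / f1\<close>.
\<close>

lemma critical_point_laplacian:
  fixes f1 f2 :: real
  assumes x: "x \<in> U" and X0: "X x \<noteq> 0" and f1: "f1 \<noteq> 0"
    and crit: "\<And>v. du x v = f1 * du x (A x v)"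
  defines "D2 v \<equiv> hess x v v + f2 * (du x (A x v))\<^sup>2 - f1 * (hess x v (A x v) + du x (nabA x v v))"
    and "l \<equiv> 1 / f1" and "s \<equiv> 1 - (\<nu> x)\<^sup>2" and "n \<equiv> \<nu> x"
  obtains Y where "Y \<noteq> 0"
    "D2 (X x) / G x (X x) (X x) + D2 Y / G x Y Y =
      2 * H / n + f2 * l\<^sup>2 * s - f1 * ((l\<^sup>2 + (2 * H - l)\<^sup>2) / n + n * K x * s + (2 * l - 2 * H) * (2 * H - l) * s / n)"
proof -
  note xV = in_V[OF x]
  \<comment> \<open>\<open>Y\<close> represents the covector \<open>det2 (X x)\<close>: it is
    \<open>X x\<close> turned by a right angle. At this point \<open>X x\<close> and
    \<open>Y\<close> are orthogonal for \<open>g\<close> and, because \<open>du x Y = 0\<close>,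
    also for \<open>G\<close>.\<close>
  define Y where "Y = sharp x (- (X x $ 2)) (X x $ 1)"
  have gY: "g x Y v = det2 (X x) v" for v
    using g_sharp[OF xV] by (simp add: Y_def det2_def)
  have gXY: "g x (X x) Y = 0" using gY[of "X x"] g_sym[OF xV, of Y] by (simp add: det2_def)
  have Y0: "Y \<noteq> 0"
  proof
    assume "Y = 0"
    then have "det2 (X x) v = 0" for v using gY[of v] g_zero_left[OF xV] by simp
    from this[of e\<^sub>1] this[of e\<^sub>2] have "X x = 0" by (simp add: det2_def axis_def vec_eq_iff forall_2)
    then show False using X0 by simp
  qed
  have det: "det2 (X x) Y \<noteq> 0" using g_pos[OF xV Y0] gY[of Y] by simp
  have n: "n \<noteq> 0" "n < 0" using neg[OF x] by (auto simp: n_def)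
  have duY: "du x Y = 0" using normal[OF x, of Y] gXY n by (simp add: n_def)
  have s: "g x (X x) (X x) = s" using unit[OF x] by (simp add: s_def)
  have duX: "du x (X x) = - s / n" using normal[OF x, of "X x"] s n by (simp add: n_def field_simps)
  have s0: "s \<noteq> 0" using g_pos[OF xV X0] s by simp
  have GXX: "G x (X x) (X x) = s / n\<^sup>2"
    using du_eq_G[OF x, of "X x"] duX n by (simp add: n_def field_simps power2_eq_square)
  have GYY: "G x Y Y > 0" by (rule G_pos[OF x Y0])
  have GXY: "G x (X x) Y = 0" using gXY duY by (simp add: G_def)
  have duA: "du x (A x v) = l * du x v" for v using crit[of v] f1 by (simp add: l_def)
  \<comment> \<open>\<open>crit\<close> says that \<open>du x\<close> is an eigencovector of
    \<open>A\<close>. It is dual to \<open>X x\<close> for \<open>G\<close> up to a factor, so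
    selfadjointness makes \<open>X x\<close> an eigenvector.\<close>
  have AX: "A x (X x) = l *\<^sub>R X x"
  proof -
    have "G x (A x (X x) - l *\<^sub>R X x) z = 0" for z
      using A_selfadjoint[OF x, of "X x" z] du_eq_G[OF x, of "A x z"] du_eq_G[OF x, of z] duA[of z] neg[OF x]
      by (simp add: G_simps[OF x])
    then show ?thesis using G_pos[OF x, of "A x (X x) - l *\<^sub>R X x"] by force
  qed
  obtain a0 \<mu> where AY0: "A x Y = a0 *\<^sub>R X x + \<mu> *\<^sub>R Y" using det2_basis[OF det] .
  have "a0 = 0" using duA[of Y] duY duX s0 n by (simp add: AY0 du_simps[OF x])
  then have AY: "A x Y = \<mu> *\<^sub>R Y" using AY0 by simp
  have "(l + \<mu>) * det2 (X x) Y = 2 * H * det2 (X x) Y"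
    using trace2_det2[OF linear_A[OF x], of "X x" Y] mean_curvature[OF x]
    by (simp add: AX AY det2_def algebra_simps)
  then have \<mu>: "\<mu> = 2 * H - l" using det by simp
  obtain a b where nX: "nabA x (X x) (X x) = a *\<^sub>R X x + b *\<^sub>R Y" using det2_basis[OF det] .
  obtain c d where nY: "nabA x (X x) Y = c *\<^sub>R X x + d *\<^sub>R Y" using det2_basis[OF det] .
  have "(a + d) * det2 (X x) Y = 0"
    using trace2_det2[OF nabA_trace(1)[OF x], of "X x" "X x" Y] nabA_trace(2)[OF x, of "X x"]
    by (simp add: nX nY det2_def algebra_simps)
  then have d: "d = - a" using det by simp
  have hXX: "hess x (X x) (X x) = l * G x (X x) (X x) / n"
    using hess_eq[OF x, of "X x" "X x"] n by (simp add: AX G_simps[OF x] n_def field_simps)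
  have hYY: "hess x Y Y = \<mu> * G x Y Y / n"
    using hess_eq[OF x, of Y Y] n by (simp add: AY G_simps[OF x] n_def field_simps)
  have hs: "hess x v (r *\<^sub>R w) = r * hess x v w" for v w r
  proof -
    have "n * hess x v (r *\<^sub>R w) = n * (r * hess x v w)"
      using hess_eq[OF x, of v w] hess_eq[OF x, of v "r *\<^sub>R w"] by (simp add: G_simps[OF x] n_def)
    then show ?thesis using n by simp
  qed
  have hYX: "hess x Y (X x) = 0"
    using hess_eq[OF x, of Y "X x"] n GXY G_sym[OF x, of Y] by (simp add: AY G_simps[OF x] n_def)
  \<comment> \<open>The derivative of \<open>A\<close> along \<open>Y\<close> is traded for the one
    along \<open>X x\<close>, whose trace is zero. The unknown coefficient \<open>a\<close> then
    enters the two quotients with opposite signs and cancels in their sum.\<close>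
  have nabYX: "nabA x Y (X x) = nabA x (X x) Y - R x Y (X x) (X x)"
    using codazzi[OF x, of Y "X x"] by (simp add: algebra_simps)
  have gauss: "G x (R x Y (X x) (X x)) Y = K x * (G x Y Y * s)"
    using gauss_equation_2d[OF xV, of Y "X x"] gXY g_sym[OF xV, of Y "X x"] duY s by (simp add: G_def)
  have "G x (X x) (nabA x Y Y) = G x (nabA x Y (X x)) Y + l * du x (X x) * hess x Y Y - du x (X x) * \<mu> * hess x Y Y"
    using nabA_selfadjoint[OF x, of Y "X x" Y]
    by (simp add: AX AY hs hYX duY du_simps[OF x])
  also have "G x (nabA x Y (X x)) Y = - a * G x Y Y - K x * (G x Y Y * s)"
    by (simp add: nabYX nY d G_simps[OF x] GXY gauss)
  finally have "G x (X x) (nabA x Y Y) = G x Y Y * (- a - K x * s + (l - \<mu>) * \<mu> * du x (X x) / n)"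
    by (simp add: hYY algebra_simps diff_divide_distrib)
  then have duYY: "du x (nabA x Y Y) = - n * (G x Y Y * (- a - K x * s + (l - \<mu>) * \<mu> * du x (X x) / n))"
    using du_eq_G[OF x, of "nabA x Y Y"] by (simp add: n_def)
  have "D2 Y = G x Y Y * (\<mu> / n - f1 * (\<mu>\<^sup>2 / n - n * (- a - K x * s + (l - \<mu>) * \<mu> * du x (X x) / n)))"
  proof -
    have "D2 Y = \<mu> * G x Y Y / n - f1 * (\<mu> * (\<mu> * G x Y Y / n) +
        - n * (G x Y Y * (- a - K x * s + (l - \<mu>) * \<mu> * du x (X x) / n)))"
      unfolding D2_def duYY by (simp add: AY hs hYY du_simps[OF x] duY)
    then show ?thesis using n by (simp add: algebra_simps power2_eq_square diff_divide_distrib)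
  qed
  then have Q2: "D2 Y / G x Y Y = \<mu> / n - f1 * (\<mu>\<^sup>2 / n - n * (- a - K x * s + (l - \<mu>) * \<mu> * du x (X x) / n))"
    using GYY by simp
  have "D2 (X x) = l * (s / n\<^sup>2) / n + f2 * (l * (- s / n))\<^sup>2 - f1 * (l * (l * (s / n\<^sup>2) / n) + a * (- s / n))"
    unfolding D2_def by (simp add: AX hs hXX nX GXX du_simps[OF x] duX duY)
  also have "\<dots> = (s / n\<^sup>2) * (l / n + f2 * l\<^sup>2 * s - f1 * (l\<^sup>2 / n - n * a))"
    using n by (simp add: field_simps power2_eq_square)
  finally have Q1: "D2 (X x) / G x (X x) (X x) = l / n + f2 * l\<^sup>2 * s - f1 * (l\<^sup>2 / n - n * a)"
    using s0 n by (simp add: GXX)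
  show ?thesis
  proof (rule that[OF Y0])
    show "D2 (X x) / G x (X x) (X x) + D2 Y / G x Y Y =
      2 * H / n + f2 * l\<^sup>2 * s - f1 * ((l\<^sup>2 + (2 * H - l)\<^sup>2) / n + n * K x * s + (2 * l - 2 * H) * (2 * H - l) * s / n)"
    proof -
      have "n * (- a - K x * s + (l - \<mu>) * \<mu> * (- s / n) / n) = - (n * a) - n * K x * s - (l - \<mu>) * \<mu> * s / n"
        using n by (simp add: field_simps)
      moreover have "2 * l - 2 * H = l - \<mu>" "2 * H - l = \<mu>" "2 * H = l + \<mu>" using \<mu> by simp_all
      ultimately show ?thesis
        unfolding Q1 Q2 duX using n by (simp add: add_divide_distrib diff_divide_distrib algebra_simps)
    qed
  qed
qed

text \<open>At a maximum the second derivatives along \<open>X x\<close> and \<open>Y\<close> are at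
  most zero, but their sum, weighted by the inverse squared lengths for \<open>G\<close>, is
  positive by \<open>critical_point_laplacian\<close> and \<open>laplacian_positive\<close>. Where
  \<open>X x\<close> vanishes there is no distinguished direction, so such points are left to the
  caller.\<close>

lemma no_interior_max:
  assumes x: "x \<in> U" and X0: "X x \<noteq> 0" and H: "H > 0" and m: "0 < m" "m < 1/2"
    and c: "4 * H\<^sup>2 + c > 0" "c \<le> K x"
    and f: "\<And>t. \<bar>t\<bar> \<le> 1 \<Longrightarrow> (f has_real_derivative m * (4 * H) / (4 * H\<^sup>2 + c * (1 - t\<^sup>2))) (at t)"
    and max: "\<And>y. y \<in> U \<Longrightarrow> u y + f (\<nu> y) \<le> u x + f (\<nu> x)"
  shows False
proof -
  note xV = in_V[OF x]
  have \<nu>1: "(\<nu> y)\<^sup>2 \<le> 1" if "y \<in> U" for y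
    using unit[OF that] g_nonneg[OF in_V[OF that], of "X y"] by simp
  have pos: "4 * H\<^sup>2 + c * (1 - t\<^sup>2) > 0" if "t\<^sup>2 \<le> 1" for t
  proof (cases "c \<ge> 0")
    case True
    then show ?thesis using that H by (simp add: add_pos_nonneg)
  next
    case False
    have "c * (1 - t\<^sup>2) \<ge> c * 1" using False by (intro mult_left_mono_neg) auto
    then show ?thesis using c by simp
  qed
  define s where "s = 1 - (\<nu> x)\<^sup>2"
  define D where "D = 4 * H\<^sup>2 + c * s"
  define f1 where "f1 = m * (4 * H) / D"
  define f2 where "f2 = f1 * (2 * c * \<nu> x / D)"
  define F where "F t = m * (4 * H) / (4 * H\<^sup>2 + c * (1 - t\<^sup>2))" for t
  have D: "D > 0" using pos[OF \<nu>1[OF x]] by (simp add: D_def s_def)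
  have f1: "f1 > 0" using D H m by (simp add: f1_def)
  have Ff1: "F (\<nu> x) = f1" by (simp add: F_def f1_def D_def s_def)
  have dF: "(F has_real_derivative f2) (at (\<nu> x))"
  proof -
    have D': "4 * H\<^sup>2 + c * (1 - (\<nu> x)\<^sup>2) = D" by (simp add: D_def s_def)
    have "((\<lambda>t. 4 * H\<^sup>2 + c * (1 - t\<^sup>2)) has_real_derivative - (2 * c * \<nu> x)) (at (\<nu> x))"
      by (auto intro!: derivative_eq_intros)
    from DERIV_cmult[OF DERIV_inverse'[OF this], of "m * (4 * H)"]
    have "((\<lambda>t. m * (4 * H) * inverse (4 * H\<^sup>2 + c * (1 - t\<^sup>2))) has_real_derivative
        m * (4 * H) * - (inverse D * - (2 * c * \<nu> x) * inverse D)) (at (\<nu> x))"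
      using D unfolding D' by blast
    moreover have "m * (4 * H) * - (inverse D * - (2 * c * \<nu> x) * inverse D) = f2"
      by (simp add: f2_def f1_def divide_inverse)
    ultimately show ?thesis
      unfolding F_def divide_inverse by simp
  qed
  have d\<psi>: "((\<lambda>y. u y + f (\<nu> y)) has_derivative (\<lambda>v. du y v + F (\<nu> y) * (- du y (A y v)))) (at y)"
    if "y \<in> U" for y
  proof -
    have "(f has_derivative (*) (F (\<nu> y))) (at (\<nu> y))"
      using f[of "\<nu> y"] \<nu>1[OF that] by (simp add: F_def has_field_derivative_def abs_square_le_1)
    from has_derivative_add[OF smooth_on_has_derivative[OF u_smooth that] has_derivative_compose[OF \<nu>_deriv[OF that] this]]
    show ?thesis .
  qed
  have dd\<psi>: "((\<lambda>y. du y v + F (\<nu> y) * (- du y (A y v))) has_derivative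
      (\<lambda>w. (hess x w v + du x (\<Gamma> x w v)) +
        (F (\<nu> x) * (- (hess x w (A x v) + du x (nabA x w v) + du x (A x (\<Gamma> x w v)))) +
         f2 * (- du x (A x w)) * (- du x (A x v))))) (at x)" for v
    by (rule has_derivative_add[OF du_has_derivative[OF x] has_derivative_mult[OF
          has_derivative_compose[OF \<nu>_deriv[OF x] dF[unfolded has_field_derivative_def]]
          \<nu>_second_derivative[OF x]]])
  have crit: "du x v = f1 * du x (A x v)" for v
    using local_max_derivatives(1)[where \<psi> = "\<lambda>y. u y + f (\<nu> y)" and \<psi>' = "\<lambda>y v. du y v + F (\<nu> y) * (- du y (A y v))" and v = v, OF open_U x max d\<psi> dd\<psi>]
    by (simp add: Ff1)
  \<comment> \<open>The first order condition in the direction \<open>\<Gamma> x v v\<close> removes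
    the Christoffel terms, so the second derivative in coordinates equals the covariant one.\<close>
  have le: "hess x v v + f2 * (du x (A x v))\<^sup>2 - f1 * (hess x v (A x v) + du x (nabA x v v)) \<le> 0" for v
    using local_max_derivatives(2)[where \<psi> = "\<lambda>y. u y + f (\<nu> y)" and \<psi>' = "\<lambda>y v. du y v + F (\<nu> y) * (- du y (A y v))", OF open_U x max d\<psi> dd\<psi>, of v]
      crit[of "\<Gamma> x v v"]
    by (simp add: Ff1 power2_eq_square algebra_simps)
  obtain Y where Y: "Y \<noteq> 0"
    "(hess x (X x) (X x) + f2 * (du x (A x (X x)))\<^sup>2 - f1 * (hess x (X x) (A x (X x)) + du x (nabA x (X x) (X x)))) / G x (X x) (X x) +
     (hess x Y Y + f2 * (du x (A x Y))\<^sup>2 - f1 * (hess x Y (A x Y) + du x (nabA x Y Y))) / G x Y Y =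
      2 * H / \<nu> x + f2 * (1 / f1)\<^sup>2 * s - f1 * (((1 / f1)\<^sup>2 + (2 * H - 1 / f1)\<^sup>2) / \<nu> x +
        \<nu> x * K x * s + (2 * (1 / f1) - 2 * H) * (2 * H - 1 / f1) * s / \<nu> x)"
    using critical_point_laplacian[OF x X0 less_imp_neq[OF f1, symmetric] crit, of f2]
    unfolding s_def by blast
  have "\<dots> > 0"
    by (rule laplacian_positive[OF neg[OF x] s_def _ H m c(2) D_def D f1_def f2_def refl])
      (use \<nu>1[OF x] in \<open>simp add: s_def\<close>)
  moreover have "(hess x (X x) (X x) + f2 * (du x (A x (X x)))\<^sup>2 - f1 * (hess x (X x) (A x (X x)) + du x (nabA x (X x) (X x)))) / G x (X x) (X x) \<le> 0"
    using le[of "X x"] G_pos[OF x X0] by (simp add: divide_le_0_iff)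
  moreover have "(hess x Y Y + f2 * (du x (A x Y))\<^sup>2 - f1 * (hess x Y (A x Y) + du x (nabA x Y Y))) / G x Y Y \<le> 0"
    using le[of Y] G_pos[OF x Y(1)] by (simp add: divide_le_0_iff)
  ultimately show False using Y(2) by linarith
qed

text \<open>At a minimum \<open>du\<close> vanishes and \<open>hess\<close> is nonnegative. Since
  \<nu> < 0, \<open>hess_eq\<close> makes \<open>A\<close> nonpositive, against its trace
  \<open>2 * H > 0\<close>.\<close>

lemma no_interior_min:
  assumes x: "x \<in> U" and H: "H > 0" and min: "\<And>y. y \<in> U \<Longrightarrow> u x \<le> u y"
  shows False
proof -
  note xV = in_V[OF x]
  have d: "((\<lambda>y. - u y) has_derivative (\<lambda>v. - du y v)) (at y)" if "y \<in> U" for y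
    by (rule has_derivative_minus[OF smooth_on_has_derivative[OF u_smooth that]])
  have dd: "((\<lambda>y. - du y v) has_derivative (\<lambda>w. - (hess x w v + du x (\<Gamma> x w v)))) (at x)" for v
    by (rule has_derivative_minus[OF du_has_derivative[OF x]])
  have du0: "du x v = 0" for v
    using local_max_derivatives(1)[where \<psi> = "\<lambda>y. - u y" and \<psi>' = "\<lambda>y v. - du y v" and v = v, OF open_U x _ d dd] min by simp
  have ge: "hess x v v \<ge> 0" for v
    using local_max_derivatives(2)[where \<psi> = "\<lambda>y. - u y" and \<psi>' = "\<lambda>y v. - du y v", OF open_U x _ d dd, of v] min du0 by simp
  have le: "g x (A x v) v \<le> 0" for v
    using hess_eq[OF x, of v v] ge[of v] neg[OF x] du0 
    by (simp add: G_def) (metis mult_nonneg_nonpos2 less_imp_le mult.commute)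
  define Y where "Y = sharp x (- (e\<^sub>1 $ 2)) (e\<^sub>1 $ 1)"
  have gY: "g x Y v = det2 e\<^sub>1 v" for v
    using g_sharp[OF xV] by (simp add: Y_def det2_def)
  have e: "e\<^sub>1 \<noteq> 0" by (simp add: axis_eq_0_iff)
  have Y0: "Y \<noteq> 0"
    using gY[of e\<^sub>2] g_zero_left[OF xV] by (auto simp: det2_def axis_def)
  have gXY: "g x e\<^sub>1 Y = 0" using gY[of e\<^sub>1] g_sym[OF xV, of Y] by (simp add: det2_def)
  have det: "det2 e\<^sub>1 Y \<noteq> 0" using g_pos[OF xV Y0] gY[of Y] by simp
  obtain a b where AX: "A x e\<^sub>1 = a *\<^sub>R e\<^sub>1 + b *\<^sub>R Y" using det2_basis[OF det] .
  obtain c d where AY: "A x Y = c *\<^sub>R e\<^sub>1 + d *\<^sub>R Y" using det2_basis[OF det] .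
  have "(a + d) * det2 e\<^sub>1 Y = 2 * H * det2 e\<^sub>1 Y"
    using trace2_det2[OF linear_A[OF x], of e\<^sub>1 Y] mean_curvature[OF x]
    by (simp add: AX AY det2_def algebra_simps)
  then have "a + d = 2 * H" using det by simp
  moreover have "a \<le> 0"
    using le[of e\<^sub>1] g_pos[OF xV e] gXY g_sym[OF xV, of Y]
    by (simp add: AX g_simps xV mult_le_0_iff)
  moreover have "d \<le> 0"
    using le[of Y] g_pos[OF xV Y0] gXY by (simp add: AY g_simps xV mult_le_0_iff)
  ultimately show False using H by simp
qed

end

section \<open>Functions differentiable on one side of a line\<close>

text \<open>\<open>inverse_function_theorem\<close> asks for a derivative that is continuous as an
  operator; in finite dimension this follows from continuity in each fixed direction.\<close>

lemma inverse_function_smooth: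
  fixes \<Phi> :: "'a::euclidean_space \<Rightarrow> 'a"
  assumes S: "open S" "smooth_on S \<Phi>" "x0 \<in> S" and inj: "inj (fd \<Phi> x0)"
  obtains U V \<Psi> where "open U" "U \<subseteq> S" "x0 \<in> U" "open V" "\<Phi> x0 \<in> V" "homeomorphism U V \<Phi> \<Psi>"
    "\<And>y. y \<in> V \<Longrightarrow> \<Psi> differentiable (at y)"
proof -
  define L where "L x = Blinfun (fd \<Phi> x)" for x
  have bl: "bounded_linear (fd \<Phi> x)" if "x \<in> S" for x
    using smooth_on_has_derivative[OF S(2) that] by (rule has_derivative_bounded_linear)
  have L: "blinfun_apply (L x) = fd \<Phi> x" if "x \<in> S" for x
    by (simp add: L_def bounded_linear_Blinfun_apply[OF bl[OF that]])
  have contL: "continuous_on S L"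
  proof (rule continuous_on_blinfun_componentwise)
    fix b :: 'a
    have "continuous_on S (\<lambda>x. fd \<Phi> x b)" by (intro smooth_on_continuous_on smooth_on_fd S)
    then show "continuous_on S (\<lambda>x. blinfun_apply (L x) b)"
      by (rule continuous_on_eq) (simp add: L)
  qed
  have lin: "linear (fd \<Phi> x0)" using bl[OF S(3)] by (rule bounded_linear.linear)
  obtain h where h: "linear h" "h \<circ> fd \<Phi> x0 = id"
    using linear_injective_left_inverse[OF lin inj] by blast
  have "Blinfun h o\<^sub>L L x0 = id_blinfun"
    by (rule blinfun_eqI)
      (use h S(3) in \<open>auto simp: L bounded_linear_Blinfun_apply linear_conv_bounded_linear o_def fun_eq_iff\<close>)
  from inverse_function_theorem[OF S(1) _ contL S(3) this]
  obtain U V \<Psi> \<Psi>' where "open U" "U \<subseteq> S" "x0 \<in> U" "open V" "\<Phi> x0 \<in> V" "homeomorphism U V \<Phi> \<Psi>"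
    "\<And>y. y \<in> V \<Longrightarrow> (\<Psi> has_derivative (\<Psi>' y)) (at y)"
    using smooth_on_has_derivative[OF S(2)] by (metis L)
  then show ?thesis using that unfolding differentiable_def by metis
qed

text \<open>The difference quotient of \<open>\<phi> \<circ> y\<close> is that of \<open>y\<close>
  times the Caratheodory slope \<open>q (y s)\<close>, which tends to \<open>l \<noteq> 0\<close>
  because \<open>y\<close> is continuous. It recovers the differentiability of a lifted curve that
  is only known to be continuous.\<close>

lemma reparam_differentiable:
  fixes \<phi> y :: "real \<Rightarrow> real"
  assumes \<phi>: "(\<phi> has_real_derivative l) (at (y t))" "l \<noteq> 0"
    and y: "isCont y t" and c: "((\<lambda>s. \<phi> (y s)) has_real_derivative d) (at t)"
  shows "(y has_real_derivative d / l) (at t)"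
proof -
  obtain q where q: "\<And>z. \<phi> z - \<phi> (y t) = q z * (z - y t)" "isCont q (y t)" "q (y t) = l"
    using \<phi>(1) unfolding CARAT_DERIV by blast
  have "isCont (\<lambda>s. q (y s)) t" using isCont_o2[OF y] q(2) by blast
  then have lim: "((\<lambda>s. q (y s)) \<longlongrightarrow> l) (at t)" using q(3) by (simp add: isCont_def)
  have "((\<lambda>s. ((\<phi> (y s) - \<phi> (y t)) / (s - t)) / q (y s)) \<longlongrightarrow> d / l) (at t)"
    using c lim \<phi>(2) unfolding has_field_derivative_iff by (intro tendsto_divide)
  moreover have "\<forall>\<^sub>F s in at t. ((\<phi> (y s) - \<phi> (y t)) / (s - t)) / q (y s) = (y s - y t) / (s - t)"
    using tendsto_imp_eventually_ne[OF lim \<phi>(2)] by eventually_elim (simp add: q(1))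
  ultimately have "((\<lambda>s. (y s - y t) / (s - t)) \<longlongrightarrow> d / l) (at t)"
    by (rule Lim_transform_eventually)
  then show ?thesis by (simp add: has_field_derivative_iff)
qed

text \<open>
  On a half disc the functions of interest are continuous, but differentiable only off the line
  \<open>x $ 1 = 0\<close>.
\<close>

locale half_disc =
  fixes W :: "(real^2) set" and x0 :: "real^2"
  assumes open_W: "open W" and x0: "x0 \<in> W" "x0 $ 1 = 0"
begin

abbreviation "WQ \<equiv> W \<inter> {x. 0 \<le> x $ 1}"

lemma continuous_gt:
  fixes \<phi> :: "real^2 \<Rightarrow> real"
  assumes "continuous_on WQ \<phi>" "\<phi> x0 > k"
  obtains r where "r > 0" "\<And>a b. 0 \<le> a \<Longrightarrow> a < r \<Longrightarrow> \<bar>b\<bar> < r \<Longrightarrow> x0 + a *\<^sub>R e\<^sub>1 + b *\<^sub>R e\<^sub>2 \<in> WQ"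
    "\<And>a b. 0 \<le> a \<Longrightarrow> a < r \<Longrightarrow> \<bar>b\<bar> < r \<Longrightarrow> \<phi> (x0 + a *\<^sub>R e\<^sub>1 + b *\<^sub>R e\<^sub>2) > k"
proof -
  obtain d1 where d1: "d1 > 0" "\<And>x. x \<in> WQ \<Longrightarrow> dist x x0 < d1 \<Longrightarrow> dist (\<phi> x) (\<phi> x0) < \<phi> x0 - k"
    using assms x0 unfolding continuous_on_iff by (metis (no_types, lifting) IntI diff_gt_0_iff_gt mem_Collect_eq order_refl)
  obtain d2 where d2: "d2 > 0" "ball x0 d2 \<subseteq> W" using open_W x0 openE by blast
  define r where "r = min d1 d2 / 2"
  have near: "dist (x0 + a *\<^sub>R e\<^sub>1 + b *\<^sub>R e\<^sub>2) x0 < min d1 d2" if "\<bar>a\<bar> < r" "\<bar>b\<bar> < r" for a b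
  proof -
    have "dist (x0 + a *\<^sub>R e\<^sub>1 + b *\<^sub>R e\<^sub>2) x0 = norm (a *\<^sub>R e\<^sub>1 + b *\<^sub>R e\<^sub>2)" by (simp add: dist_norm)
    also have "\<dots> \<le> \<bar>a\<bar> + \<bar>b\<bar>" using norm_triangle_ineq[of "a *\<^sub>R e\<^sub>1" "b *\<^sub>R e\<^sub>2"] by simp
    also have "\<dots> < min d1 d2" using that by (simp add: r_def)
    finally show ?thesis .
  qed
  have inW: "x0 + a *\<^sub>R e\<^sub>1 + b *\<^sub>R e\<^sub>2 \<in> WQ" if "0 \<le> a" "a < r" "\<bar>b\<bar> < r" for a b
    using near[of a b] that d2(2) x0 by (auto simp: dist_commute axis_def subset_iff)
  show ?thesis
  proof (rule that[of r])
    show "r > 0" using d1 d2 by (simp add: r_def)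
    show "\<phi> (x0 + a *\<^sub>R e\<^sub>1 + b *\<^sub>R e\<^sub>2) > k" if "0 \<le> a" "a < r" "\<bar>b\<bar> < r" for a b
    proof -
      have "dist (\<phi> (x0 + a *\<^sub>R e\<^sub>1 + b *\<^sub>R e\<^sub>2)) (\<phi> x0) < \<phi> x0 - k"
        by (rule d1(2)[OF inW[OF that]]) (use near[of a b] that in simp)
      then show ?thesis by (simp add: dist_real_def)
    qed
  qed (rule inW)
qed

lemma boundary_le:
  fixes \<phi> :: "real^2 \<Rightarrow> real"
  assumes "continuous_on WQ \<phi>" "\<And>x. x \<in> W \<Longrightarrow> x $ 1 > 0 \<Longrightarrow> \<phi> x \<le> k"
  shows "\<phi> x0 \<le> k"
proof (rule ccontr)
  assume "\<not> \<phi> x0 \<le> k"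
  then obtain r where r: "r > 0" "\<And>a b. 0 \<le> a \<Longrightarrow> a < r \<Longrightarrow> \<bar>b\<bar> < r \<Longrightarrow> x0 + a *\<^sub>R e\<^sub>1 + b *\<^sub>R e\<^sub>2 \<in> WQ"
    "\<And>a b. 0 \<le> a \<Longrightarrow> a < r \<Longrightarrow> \<bar>b\<bar> < r \<Longrightarrow> \<phi> (x0 + a *\<^sub>R e\<^sub>1 + b *\<^sub>R e\<^sub>2) > k"
    using continuous_gt[OF assms(1), of k] by (auto simp: not_le)
  from r(2,3)[of "r / 2" 0] r(1) assms(2)[of "x0 + (r / 2) *\<^sub>R e\<^sub>1 + 0 *\<^sub>R e\<^sub>2"] x0 show False
    by (auto simp: axis_def)
qed

lemma boundary_eq:
  fixes \<phi> :: "real^2 \<Rightarrow> real"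
  assumes "continuous_on WQ \<phi>" "\<And>x. x \<in> W \<Longrightarrow> x $ 1 > 0 \<Longrightarrow> \<phi> x = k"
  shows "\<phi> x0 = k"
  using boundary_le[OF assms(1), of k] boundary_le[OF continuous_on_minus[OF assms(1)], of "- k"] assms(2)
  by force

text \<open>The constancy of \<open>\<phi>\<close> on the line cannot be differentiated there, as
  only the continuous extension \<open>E\<close> of the tangential derivative exists. If
  \<open>E x0\<close> were positive, \<open>\<phi>\<close> would grow along parallel segments by an
  amount bounded away from zero, and this would persist in the limit on the line.\<close>

lemma tangential_derivative_nonpos:
  fixes \<phi> E :: "real^2 \<Rightarrow> real"
  assumes \<phi>: "continuous_on WQ \<phi>" and E: "continuous_on WQ E"
    and const: "\<And>x. x \<in> W \<Longrightarrow> x $ 1 = 0 \<Longrightarrow> \<phi> x = k"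
    and d: "\<And>x. x \<in> W \<Longrightarrow> x $ 1 > 0 \<Longrightarrow> (\<phi> has_derivative \<phi>' x) (at x) \<and> \<phi>' x e\<^sub>2 = E x"
  shows "E x0 \<le> 0"
proof (rule ccontr)
  assume "\<not> E x0 \<le> 0"
  then have "E x0 > E x0 / 2" by simp
  then obtain r where r: "r > 0" "\<And>a b. 0 \<le> a \<Longrightarrow> a < r \<Longrightarrow> \<bar>b\<bar> < r \<Longrightarrow> x0 + a *\<^sub>R e\<^sub>1 + b *\<^sub>R e\<^sub>2 \<in> WQ"
    "\<And>a b. 0 \<le> a \<Longrightarrow> a < r \<Longrightarrow> \<bar>b\<bar> < r \<Longrightarrow> E (x0 + a *\<^sub>R e\<^sub>1 + b *\<^sub>R e\<^sub>2) > E x0 / 2"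
    using continuous_gt[OF E] by blast
  define \<delta> where "\<delta> = r / 2"
  have \<delta>: "\<delta> > 0" "\<delta> < r" using r(1) by (auto simp: \<delta>_def)
  have step: "\<phi> (x0 + a *\<^sub>R e\<^sub>1 + \<delta> *\<^sub>R e\<^sub>2) - \<phi> (x0 + a *\<^sub>R e\<^sub>1) \<ge> \<delta> * (E x0 / 2)" if "0 < a" "a < r" for a
  proof -
    have d': "((\<lambda>b. \<phi> (x0 + a *\<^sub>R e\<^sub>1 + b *\<^sub>R e\<^sub>2)) has_real_derivative E (x0 + a *\<^sub>R e\<^sub>1 + b *\<^sub>R e\<^sub>2)) (at b)"
      if "0 \<le> b" "b \<le> \<delta>" for b
    proof -
      have "x0 + a *\<^sub>R e\<^sub>1 + b *\<^sub>R e\<^sub>2 \<in> W" "(x0 + a *\<^sub>R e\<^sub>1 + b *\<^sub>R e\<^sub>2) $ 1 > 0"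
        using r(2)[of a b] that \<open>0 < a\<close> \<open>a < r\<close> \<delta> x0 by (auto simp: axis_def)
      from d[OF this] show ?thesis using has_real_derivative_line by metis
    qed
    obtain z where z: "0 < z" "z < \<delta>" "\<phi> (x0 + a *\<^sub>R e\<^sub>1 + \<delta> *\<^sub>R e\<^sub>2) - \<phi> (x0 + a *\<^sub>R e\<^sub>1 + 0 *\<^sub>R e\<^sub>2) = (\<delta> - 0) * E (x0 + a *\<^sub>R e\<^sub>1 + z *\<^sub>R e\<^sub>2)"
      using MVT2[OF \<delta>(1) d'] by blast
    have "E x0 / 2 \<le> E (x0 + a *\<^sub>R e\<^sub>1 + z *\<^sub>R e\<^sub>2)" using r(3)[of a z] z \<delta> that by simp
    then show ?thesis using z(3) \<delta>(1) by simp
  qed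
  have lim: "((\<lambda>a. \<phi> (x0 + a *\<^sub>R e\<^sub>1 + b *\<^sub>R e\<^sub>2)) \<longlongrightarrow> k) (at_right 0)" if "\<bar>b\<bar> < r" for b
  proof -
    have "((\<lambda>a. \<phi> (x0 + a *\<^sub>R e\<^sub>1 + b *\<^sub>R e\<^sub>2)) \<longlongrightarrow> \<phi> (x0 + 0 *\<^sub>R e\<^sub>1 + b *\<^sub>R e\<^sub>2)) (at 0 within {0..r / 2})"
    proof -
      have "continuous_on {0..r / 2} (\<lambda>a. \<phi> (x0 + a *\<^sub>R e\<^sub>1 + b *\<^sub>R e\<^sub>2))"
        by (rule continuous_on_compose2[OF \<phi>]) (use r(2) that in \<open>auto intro!: continuous_intros\<close>)
      from bspec[OF this[unfolded continuous_on_def], of 0] show ?thesis using r(1) by simp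
    qed
    moreover have "\<phi> (x0 + 0 *\<^sub>R e\<^sub>1 + b *\<^sub>R e\<^sub>2) = k"
      by (rule const) (use r(1) r(2)[of 0 b] that x0 in \<open>auto simp: axis_def\<close>)
    moreover have "at 0 within {0..r / 2} = at_right (0::real)"
      using r(1) by (intro at_within_Icc_at_right) simp
    ultimately show ?thesis by simp
  qed
  have "((\<lambda>a. \<phi> (x0 + a *\<^sub>R e\<^sub>1 + \<delta> *\<^sub>R e\<^sub>2) - \<phi> (x0 + a *\<^sub>R e\<^sub>1 + 0 *\<^sub>R e\<^sub>2)) \<longlongrightarrow> k - k) (at_right 0)"
    by (intro tendsto_diff lim) (use \<delta> r(1) in auto)
  moreover have "\<forall>\<^sub>F a in at_right 0. \<delta> * (E x0 / 2) \<le> \<phi> (x0 + a *\<^sub>R e\<^sub>1 + \<delta> *\<^sub>R e\<^sub>2) - \<phi> (x0 + a *\<^sub>R e\<^sub>1 + 0 *\<^sub>R e\<^sub>2)"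
    using eventually_at_right_less[of "0::real"] eventually_at_right_field[of "\<lambda>a. a < r" 0]
    by (subst eventually_at_right_field) (use step r(1) in auto)
  ultimately have "\<delta> * (E x0 / 2) \<le> k - k"
    by (intro tendsto_lowerbound) auto
  then show False using \<open>\<not> E x0 \<le> 0\<close> \<delta>(1) by (simp add: mult_le_0_iff)
qed

lemma tangential_derivative_zero:
  fixes \<phi> E :: "real^2 \<Rightarrow> real"
  assumes \<phi>: "continuous_on WQ \<phi>" and E: "continuous_on WQ E"
    and const: "\<And>x. x \<in> W \<Longrightarrow> x $ 1 = 0 \<Longrightarrow> \<phi> x = k"
    and d: "\<And>x. x \<in> W \<Longrightarrow> x $ 1 > 0 \<Longrightarrow> (\<phi> has_derivative \<phi>' x) (at x) \<and> \<phi>' x e\<^sub>2 = E x"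
  shows "E x0 = 0"
  using tangential_derivative_nonpos[OF assms]
    tangential_derivative_nonpos[of "\<lambda>x. - \<phi> x" "\<lambda>x. - E x" "- k" "\<lambda>x v. - \<phi>' x v"] assms
  by (force intro!: continuous_on_minus has_derivative_minus)

text \<open>\<open>E\<close> again replaces a derivative that may fail to exist at
  \<open>x0\<close>: if it were positive there, \<open>\<phi>\<close> would increase along the
  segment entering the half disc from its maximum.\<close>

lemma normal_derivative_nonpos:
  fixes \<phi> E :: "real^2 \<Rightarrow> real"
  assumes \<phi>: "continuous_on WQ \<phi>" and E: "continuous_on WQ E"
    and max: "\<And>x. x \<in> W \<Longrightarrow> x $ 1 > 0 \<Longrightarrow> \<phi> x \<le> \<phi> x0"
    and d: "\<And>x. x \<in> W \<Longrightarrow> x $ 1 > 0 \<Longrightarrow> (\<phi> has_derivative \<phi>' x) (at x) \<and> \<phi>' x e\<^sub>1 = E x"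
  shows "E x0 \<le> 0"
proof (rule ccontr)
  assume "\<not> E x0 \<le> 0"
  then obtain r where r: "r > 0" "\<And>a b. 0 \<le> a \<Longrightarrow> a < r \<Longrightarrow> \<bar>b\<bar> < r \<Longrightarrow> x0 + a *\<^sub>R e\<^sub>1 + b *\<^sub>R e\<^sub>2 \<in> WQ"
    "\<And>a b. 0 \<le> a \<Longrightarrow> a < r \<Longrightarrow> \<bar>b\<bar> < r \<Longrightarrow> E (x0 + a *\<^sub>R e\<^sub>1 + b *\<^sub>R e\<^sub>2) > 0"
    using continuous_gt[OF E, of 0] by (auto simp: not_le)
  have W: "x0 + a *\<^sub>R e\<^sub>1 \<in> W" "(x0 + a *\<^sub>R e\<^sub>1) $ 1 > 0" if "0 < a" "a < r" for a
    using r(1) r(2)[of a 0] that x0 by (auto simp: axis_def)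
  define t where "t = r / 2"
  have t: "0 < t" "t < r" using r(1) by (auto simp: t_def)
  have "\<phi> (x0 + 0 *\<^sub>R e\<^sub>1) < \<phi> (x0 + t *\<^sub>R e\<^sub>1)"
  proof (rule DERIV_pos_imp_increasing_open[OF t(1), where f = "\<lambda>t. \<phi> (x0 + t *\<^sub>R e\<^sub>1)"])
    show "\<exists>y. DERIV (\<lambda>t. \<phi> (x0 + t *\<^sub>R e\<^sub>1)) a :> y \<and> y > 0" if "0 < a" "a < t" for a
      using has_real_derivative_line[of \<phi> "\<phi>' (x0 + a *\<^sub>R e\<^sub>1)" x0 a e\<^sub>1] d[OF W[of a]] r(3)[of a 0] that t r(1) by auto
    show "continuous_on {0..t} (\<lambda>t. \<phi> (x0 + t *\<^sub>R e\<^sub>1))"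
      by (rule continuous_on_compose2[OF \<phi>]) (use r(1) r(2)[of _ 0] t in \<open>auto intro!: continuous_intros\<close>)
  qed
  then show False using max[OF W[OF t]] by simp
qed

end

section \<open>The boundary curvature\<close>

lemma (in riem_chart) orthogonal_expansion:
  assumes x: "x \<in> V" and n: "g x n n = 1" and b: "b \<noteq> 0" "g x b n = 0" and v: "g x b v = 0"
  shows "v = g x v n *\<^sub>R n"
proof -
  \<comment> \<open>The part of \<open>v\<close> orthogonal to \<open>n\<close>. It is orthogonal to
    \<open>b\<close> as well, and \<open>b\<close> and \<open>n\<close> span the plane.\<close>
  define w where "w = v - g x v n *\<^sub>R n"
  have wb: "g x w b = 0" and wn: "g x w n = 0"
    using n b(2) v g_sym[OF x, of v b] g_sym[OF x, of n b] by (simp_all add: w_def g_simps x)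
  have "det2 b n \<noteq> 0"
  proof
    assume "det2 b n = 0"
    then have eq: "n $ 1 *\<^sub>R b = b $ 1 *\<^sub>R n" "n $ 2 *\<^sub>R b = b $ 2 *\<^sub>R n"
      by (auto simp: det2_def vec_eq_iff forall_2 mult.commute)
    have "g x (n $ 1 *\<^sub>R b) n = b $ 1" "g x (n $ 2 *\<^sub>R b) n = b $ 2"
      unfolding eq by (simp_all add: g_simps x n)
    then show False using b by (simp add: g_simps x vec_eq_iff forall_2)
  qed
  then obtain r q where "w = r *\<^sub>R b + q *\<^sub>R n" using det2_basis by blast
  then have "g x w w = r * g x w b + q * g x w n" by (metis g_add_right g_scale_right x)
  then show ?thesis using g_eq_zero[OF x, of w] wb wn by (simp add: w_def)
qed

text \<open>
  A patch \<open>(Fm, Fh)\<close> of a surface with boundary at height zero. The unit normal \<open>(X, \<nu>)\<close> is only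
  continuous up to the boundary; the shape operator extends to the boundary because it is
  determined by the second derivatives of the patch.
\<close>

locale boundary_patch = riem_chart M i V + half_disc W x0
  for M :: "('a, real^2, 'i) riem" and i V W x0 +
  fixes Fm :: "real^2 \<Rightarrow> real^2" and Fh :: "real^2 \<Rightarrow> real"
    and X :: "real^2 \<Rightarrow> real^2" and \<nu> :: "real^2 \<Rightarrow> real" and H \<nu>0 :: real
  assumes Fm_im: "Fm ` W \<subseteq> V" and Fm_smooth: "smooth_on W Fm" and Fh_smooth: "smooth_on W Fh"
    and immersion: "x \<in> W \<Longrightarrow> fd Fm x v = 0 \<Longrightarrow> fd Fh x v = 0 \<Longrightarrow> v = 0"
    and X_cont: "continuous_on (W \<inter> {x. 0 \<le> x $ 1}) X"
    and \<nu>_cont: "continuous_on (W \<inter> {x. 0 \<le> x $ 1}) \<nu>"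
    and unit: "x \<in> W \<Longrightarrow> 0 \<le> x $ 1 \<Longrightarrow> metric M i (Fm x) (X x) (X x) + (\<nu> x)\<^sup>2 = 1"
    and normal: "x \<in> W \<Longrightarrow> 0 \<le> x $ 1 \<Longrightarrow> metric M i (Fm x) (X x) (fd Fm x v) + \<nu> x * fd Fh x v = 0"
    and shape: "x \<in> W \<Longrightarrow> 0 < x $ 1 \<Longrightarrow> \<exists>A. linear A \<and> trace2 A = 2 * H \<and>
      X differentiable (at x) \<and> \<nu> differentiable (at x) \<and>
      (\<forall>v. fd Fm x (A v) = - (fd X x v + christoffel M i (Fm x) (fd Fm x v) (X x)) \<and>
           fd Fh x (A v) = - fd \<nu> x v)"
    and \<nu>_neg: "x \<in> W \<Longrightarrow> 0 < x $ 1 \<Longrightarrow> \<nu> x < 0"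
    and h_boundary: "x \<in> W \<Longrightarrow> x $ 1 = 0 \<Longrightarrow> Fh x = 0"
    and \<nu>_boundary: "x \<in> W \<Longrightarrow> x $ 1 = 0 \<Longrightarrow> \<nu> x = \<nu>0"
    and h_nonneg: "x \<in> W \<Longrightarrow> 0 < x $ 1 \<Longrightarrow> 0 \<le> Fh x"
    and \<nu>0: "-1 < \<nu>0" "\<nu>0 \<le> 0"
begin

lemma in_V: "x \<in> W \<Longrightarrow> Fm x \<in> V" using Fm_im by auto

lemma linear_Fm: "x \<in> W \<Longrightarrow> linear (fd Fm x)"
  by (rule fd_linear[OF smooth_on_differentiable[OF Fm_smooth]])

lemma linear_Fh: "x \<in> W \<Longrightarrow> linear (fd Fh x)"
  by (rule fd_linear[OF smooth_on_differentiable[OF Fh_smooth]])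

lemma Fm_cont [continuous_intros]: "continuous_on WQ Fm" "continuous_on WQ (\<lambda>x. fd Fm x v)"
    "continuous_on WQ (\<lambda>x. fd (\<lambda>y. fd Fm y w) x v)"
  and Fh_cont [continuous_intros]: "continuous_on WQ Fh" "continuous_on WQ (\<lambda>x. fd Fh x v)"
    "continuous_on WQ (\<lambda>x. fd (\<lambda>y. fd Fh y w) x v)"
  by (rule continuous_on_subset[where s = W]; blast?; intro smooth_on_continuous_on smooth_on_fd Fm_smooth Fh_smooth)+

lemma Fm_im_WQ: "Fm ` WQ \<subseteq> V" using Fm_im by auto

lemma interior_open: "open (W \<inter> {x. 0 < x $ 1})"
  using open_W open_halfspace_component_gt_cart[of 0 "1::2"] by (auto intro: open_Int)

definition "G x v w = g (Fm x) (fd Fm x v) (fd Fm x w) + fd Fh x v * fd Fh x w"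

text \<open>The second fundamental form written as the normal component of the second derivatives of
  the patch. No derivative of the normal occurs, so it is continuous up to the boundary.\<close>

definition "II x v w = g (Fm x) (X x) (fd (\<lambda>y. fd Fm y w) x v + \<Gamma> (Fm x) (fd Fm x v) (fd Fm x w)) +
  \<nu> x * fd (\<lambda>y. fd Fh y w) x v"

text \<open>The shape operator, up to the boundary.\<close>

definition "B x v = gram_sharp (G x) (II x v e\<^sub>1) (II x v e\<^sub>2)"

lemma G_bilinear: "x \<in> W \<Longrightarrow> bilinear (G x)"
  unfolding bilinear_def G_def
  by (auto intro!: linearI simp: linear_add[OF linear_Fm] linear_add[OF linear_Fh]
      linear_scale[OF linear_Fm] linear_scale[OF linear_Fh] g_simps in_V algebra_simps)

lemma G_sym: "x \<in> W \<Longrightarrow> G x v w = G x w v"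
  by (simp add: G_def g_sym[OF in_V, of x "fd Fm x v"])

lemma G_pos: assumes "x \<in> W" "v \<noteq> 0" shows "G x v v > 0"
proof (cases "fd Fm x v = 0")
  case True
  then have "fd Fh x v \<noteq> 0" using immersion[OF assms(1)] assms(2) by blast
  then show ?thesis using True g_zero_left[OF in_V[OF assms(1)]]
    by (simp add: G_def) (metis not_square_less_zero linorder_neqE_linordered_idom mult_eq_0_iff)
next
  case False
  then show ?thesis using g_pos[OF in_V[OF assms(1)] False] by (simp add: G_def add_pos_nonneg)
qed

lemma G_gram: "x \<in> W \<Longrightarrow> gram (G x) > 0"
  by (rule gram_pos[OF G_bilinear G_sym G_pos])

lemma G_B: "x \<in> W \<Longrightarrow> G x (B x v) w = II x v e\<^sub>1 * w $ 1 + II x v e\<^sub>2 * w $ 2"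
  unfolding B_def by (rule gram_sharp_eq[OF G_bilinear G_sym G_gram])

lemma G_cont: "continuous_on WQ (\<lambda>x. G x v w)"
  unfolding G_def by (intro continuous_on_g continuous_intros Fm_im_WQ)

lemma II_cont: "continuous_on WQ (\<lambda>x. II x v w)"
  unfolding II_def
  by (intro continuous_on_g continuous_on_christoffel continuous_on_add continuous_on_mult
      Fm_cont Fh_cont Fm_im_WQ X_cont \<nu>_cont)

lemma B_cont: "continuous_on WQ (\<lambda>x. B x v)"
proof -
  have "continuous_on WQ (\<lambda>x. gram (G x))"
    unfolding gram_def by (intro continuous_intros G_cont)
  then show ?thesis
    unfolding B_def gram_sharp_def
    by (intro continuous_on_add continuous_on_scaleR continuous_on_divide continuous_on_diff
        continuous_on_mult G_cont II_cont continuous_on_const) (use G_gram in force)+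
qed

text \<open>Differentiating the orthogonality of the normal to the tangent vectors
  \<open>fd Fm x w\<close>, \<open>fd Fh x w\<close> shows that the shape operator represents
  \<open>II\<close> with respect to \<open>G\<close>, which is what characterises
  \<open>B\<close>.\<close>

lemma shape_interior:
  assumes x: "x \<in> W" "0 < x $ 1"
  shows "(\<nu> has_derivative (\<lambda>v. - fd Fh x (B x v))) (at x)" "trace2 (B x) = 2 * H"
proof -
  note xV = in_V[OF x(1)]
  obtain A where A: "linear A" "trace2 A = 2 * H" "X differentiable (at x)" "\<nu> differentiable (at x)"
    "\<And>v. fd Fm x (A v) = - (fd X x v + \<Gamma> (Fm x) (fd Fm x v) (X x))"
    "\<And>v. fd Fh x (A v) = - fd \<nu> x v"
    using shape[OF x] by blast
  have GA: "G x (A v) w = II x v w" for v w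
  proof -
    have "((\<lambda>y. g (Fm y) (X y) (fd Fm y w) + \<nu> y * fd Fh y w) has_derivative
      (\<lambda>v. (g (Fm x) (fd X x v + \<Gamma> (Fm x) (fd Fm x v) (X x)) (fd Fm x w) +
        g (Fm x) (X x) (fd (\<lambda>y. fd Fm y w) x v + \<Gamma> (Fm x) (fd Fm x v) (fd Fm x w))) +
        (\<nu> x * fd (\<lambda>y. fd Fh y w) x v + fd \<nu> x v * fd Fh x w))) (at x)"
      by (rule has_derivative_add[OF has_derivative_g[OF xV smooth_on_has_derivative[OF Fm_smooth x(1)] fd_has_derivative[OF A(3)]
            smooth_on_has_derivative[OF smooth_on_fd[OF Fm_smooth] x(1)]]
          has_derivative_mult[OF fd_has_derivative[OF A(4)] smooth_on_has_derivative[OF smooth_on_fd[OF Fh_smooth] x(1)]]])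
    moreover have "((\<lambda>y. g (Fm y) (X y) (fd Fm y w) + \<nu> y * fd Fh y w) has_derivative (\<lambda>v. 0)) (at x)"
      by (rule has_derivative_transform_within_open[OF has_derivative_const interior_open])
        (use x normal in auto)
    ultimately have eq: "(g (Fm x) (fd X x v + \<Gamma> (Fm x) (fd Fm x v) (X x)) (fd Fm x w) +
        g (Fm x) (X x) (fd (\<lambda>y. fd Fm y w) x v + \<Gamma> (Fm x) (fd Fm x v) (fd Fm x w))) +
        (\<nu> x * fd (\<lambda>y. fd Fh y w) x v + fd \<nu> x v * fd Fh x w) = 0"
      by (rule fun_cong[OF has_derivative_unique])
    have A': "fd X x v + \<Gamma> (Fm x) (fd Fm x v) (X x) = - fd Fm x (A v)" "fd \<nu> x v = - fd Fh x (A v)"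
      using A(5)[of v] A(6)[of v] by simp_all
    show ?thesis
      using eq unfolding A' by (simp add: G_def II_def g_simps xV)
  qed
  have AB: "A v = B x v" for v
  proof (rule ccontr)
    define z where "z = A v - B x v"
    assume "A v \<noteq> B x v"
    then have "G x z z > 0" by (intro G_pos x) (simp add: z_def)
    moreover have "G x z w = 0" for w
    proof -
      have "linear (G x (A v))" using G_bilinear[OF x(1)] by (simp add: bilinear_def)
      then show ?thesis
        using linear2_expand[of "G x (A v)" w] G_B[OF x(1), of v w]
        by (simp add: z_def bilinear_lsub[OF G_bilinear[OF x(1)]] GA)
    qed
    ultimately show False by simp
  qed
  show "(\<nu> has_derivative (\<lambda>v. - fd Fh x (B x v))) (at x)"
    using fd_has_derivative[OF A(4)] A(6) AB by simp
  have "B x = A" using AB by auto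
  then show "trace2 (B x) = 2 * H" using A(2) by simp
qed

lemma boundary_constant:
  fixes \<phi> :: "real^2 \<Rightarrow> 'b::real_normed_vector"
  assumes "x \<in> W" "x $ 1 = 0" "(\<phi> has_derivative \<phi>') (at x)" "\<And>y. y \<in> W \<Longrightarrow> y $ 1 = 0 \<Longrightarrow> \<phi> y = k"
  shows "\<phi>' e\<^sub>2 = 0"
proof -
  define S where "S = (\<lambda>t. x + t *\<^sub>R e\<^sub>2) -` W"
  have S: "open S" "0 \<in> S"
    using assms(1) by (auto simp: S_def intro!: open_vimage open_W continuous_intros)
  have "((\<lambda>t. \<phi> (x + t *\<^sub>R e\<^sub>2)) has_derivative (\<lambda>h. h *\<^sub>R \<phi>' e\<^sub>2)) (at 0)"
    by (rule has_derivative_line) (simp add: assms)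
  moreover have "((\<lambda>t. \<phi> (x + t *\<^sub>R e\<^sub>2)) has_derivative (\<lambda>h. 0)) (at 0)"
    by (rule has_derivative_transform_within_open[OF has_derivative_const S])
      (use assms(2,4) in \<open>auto simp: S_def axis_def\<close>)
  ultimately have "(\<lambda>h. h *\<^sub>R \<phi>' e\<^sub>2) = (\<lambda>h::real. 0)" by (rule has_derivative_unique)
  from fun_cong[OF this, of 1] show ?thesis by simp
qed

lemma Fh2: "x \<in> W \<Longrightarrow> x $ 1 = 0 \<Longrightarrow> fd Fh x e\<^sub>2 = 0"
  by (rule boundary_constant[OF _ _ smooth_on_has_derivative[OF Fh_smooth] h_boundary])

lemma Fh22: "x \<in> W \<Longrightarrow> x $ 1 = 0 \<Longrightarrow> fd (\<lambda>y. fd Fh y e\<^sub>2) x e\<^sub>2 = 0"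
  by (rule boundary_constant[OF _ _ smooth_on_has_derivative[OF smooth_on_fd[OF Fh_smooth]] Fh2])

lemma Fm2_nonzero: "x \<in> W \<Longrightarrow> x $ 1 = 0 \<Longrightarrow> fd Fm x e\<^sub>2 \<noteq> 0"
  using immersion[of x e\<^sub>2] Fh2[of x] by (auto simp: axis_eq_0_iff)

lemma s_pos: "1 - \<nu>0\<^sup>2 > 0"
  using \<nu>0 by (simp add: abs_square_less_1)

lemma X_boundary:
  assumes "x \<in> W" "x $ 1 = 0"
  shows "g (Fm x) (X x) (X x) = 1 - \<nu>0\<^sup>2" "g (Fm x) (X x) (fd Fm x e\<^sub>2) = 0"
  using unit[of x] normal[of x e\<^sub>2] assms \<nu>_boundary[of x] Fh2[of x] by auto

text \<open>Nonnegative height gives the weak inequality. Equality would make the tangent plane at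
  \<open>x0\<close> horizontal and the normal vertical, whereas \<open>-1 < \<nu>0 \<le> 0\<close>
  forces \<open>X x0 \<noteq> 0\<close>.\<close>

lemma Fh1_pos: "fd Fh x0 e\<^sub>1 > 0"
proof -
  note x0V = in_V[OF x0(1)]
  have "- fd Fh x0 e\<^sub>1 \<le> 0"
  proof (rule normal_derivative_nonpos[where \<phi> = "\<lambda>x. - Fh x" and \<phi>' = "\<lambda>x v. - fd Fh x v"])
    show "- Fh x \<le> - Fh x0" if "x \<in> W" "0 < x $ 1" for x
      using h_nonneg[OF that] h_boundary[OF x0] by simp
    show "((\<lambda>x. - Fh x) has_derivative (\<lambda>v. - fd Fh x v)) (at x) \<and> - fd Fh x e\<^sub>1 = - fd Fh x e\<^sub>1"
      if "x \<in> W" "0 < x $ 1" for x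
      using has_derivative_minus[OF smooth_on_has_derivative[OF Fh_smooth that(1)]] by simp
  qed (intro continuous_intros)+
  moreover have "fd Fh x0 e\<^sub>1 \<noteq> 0"
  proof
    assume h1: "fd Fh x0 e\<^sub>1 = 0"
    have Fh0: "fd Fh x0 v = 0" for v
      using linear2_expand[OF linear_Fh[OF x0(1)], of v] h1 Fh2[OF x0] by simp
    then have inj: "inj (fd Fm x0)"
      using immersion[OF x0(1)] linear_injective_0[OF linear_Fm[OF x0(1)]] by blast
    then have "surj (fd Fm x0)"
      using linear_injective_imp_surjective[OF linear_Fm[OF x0(1)] inj] by simp
    then obtain v where "X x0 = fd Fm x0 v" by (metis surjD)
    then have "g (Fm x0) (X x0) (X x0) = 0" using normal[OF x0(1), of v] x0(2) Fh0[of v] by simp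
    then show False using X_boundary(1)[OF x0] s_pos by simp
  qed
  ultimately show ?thesis by simp
qed

text \<open>
  The surface lies over the side of the boundary from which \<open>n\<close> points away, because \<open>\<nu> < 0\<close> off
  the boundary. Over a vertical boundary tangent plane this is not visible to first order, so we
  follow the intersection of the surface with the vertical plane spanned by \<open>n\<close>.
\<close>

lemma X_inward:
  assumes n: "g (Fm x0) n n = 1" and \<tau>: "g (Fm x0) \<tau> n = 0" "g (Fm x0) (fd Fm x0 e\<^sub>2) \<tau> \<noteq> 0"
    and outer: "\<forall>\<^sub>F s in at_right 0. Fm x0 + s *\<^sub>R n \<notin> Fm ` WQ"
  shows "g (Fm x0) (X x0) n \<le> 0"
proof (rule ccontr)
  assume "\<not> g (Fm x0) (X x0) n \<le> 0"
  then have pos: "g (Fm x0) (X x0) n > 0" by simp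
  note x0V = in_V[OF x0(1)]
  let ?g = "g (Fm x0)"
  \<comment> \<open>\<open>\<xi>\<close> and \<open>d\<close> measure the displacement from
    \<open>Fm x0\<close> along \<open>\<tau>\<close> and \<open>n\<close>, with the inner product
    frozen at that point. The zero set of \<open>\<xi>\<close> is the trace of the vertical
    plane.\<close>
  define \<xi> where "\<xi> x = ?g \<tau> (Fm x - Fm x0)" for x
  define d where "d x = ?g n (Fm x - Fm x0)" for x
  have blg: "bounded_linear (?g v)" for v
    using bilinear_g[OF x0V] by (simp add: bilinear_def linear_conv_bounded_linear)
  have sm: "smooth_on W (\<lambda>x. ?g v (Fm x - Fm x0))" for v
    by (intro smooth_on_linear[OF open_W blg] smooth_intros open_W Fm_smooth)
  have dg: "((\<lambda>x. ?g v (Fm x - Fm x0)) has_derivative (\<lambda>w. ?g v (fd Fm x w))) (at x)" if "x \<in> W" for v x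
    using bounded_linear.has_derivative[OF blg has_derivative_diff[OF smooth_on_has_derivative[OF Fm_smooth that] has_derivative_const]]
    by simp
  \<comment> \<open>Taking the distance from the boundary line and \<open>\<xi>\<close> as new
    coordinates, the curve \<open>\<xi> = 0\<close> becomes a coordinate line, parametrised by
    \<open>x $ 1\<close>.\<close>
  define \<Phi> where "\<Phi> x = x $ 1 *\<^sub>R e\<^sub>1 + \<xi> x *\<^sub>R e\<^sub>2" for x
  have \<Phi>_nth: "\<Phi> x $ 1 = x $ 1" "\<Phi> x $ 2 = \<xi> x" for x
    by (simp_all add: \<Phi>_def axis_def)
  have \<Phi>: "smooth_on W \<Phi>"
    unfolding \<Phi>_def \<xi>_def
    by (intro smooth_on_add smooth_on_scaleR smooth_on_const sm open_W
        smooth_on_linear[OF open_W bounded_linear_vec_nth smooth_on_id])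
  have d\<Phi>: "(\<Phi> has_derivative (\<lambda>w. w $ 1 *\<^sub>R e\<^sub>1 + ?g \<tau> (fd Fm x w) *\<^sub>R e\<^sub>2)) (at x)" if "x \<in> W" for x
    unfolding \<Phi>_def \<xi>_def
    by (intro has_derivative_add has_derivative_scaleR_left dg that
        bounded_linear.has_derivative[OF bounded_linear_vec_nth] has_derivative_ident)
  have fd\<Phi>: "fd \<Phi> x = (\<lambda>w. w $ 1 *\<^sub>R e\<^sub>1 + ?g \<tau> (fd Fm x w) *\<^sub>R e\<^sub>2)" if "x \<in> W" for x
    by (rule fd_eq[OF d\<Phi>[OF that]])
  have \<tau>2: "?g \<tau> (fd Fm x0 e\<^sub>2) \<noteq> 0" using \<tau>(2) g_sym[OF x0V] by metis
  have inj: "inj (fd \<Phi> x0)"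
  proof -
    have "v = 0" if "fd \<Phi> x0 v = 0" for v
    proof -
      have v1: "v $ 1 = 0" and 2: "?g \<tau> (fd Fm x0 v) = 0"
        using that unfolding fd\<Phi>[OF x0(1)] by (auto simp: vec_eq_iff forall_2 axis_def)
      have "fd Fm x0 v = v $ 2 *\<^sub>R fd Fm x0 e\<^sub>2"
        using linear2_expand[OF linear_Fm[OF x0(1)], of v] v1 by simp
      then have "v $ 2 = 0" using 2 \<tau>2 by (simp add: g_simps x0V)
      then show ?thesis using v1 by (simp add: vec_eq_iff forall_2)
    qed
    then show ?thesis
      using linear_injective_0[OF fd_linear[OF smooth_on_differentiable[OF \<Phi> x0(1)]]] by blast
  qed
  obtain U V' \<Psi> where U: "open U" "U \<subseteq> W" "x0 \<in> U" and V': "open V'" "\<Phi> x0 \<in> V'"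
    and hom: "homeomorphism U V' \<Phi> \<Psi>" and \<Psi>: "\<And>y. y \<in> V' \<Longrightarrow> \<Psi> differentiable (at y)"
    using inverse_function_smooth[OF open_W \<Phi> x0(1) inj] by blast
  have \<Phi>x0: "\<Phi> x0 = 0" using x0 g_zero_right[OF x0V] by (simp add: \<Phi>_def \<xi>_def)
  define \<zeta> where "\<zeta> s = \<Psi> (0 + s *\<^sub>R e\<^sub>1)" for s
  define T where "T = (\<lambda>s. 0 + s *\<^sub>R e\<^sub>1) -` V'"
  have T: "open T" "0 \<in> T"
    using V' \<Phi>x0 by (auto simp: T_def intro!: open_vimage continuous_intros)
  have \<zeta>U: "\<zeta> s \<in> U" "\<Phi> (\<zeta> s) = s *\<^sub>R e\<^sub>1" if "s \<in> T" for s
    using hom that unfolding homeomorphism_def \<zeta>_def T_def by auto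
  have \<zeta>W: "\<zeta> s \<in> W" if "s \<in> T" for s using \<zeta>U(1)[OF that] U(2) by auto
  have \<zeta>1: "\<zeta> s $ 1 = s" and \<xi>\<zeta>: "\<xi> (\<zeta> s) = 0" if "s \<in> T" for s
    using \<zeta>U(2)[OF that] \<Phi>_nth[of "\<zeta> s"] by (auto simp: axis_def)
  have \<zeta>0: "\<zeta> 0 = x0"
    using hom U(3) \<Phi>x0 unfolding homeomorphism_def \<zeta>_def by auto
  define \<zeta>' where "\<zeta>' s = fd \<Psi> (0 + s *\<^sub>R e\<^sub>1) e\<^sub>1" for s
  have d\<zeta>: "(\<zeta> has_derivative (\<lambda>h. h *\<^sub>R \<zeta>' s)) (at s)" if "s \<in> T" for s
    unfolding \<zeta>_def \<zeta>'_def by (rule has_derivative_line[OF fd_has_derivative[OF \<Psi>]]) (use that in \<open>simp add: T_def\<close>)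
  have comp: "((\<lambda>s. f (\<zeta> s)) has_real_derivative f' (\<zeta>' s)) (at s)"
    if "s \<in> T" "(f has_derivative f') (at (\<zeta> s))" for f :: "real^2 \<Rightarrow> real" and f' s
    using has_derivative_compose[OF d\<zeta>[OF that(1)] that(2)] linear_scale[OF has_derivative_linear[OF that(2)]]
    by (simp add: has_field_derivative_def mult_commute_abs)
  have \<zeta>'1: "\<zeta>' s $ 1 = 1" if s: "s \<in> T" for s
  proof -
    have "((\<lambda>s. \<zeta> s $ 1) has_real_derivative \<zeta>' s $ 1) (at s)"
      by (rule comp[OF s]) (intro bounded_linear.has_derivative[OF bounded_linear_vec_nth] has_derivative_ident)
    moreover have "((\<lambda>s. \<zeta> s $ 1) has_real_derivative 1) (at s)"
      by (rule has_field_derivative_transform_within_open[OF DERIV_ident T(1) s]) (simp add: \<zeta>1)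
    ultimately show ?thesis by (rule DERIV_unique)
  qed
  have \<xi>': "?g \<tau> (fd Fm (\<zeta> s) (\<zeta>' s)) = 0" if s: "s \<in> T" for s
  proof -
    have "((\<lambda>s. \<xi> (\<zeta> s)) has_real_derivative ?g \<tau> (fd Fm (\<zeta> s) (\<zeta>' s))) (at s)"
      unfolding \<xi>_def by (rule comp[OF s dg[OF \<zeta>W[OF s]]])
    moreover have "((\<lambda>s. \<xi> (\<zeta> s)) has_real_derivative 0) (at s)"
      by (rule has_field_derivative_transform_within_open[OF DERIV_const[of 0] T(1) s]) (simp add: \<xi>\<zeta>)
    ultimately show ?thesis by (rule DERIV_unique)
  qed
  have \<tau>0: "\<tau> \<noteq> 0" using \<tau>2 g_zero_left[OF x0V] by auto
  have multiple: "v = ?g n v *\<^sub>R n" if "?g \<tau> v = 0" for v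
    using orthogonal_expansion[OF x0V n \<tau>0 \<tau>(1)] that g_sym[OF x0V] by metis
  define E where "E x = fd Fh x e\<^sub>1 * ?g \<tau> (fd Fm x e\<^sub>2) - fd Fh x e\<^sub>2 * ?g \<tau> (fd Fm x e\<^sub>1)" for x
  have E: "fd Fh (\<zeta> s) (\<zeta>' s) * ?g \<tau> (fd Fm (\<zeta> s) e\<^sub>2) = E (\<zeta> s)" if s: "s \<in> T" for s
  proof -
    have "?g \<tau> (fd Fm (\<zeta> s) e\<^sub>1) = - (\<zeta>' s $ 2 * ?g \<tau> (fd Fm (\<zeta> s) e\<^sub>2))"
      using \<xi>'[OF s] linear2_expand[OF linear_Fm[OF \<zeta>W[OF s]], of "\<zeta>' s"] \<zeta>'1[OF s]
      by (simp add: g_simps x0V)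
    then show ?thesis
      using linear2_expand[OF linear_Fh[OF \<zeta>W[OF s]], of "\<zeta>' s"] \<zeta>'1[OF s]
      by (simp add: E_def algebra_simps)
  qed
  \<comment> \<open>Along the curve \<open>J\<close> is the derivative of the height times a square,
    so it has the sign of that derivative whatever the orientation of \<open>\<tau>\<close>. Being
    continuous on the half disc and positive at \<open>x0\<close>, it stays positive near
    \<open>x0\<close>.\<close>
  define J where "J x = E x * ?g \<tau> (fd Fm x e\<^sub>2)" for x
  have "continuous_on WQ J"
    unfolding J_def E_def
    by (intro continuous_intros bounded_linear.continuous_on[OF blg])
  moreover have "J x0 > 0"
  proof -
    have "J x0 = fd Fh x0 e\<^sub>1 * (?g \<tau> (fd Fm x0 e\<^sub>2))\<^sup>2"
      by (simp add: J_def E_def Fh2[OF x0] power2_eq_square)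
    then show ?thesis using Fh1_pos \<tau>2 by simp
  qed
  moreover define P where "P x = g (Fm x) (X x) n" for x
  have "continuous_on WQ P"
    unfolding P_def by (intro continuous_on_g Fm_cont Fm_im_WQ X_cont continuous_on_const)
  ultimately have cont: "continuous_on WQ (\<lambda>x. min (J x) (P x))" "min (J x0) (P x0) > 0"
    using pos by (auto intro: continuous_on_min simp: P_def)
  have \<zeta>_cont: "continuous_on (T \<inter> {0..}) \<zeta>"
    using d\<zeta> by (intro continuous_at_imp_continuous_on) (auto intro: has_derivative_continuous)
  have "continuous_on (T \<inter> {0..}) (\<lambda>s. min (J (\<zeta> s)) (P (\<zeta> s)))"
    by (rule continuous_on_compose2[OF cont(1) \<zeta>_cont]) (use \<zeta>W \<zeta>1 in auto)
  then obtain r1 where r1: "r1 > 0" "\<And>s. s \<in> T \<Longrightarrow> 0 \<le> s \<Longrightarrow> s < r1 \<Longrightarrow> min (J (\<zeta> s)) (P (\<zeta> s)) > 0"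
  proof -
    assume *: "continuous_on (T \<inter> {0..}) (\<lambda>s. min (J (\<zeta> s)) (P (\<zeta> s)))"
    have "0 \<in> T \<inter> {0..}" using T by simp
    from *[unfolded continuous_on_iff, rule_format, OF this, of "min (J x0) (P x0)"] cont(2)
    obtain r where "r > 0" "\<And>s. s \<in> T \<inter> {0..} \<Longrightarrow> dist s 0 < r \<Longrightarrow>
        dist (min (J (\<zeta> s)) (P (\<zeta> s))) (min (J x0) (P x0)) < min (J x0) (P x0)"
      unfolding \<zeta>0 by blast
    then show ?thesis
      using that[of r] by (force simp: dist_real_def)
  qed
  obtain r2 where r2: "r2 > 0" "ball 0 r2 \<subseteq> T" using T openE by blast
  have dpos: "\<exists>y. DERIV (\<lambda>s. d (\<zeta> s)) s :> y \<and> y > 0" if "0 < s" "s < min r1 r2" for s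
  proof -
    have s: "s \<in> T" using r2(2) that by (auto simp: dist_real_def subset_iff)
    have D: "((\<lambda>s. d (\<zeta> s)) has_real_derivative ?g n (fd Fm (\<zeta> s) (\<zeta>' s))) (at s)"
      unfolding d_def by (rule comp[OF s dg[OF \<zeta>W[OF s]]])
    have JP: "J (\<zeta> s) > 0" "P (\<zeta> s) > 0" using r1(2)[OF s] that by auto
    have "fd Fh (\<zeta> s) (\<zeta>' s) * (?g \<tau> (fd Fm (\<zeta> s) e\<^sub>2))\<^sup>2 = J (\<zeta> s)"
      using E[OF s] by (simp add: J_def power2_eq_square mult.assoc[symmetric])
    then have h: "fd Fh (\<zeta> s) (\<zeta>' s) > 0" using JP(1) by (metis zero_less_mult_pos2 zero_le_power2 less_le mult_zero_right)
    have "fd Fm (\<zeta> s) (\<zeta>' s) = ?g n (fd Fm (\<zeta> s) (\<zeta>' s)) *\<^sub>R n"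
      by (rule multiple[OF \<xi>'[OF s]])
    then have "g (Fm (\<zeta> s)) (X (\<zeta> s)) (fd Fm (\<zeta> s) (\<zeta>' s)) = ?g n (fd Fm (\<zeta> s) (\<zeta>' s)) * P (\<zeta> s)"
      by (metis P_def g_scale_right in_V \<zeta>W s)
    \<comment> \<open>The velocity of the projected curve is a multiple of \<open>n\<close>. The
      orthogonality of the normal determines the sign of this multiple from \<nu> < 0, the
      increasing height and \<open>P > 0\<close>.\<close>
    then have "?g n (fd Fm (\<zeta> s) (\<zeta>' s)) * P (\<zeta> s) = - \<nu> (\<zeta> s) * fd Fh (\<zeta> s) (\<zeta>' s)"
      using normal[OF \<zeta>W[OF s], of "\<zeta>' s"] \<zeta>1[OF s] that by simp
    also have "\<dots> > 0" using \<nu>_neg[OF \<zeta>W[OF s]] \<zeta>1[OF s] that h by (simp add: mult_neg_pos)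
    finally show ?thesis using D JP(2) by (auto simp: zero_less_mult_iff)
  qed
  have d0: "d (\<zeta> 0) = 0" by (simp add: \<zeta>0 d_def g_zero_right x0V)
  have d_cont: "isCont (\<lambda>s. d (\<zeta> s)) 0"
    unfolding d_def by (rule DERIV_isCont[OF comp[OF T(2) dg[OF \<zeta>W[OF T(2)]]]])
  have dge: "d (\<zeta> s) > 0" if "0 < s" "s < min r1 r2" for s
  proof -
    have "d (\<zeta> 0) < d (\<zeta> s)"
    proof (rule DERIV_pos_imp_increasing_open[OF that(1), where f = "\<lambda>s. d (\<zeta> s)"])
      show "\<exists>y. DERIV (\<lambda>s. d (\<zeta> s)) a :> y \<and> y > 0" if "0 < a" "a < s" for a
        using dpos[of a] that \<open>s < min r1 r2\<close> by simp
      show "continuous_on {0..s} (\<lambda>s. d (\<zeta> s))"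
      proof (rule continuous_at_imp_continuous_on, rule ballI)
        fix a assume "a \<in> {0..s}"
        then show "isCont (\<lambda>s. d (\<zeta> s)) a"
          using d_cont dpos[of a] that DERIV_isCont by (cases "a = 0") force+
      qed
    qed
    then show ?thesis using d0 by simp
  qed
  obtain s0 where s0: "s0 > 0" "\<And>s. 0 < s \<Longrightarrow> s < s0 \<Longrightarrow> Fm x0 + s *\<^sub>R n \<notin> Fm ` WQ"
    using outer unfolding eventually_at_right_field by auto
  obtain \<delta> where \<delta>: "\<delta> > 0" "\<And>s. \<bar>s\<bar> < \<delta> \<Longrightarrow> \<bar>d (\<zeta> s)\<bar> < s0"
    using d_cont s0(1) d0 unfolding continuous_at_eps_delta by (auto simp: dist_real_def)
  define s where "s = min \<delta> (min r1 r2) / 2"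
  have s: "0 < s" "s < min r1 r2" "\<bar>s\<bar> < \<delta>" using \<delta>(1) r1(1) r2(1) by (auto simp: s_def)
  have sT: "s \<in> T" using r2(2) s by (auto simp: dist_real_def subset_iff)
  \<comment> \<open>The projected curve lies on the ray from \<open>Fm x0\<close> along
    \<open>n\<close>, at positive distances that can be made arbitrarily small. So the patch covers
    points that \<open>outer\<close> excludes.\<close>
  have "Fm (\<zeta> s) - Fm x0 = d (\<zeta> s) *\<^sub>R n"
    unfolding d_def by (rule multiple) (use \<xi>\<zeta>[OF sT] in \<open>simp add: \<xi>_def\<close>)
  then have "Fm x0 + d (\<zeta> s) *\<^sub>R n = Fm (\<zeta> s)" by (simp add: algebra_simps)
  moreover have "\<zeta> s \<in> WQ" using \<zeta>W[OF sT] \<zeta>1[OF sT] s by simp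
  ultimately show False
    using s0(2)[of "d (\<zeta> s)"] dge[OF s(1,2)] \<delta>(2)[OF s(3)] by auto
qed

text \<open>Since \<nu> is constant along the boundary, its tangent is a principal direction, and
  the trace gives the other diagonal entry of \<open>B x0\<close>. As h + f(\<nu>) is maximal at
  \<open>x0\<close>, its derivative in the entering direction \<open>e\<^sub>1\<close> is at most
  zero, which bounds that entry from below.\<close>

lemma boundary_shape:
  assumes f: "\<And>t. \<bar>t\<bar> \<le> 1 \<Longrightarrow> (f has_real_derivative f' t) (at t)" "continuous_on {-1..1} f'"
    and max: "\<And>x. x \<in> W \<Longrightarrow> 0 < x $ 1 \<Longrightarrow> Fh x + f (\<nu> x) \<le> f \<nu>0"
  shows "1 \<le> f' \<nu>0 * (2 * H - B x0 e\<^sub>2 $ 2)"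
    "II x0 e\<^sub>2 e\<^sub>2 = B x0 e\<^sub>2 $ 2 * g (Fm x0) (fd Fm x0 e\<^sub>2) (fd Fm x0 e\<^sub>2)"
proof -
  have \<nu>1: "\<bar>\<nu> x\<bar> \<le> 1" if "x \<in> WQ" for x
  proof -
    have "(\<nu> x)\<^sup>2 \<le> 1" using unit[of x] g_nonneg[OF in_V, of x "X x"] that by simp
    then show ?thesis by (simp add: abs_square_le_1)
  qed
  have B_nth_cont: "continuous_on WQ (\<lambda>x. fd Fh x (B x v))" for v
  proof (rule continuous_on_eq)
    show "continuous_on WQ (\<lambda>x. B x v $ 1 *\<^sub>R fd Fh x e\<^sub>1 + B x v $ 2 *\<^sub>R fd Fh x e\<^sub>2)"
      by (intro continuous_intros B_cont)
    show "B x v $ 1 *\<^sub>R fd Fh x e\<^sub>1 + B x v $ 2 *\<^sub>R fd Fh x e\<^sub>2 = fd Fh x (B x v)" if "x \<in> WQ" for x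
      using linear2_expand[OF linear_Fh, of x "B x v"] that by simp
  qed
  have "- fd Fh x0 (B x0 e\<^sub>2) = 0"
    \<comment> \<open>In the interior the tangential derivative of \<nu> is
      \<open>- fd Fh x (B x e\<^sub>2)\<close>; this expression, unlike \<nu>, is controlled up to
      the boundary.\<close>
    by (rule tangential_derivative_zero[where \<phi>' = "\<lambda>x v. - fd Fh x (B x v)",
          OF \<nu>_cont continuous_on_minus[OF B_nth_cont] \<nu>_boundary])
      (simp_all add: shape_interior(1))
  then have B12: "B x0 e\<^sub>2 $ 1 = 0"
    using linear2_expand[OF linear_Fh[OF x0(1)], of "B x0 e\<^sub>2"] Fh2[OF x0] Fh1_pos by simp
  show "II x0 e\<^sub>2 e\<^sub>2 = B x0 e\<^sub>2 $ 2 * g (Fm x0) (fd Fm x0 e\<^sub>2) (fd Fm x0 e\<^sub>2)"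
  proof -
    have "linear (\<lambda>v. G x0 v e\<^sub>2)" using G_bilinear[OF x0(1)] by (simp add: bilinear_def)
    from linear2_expand[OF this, of "B x0 e\<^sub>2"] have "G x0 (B x0 e\<^sub>2) e\<^sub>2 = B x0 e\<^sub>2 $ 2 * G x0 e\<^sub>2 e\<^sub>2"
      using B12 by simp
    then show ?thesis
      using G_B[OF x0(1), of e\<^sub>2 e\<^sub>2] Fh2[OF x0] by (simp add: G_def axis_def)
  qed
  have trace: "B x0 e\<^sub>1 $ 1 + B x0 e\<^sub>2 $ 2 = 2 * H"
  proof (rule boundary_eq[of "\<lambda>x. B x e\<^sub>1 $ 1 + B x e\<^sub>2 $ 2"])
    show "continuous_on WQ (\<lambda>x. B x e\<^sub>1 $ 1 + B x e\<^sub>2 $ 2)" by (intro continuous_intros B_cont)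
  qed (use shape_interior(2) in \<open>simp add: trace2_def\<close>)
  have f_cont: "continuous_on {-1..1} f"
    by (rule DERIV_continuous_on[OF has_field_derivative_at_within[OF f(1)]]) auto
  define E where "E x = fd Fh x e\<^sub>1 + f' (\<nu> x) * - fd Fh x (B x e\<^sub>1)" for x
  have im: "\<nu> ` WQ \<subseteq> {-1..1}" using abs_le_D1[OF \<nu>1] abs_le_D2[OF \<nu>1] by (fastforce simp: minus_le_iff)
  have "E x0 \<le> 0"
  proof (rule normal_derivative_nonpos[where \<phi> = "\<lambda>x. Fh x + f (\<nu> x)"
        and \<phi>' = "\<lambda>x v. fd Fh x v + f' (\<nu> x) * - fd Fh x (B x v)"])
    show "continuous_on WQ (\<lambda>x. Fh x + f (\<nu> x))"
      by (intro continuous_intros continuous_on_compose2[OF f_cont \<nu>_cont im])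
    show "continuous_on WQ E"
      unfolding E_def by (intro continuous_intros B_nth_cont continuous_on_compose2[OF f(2) \<nu>_cont im])
    show "Fh x + f (\<nu> x) \<le> Fh x0 + f (\<nu> x0)" if "x \<in> W" "0 < x $ 1" for x
      using max[OF that] h_boundary[OF x0] \<nu>_boundary[OF x0] by simp
    show "((\<lambda>x. Fh x + f (\<nu> x)) has_derivative (\<lambda>v. fd Fh x v + f' (\<nu> x) * - fd Fh x (B x v))) (at x) \<and>
        fd Fh x e\<^sub>1 + f' (\<nu> x) * - fd Fh x (B x e\<^sub>1) = E x" if x: "x \<in> W" "0 < x $ 1" for x
      using has_derivative_add[OF smooth_on_has_derivative[OF Fh_smooth x(1)]
          has_derivative_compose[OF shape_interior(1)[OF x] f(1)[OF \<nu>1, unfolded has_field_derivative_def]]] x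
      by (simp add: E_def)
  qed
  then have "fd Fh x0 e\<^sub>1 * (1 - f' \<nu>0 * B x0 e\<^sub>1 $ 1) \<le> 0"
    using linear2_expand[OF linear_Fh[OF x0(1)], of "B x0 e\<^sub>1"] Fh2[OF x0] \<nu>_boundary[OF x0]
    by (simp add: E_def algebra_simps)
  then have "1 \<le> f' \<nu>0 * B x0 e\<^sub>1 $ 1" using Fh1_pos by (simp add: mult_le_0_iff)
  moreover have "B x0 e\<^sub>1 $ 1 = 2 * H - B x0 e\<^sub>2 $ 2" using trace by simp
  ultimately show "1 \<le> f' \<nu>0 * (2 * H - B x0 e\<^sub>2 $ 2)" by simp
qed

text \<open>\<open>c\<close> lifts the boundary curve through the patch and is only continuous at
  first. \<open>Fm\<close> is regular along the boundary line, so the lift is differentiable. In the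
  acceleration the component along \<open>fd Fm x0 e\<^sub>2\<close> is orthogonal to
  \<open>X x0\<close>, and what remains is \<open>II\<close>.\<close>

lemma boundary_curve:
  fixes c \<gamma> \<gamma>' :: "real \<Rightarrow> real^2"
  assumes J: "open J" "t0 \<in> J" and c: "continuous_on J c" "c t0 = x0"
    "\<And>t. t \<in> J \<Longrightarrow> c t \<in> W" "\<And>t. t \<in> J \<Longrightarrow> c t $ 1 = 0"
    and \<gamma>: "\<And>t. t \<in> J \<Longrightarrow> \<gamma> t = Fm (c t)" "\<And>t. t \<in> J \<Longrightarrow> (\<gamma> has_vector_derivative \<gamma>' t) (at t)"
    "(\<gamma>' has_vector_derivative a) (at t0)"
  obtains p where "\<gamma>' t0 = p *\<^sub>R fd Fm x0 e\<^sub>2"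
    "g (Fm x0) (X x0) (a + \<Gamma> (Fm x0) (\<gamma>' t0) (\<gamma>' t0)) = p\<^sup>2 * II x0 e\<^sub>2 e\<^sub>2"
proof -
  define b where "b t = fd Fm (c t) e\<^sub>2" for t
  \<comment> \<open>The speed of the lift, found by comparing \<open>\<gamma>' t\<close> with
    \<open>b t\<close> in the Euclidean inner product; any functional that is nonzero on
    \<open>b t\<close> would give the same value.\<close>
  define p where "p t = (\<gamma>' t \<bullet> b t) / (b t \<bullet> b t)" for t
  have c_eq: "c t = 0 + c t $ 2 *\<^sub>R e\<^sub>2" if "t \<in> J" for t
    using c(4)[OF that] by (simp add: vec_eq_iff forall_2 axis_def)
  have b0: "b t \<noteq> 0" if "t \<in> J" for t
    unfolding b_def by (rule Fm2_nonzero[OF c(3,4)[OF that]])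
  have c2: "((\<lambda>t. c t $ 2) has_real_derivative p t) (at t)" if t: "t \<in> J" for t
    unfolding p_def
  proof (rule reparam_differentiable[where \<phi> = "\<lambda>\<tau>. Fm (0 + \<tau> *\<^sub>R e\<^sub>2) \<bullet> b t"])
    show "((\<lambda>\<tau>. Fm (0 + \<tau> *\<^sub>R e\<^sub>2) \<bullet> b t) has_real_derivative b t \<bullet> b t) (at (c t $ 2))"
    proof -
      have "((\<lambda>x. Fm x \<bullet> b t) has_derivative (\<lambda>v. fd Fm (c t) v \<bullet> b t)) (at (0 + c t $ 2 *\<^sub>R e\<^sub>2))"
        unfolding c_eq[OF t, symmetric]
        by (rule bounded_linear.has_derivative[OF bounded_linear_inner_left smooth_on_has_derivative[OF Fm_smooth c(3)[OF t]]])
      from has_real_derivative_line[OF this] show ?thesis by (simp add: b_def)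
    qed
    show "b t \<bullet> b t \<noteq> 0" using b0[OF t] by simp
    show "isCont (\<lambda>t. c t $ 2) t"
      using c(1) J(1) t by (intro continuous_intros) (simp add: continuous_on_eq_continuous_at)
    have "((\<lambda>s. \<gamma> s \<bullet> b t) has_real_derivative \<gamma>' t \<bullet> b t) (at t)"
      using bounded_linear.has_vector_derivative[OF bounded_linear_inner_left \<gamma>(2)[OF t]]
      by (simp add: has_real_derivative_iff_has_vector_derivative)
    then show "((\<lambda>s. Fm (0 + c s $ 2 *\<^sub>R e\<^sub>2) \<bullet> b t) has_real_derivative \<gamma>' t \<bullet> b t) (at t)"
      by (rule has_field_derivative_transform_within_open[OF _ J(1) t]) (use c_eq \<gamma>(1) in metis)
  qed
  have dc: "(c has_derivative (\<lambda>h. h *\<^sub>R (p t *\<^sub>R e\<^sub>2))) (at t)" if t: "t \<in> J" for t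
  proof (rule has_derivative_transform_within_open[OF _ J(1) t])
    show "((\<lambda>t. 0 + c t $ 2 *\<^sub>R e\<^sub>2) has_derivative (\<lambda>h. h *\<^sub>R (p t *\<^sub>R e\<^sub>2))) (at t)"
      using has_derivative_scaleR_left[OF c2[OF t, unfolded has_field_derivative_def], of e\<^sub>2]
      by (simp add: mult.commute)
  qed (use c_eq in auto)
  have \<gamma>'_eq: "\<gamma>' t = p t *\<^sub>R b t" if t: "t \<in> J" for t
  proof -
    have "((\<lambda>s. Fm (c s)) has_derivative (\<lambda>h. fd Fm (c t) (h *\<^sub>R (p t *\<^sub>R e\<^sub>2)))) (at t)"
      by (rule has_derivative_compose[OF dc[OF t] smooth_on_has_derivative[OF Fm_smooth c(3)[OF t]]])
    then have "(\<gamma> has_vector_derivative p t *\<^sub>R b t) (at t)"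
      unfolding has_vector_derivative_def b_def
      by (rule has_derivative_transform_within_open[OF has_derivative_eq_rhs J(1) t])
        (use \<gamma>(1) linear_scale[OF linear_Fm[OF c(3)[OF t]]] in auto)
    then show ?thesis using vector_derivative_unique_at \<gamma>(2)[OF t] by blast
  qed
  define b' where "b' = fd (\<lambda>x. fd Fm x e\<^sub>2) x0 e\<^sub>2"
  have db: "(b has_vector_derivative p t0 *\<^sub>R b') (at t0)"
  proof -
    have "((\<lambda>x. fd Fm x e\<^sub>2) has_derivative fd (\<lambda>x. fd Fm x e\<^sub>2) x0) (at (c t0))"
      using smooth_on_has_derivative[OF smooth_on_fd[OF Fm_smooth] x0(1)] c(2) by simp
    from has_derivative_compose[OF dc[OF J(2)] this]
    show ?thesis
      unfolding has_vector_derivative_def b_def b'_def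
      using linear_scale[OF fd_linear[OF smooth_on_differentiable[OF smooth_on_fd[OF Fm_smooth] x0(1)]]]
      by simp
  qed
  have "p differentiable (at t0)"
    unfolding p_def
  proof (intro differentiable_divide differentiable_inner)
    show "\<gamma>' differentiable (at t0)" "b differentiable (at t0)"
      using \<gamma>(3) db by (auto simp: has_vector_derivative_def differentiable_def)
    then show "b differentiable (at t0)" "b differentiable (at t0)" by auto
  qed (use b0[OF J(2)] in auto)
  then obtain p' where p': "(p has_vector_derivative p') (at t0)"
    using differentiable_def vector_derivative_works by blast
  have "((\<lambda>t. p t *\<^sub>R b t) has_vector_derivative p t0 *\<^sub>R (p t0 *\<^sub>R b') + p' *\<^sub>R b t0) (at t0)"
    using has_vector_derivative_scaleR[OF p'[unfolded has_real_derivative_iff_has_vector_derivative[symmetric]] db]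
    by simp
  then have "(\<gamma>' has_vector_derivative p t0 *\<^sub>R (p t0 *\<^sub>R b') + p' *\<^sub>R b t0) (at t0)"
    by (rule has_vector_derivative_transform_within_open[OF _ J]) (simp add: \<gamma>'_eq)
  then have a: "a = p t0 *\<^sub>R (p t0 *\<^sub>R b') + p' *\<^sub>R b t0"
    using vector_derivative_unique_at \<gamma>(3) by blast
  note x0V = in_V[OF x0(1)]
  have bt0: "b t0 = fd Fm x0 e\<^sub>2" by (simp add: b_def c(2))
  have "g (Fm x0) (X x0) (a + \<Gamma> (Fm x0) (\<gamma>' t0) (\<gamma>' t0)) =
      (p t0)\<^sup>2 * g (Fm x0) (X x0) (b' + \<Gamma> (Fm x0) (b t0) (b t0))"
    using X_boundary(2)[OF x0]
    by (simp add: a \<gamma>'_eq[OF J(2)] bt0 g_simps x0V bilinear_lmul[OF christoffel_bilinear[OF x0V]]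
        bilinear_rmul[OF christoffel_bilinear[OF x0V]] power2_eq_square algebra_simps)
  also have "g (Fm x0) (X x0) (b' + \<Gamma> (Fm x0) (b t0) (b t0)) = II x0 e\<^sub>2 e\<^sub>2"
    by (simp add: II_def b'_def bt0 Fh22[OF x0])
  finally show ?thesis using that[of "p t0"] \<gamma>'_eq[OF J(2)] bt0 by simp
qed

text \<open>At \<open>x0\<close> the horizontal part \<open>X x0\<close> of the normal is normal to
  the boundary, has length \<open>sqrt (1 - \<nu>0\<^sup>2)\<close> and points against
  \<open>n\<close> by \<open>X_inward\<close>. So the normal curvature of the boundary is
  \<open>- sqrt (1 - \<nu>0\<^sup>2)\<close> times the geodesic curvature, and
  \<open>boundary_shape\<close> bounds it.\<close>

theorem boundary_curvature_bound:
  fixes c \<gamma> \<gamma>' :: "real \<Rightarrow> real^2"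
  assumes f: "\<And>t. \<bar>t\<bar> \<le> 1 \<Longrightarrow> (f has_real_derivative f' t) (at t)" "continuous_on {-1..1} f'" "f' \<nu>0 > 0"
    and max: "\<And>x. x \<in> W \<Longrightarrow> 0 < x $ 1 \<Longrightarrow> Fh x + f (\<nu> x) \<le> f \<nu>0"
    and J: "open J" "t0 \<in> J" and c: "continuous_on J c" "c t0 = x0"
    "\<And>t. t \<in> J \<Longrightarrow> c t \<in> W" "\<And>t. t \<in> J \<Longrightarrow> c t $ 1 = 0"
    and \<gamma>: "\<And>t. t \<in> J \<Longrightarrow> \<gamma> t = Fm (c t)" "\<And>t. t \<in> J \<Longrightarrow> (\<gamma> has_vector_derivative \<gamma>' t) (at t)"
    "(\<gamma>' has_vector_derivative a) (at t0)" "g (Fm x0) (\<gamma>' t0) (\<gamma>' t0) = 1"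
    and n: "g (Fm x0) n n = 1" "g (Fm x0) n (\<gamma>' t0) = 0"
    and outer: "\<forall>\<^sub>F s in at_right 0. Fm x0 + s *\<^sub>R n \<notin> Fm ` WQ"
  shows "1 / f' \<nu>0 - 2 * H \<le> sqrt (1 - \<nu>0\<^sup>2) * g (Fm x0) (a + \<Gamma> (Fm x0) (\<gamma>' t0) (\<gamma>' t0)) n"
proof -
  note x0V = in_V[OF x0(1)]
  define acc where "acc = a + \<Gamma> (Fm x0) (\<gamma>' t0) (\<gamma>' t0)"
  let ?b = "fd Fm x0 e\<^sub>2"
  obtain p where p: "\<gamma>' t0 = p *\<^sub>R ?b" "g (Fm x0) (X x0) acc = p\<^sup>2 * II x0 e\<^sub>2 e\<^sub>2"
    using boundary_curve[OF J c \<gamma>(1-3)] unfolding acc_def by blast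
  have p1: "p\<^sup>2 * g (Fm x0) ?b ?b = 1"
    using \<gamma>(4) by (simp add: p(1) g_simps x0V power2_eq_square)
  have p0: "p \<noteq> 0" using p1 by auto
  have shape: "1 \<le> f' \<nu>0 * (2 * H - B x0 e\<^sub>2 $ 2)" "II x0 e\<^sub>2 e\<^sub>2 = B x0 e\<^sub>2 $ 2 * g (Fm x0) ?b ?b"
    using boundary_shape[OF f(1,2) max] by auto
  have B: "g (Fm x0) (X x0) acc = B x0 e\<^sub>2 $ 2"
    using p(2) shape(2) p1 by (simp add: algebra_simps)
  have nb: "g (Fm x0) n ?b = 0" using n(2) p0 by (simp add: p(1) g_simps x0V)
  have b0: "?b \<noteq> 0" by (rule Fm2_nonzero[OF x0])
  let ?k = "g (Fm x0) (X x0) n"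
  have k: "?k \<le> 0"
  proof (rule X_inward[OF n(1) _ _ outer])
    show "g (Fm x0) ?b n = 0" using nb g_sym[OF x0V] by metis
    show "g (Fm x0) ?b ?b \<noteq> 0" using g_eq_zero[OF x0V] b0 by simp
  qed
  have X: "X x0 = ?k *\<^sub>R n"
    using orthogonal_expansion[OF x0V n(1) b0] nb X_boundary(2)[OF x0] g_sym[OF x0V] by metis
  have "?k\<^sup>2 = 1 - \<nu>0\<^sup>2"
  proof -
    have "g (Fm x0) (X x0) (X x0) = g (Fm x0) (X x0) (?k *\<^sub>R n)" using X by simp
    then show ?thesis using X_boundary(1)[OF x0] by (simp add: g_simps x0V power2_eq_square)
  qed
  then have ks: "sqrt (1 - \<nu>0\<^sup>2) = - ?k"
    using k by (metis abs_of_nonpos real_sqrt_abs)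
  have "g (Fm x0) (X x0) acc = g (Fm x0) (?k *\<^sub>R n) acc" using X by simp
  also have "\<dots> = - (sqrt (1 - \<nu>0\<^sup>2) * g (Fm x0) acc n)"
    using g_sym[OF x0V, of n acc] by (simp add: ks g_simps x0V)
  finally have "B x0 e\<^sub>2 $ 2 = - (sqrt (1 - \<nu>0\<^sup>2) * g (Fm x0) acc n)" using B by simp
  then have "1 \<le> f' \<nu>0 * (2 * H + sqrt (1 - \<nu>0\<^sup>2) * g (Fm x0) acc n)" using shape(1) by simp
  then have "1 / f' \<nu>0 \<le> 2 * H + sqrt (1 - \<nu>0\<^sup>2) * g (Fm x0) acc n"
    using f(3) by (simp add: field_simps)
  then show ?thesis unfolding acc_def by simp
qed

end

section \<open>The antiderivative behind the height constant\<close>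

definition height_fun :: "real \<Rightarrow> real \<Rightarrow> real \<Rightarrow> real" where
  "height_fun c H t =
     (if c < 0 then 4 * H / sqrt (- 4 * c * H\<^sup>2 - c\<^sup>2) * arctan (t * (sqrt (- c) / sqrt (c + 4 * H\<^sup>2)))
      else if c = 0 then t / H
      else 4 * H / sqrt (4 * c * H\<^sup>2 + c\<^sup>2) * artanh (t * (sqrt c / sqrt (c + 4 * H\<^sup>2))))"

lemma height_fun_pos:
  assumes "4 * H\<^sup>2 + c > 0" "H > 0" "\<bar>t\<bar> \<le> (1::real)"
  shows "4 * H\<^sup>2 + c * (1 - t\<^sup>2) > 0"
proof (cases "c \<ge> 0")
  case True
  then show ?thesis using assms by (simp add: add_pos_nonneg abs_square_le_1)
next
  case False
  have "c * (1 - t\<^sup>2) \<ge> c * 1" using False by (intro mult_left_mono_neg) auto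
  then show ?thesis using assms by simp
qed

text \<open>One formula covers all signs of \<open>c\<close>, so the geometric arguments that use
  the derivative need no case distinction.\<close>

lemma height_fun_derivative:
  assumes c: "4 * H\<^sup>2 + c > 0" and H: "H > 0" and t: "\<bar>t\<bar> \<le> 1"
  shows "(height_fun c H has_real_derivative 4 * H / (4 * H\<^sup>2 + c * (1 - t\<^sup>2))) (at t)"
proof -
  define e where "e = c + 4 * H\<^sup>2"
  have e: "e > 0" using c by (simp add: e_def)
  have pos: "e - c * t\<^sup>2 > 0" using height_fun_pos[OF c H t] by (simp add: e_def algebra_simps)
  consider "c < 0" | "c = 0" | "c > 0" by linarith
  then show ?thesis
  proof cases
    case 1
    define r where "r = sqrt (- c) / sqrt e"
    have r2: "r\<^sup>2 = - c / e" using 1 e by (simp add: r_def power_divide)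
    \<comment> \<open>The radicand factors as \<open>(- c) * (c + 4 * H\<^sup>2)\<close>, which
      expresses the prefactor by the same ratio \<open>r\<close> that stands inside the
      arctangent.\<close>
    have "sqrt (- 4 * c * H\<^sup>2 - c\<^sup>2) = sqrt ((- c) * e)" by (simp add: e_def algebra_simps power2_eq_square)
    also have "\<dots> = sqrt (- c) * (e / sqrt e)" unfolding real_sqrt_mult using e by (simp add: real_div_sqrt)
    also have "\<dots> = r * e" by (simp add: r_def)
    finally have sq: "sqrt (- 4 * c * H\<^sup>2 - c\<^sup>2) = r * e" .
    have r: "r > 0" using 1 e by (simp add: r_def)
    have eq: "height_fun c H = (\<lambda>t. 4 * H / (r * e) * arctan (t * r))"
      using 1 sq by (auto simp: height_fun_def r_def e_def)
    have "((\<lambda>t. 4 * H / (r * e) * arctan (t * r)) has_real_derivative 4 * H / (r * e) * (inverse (1 + (t * r)\<^sup>2) * r)) (at t)"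
      using r e by (auto intro!: derivative_eq_intros)
    moreover have "4 * H / (r * e) * (inverse (1 + (t * r)\<^sup>2) * r) = 4 * H / (e * (1 + t\<^sup>2 * r\<^sup>2))"
      using r e by (simp add: divide_inverse power_mult_distrib)
    moreover have "e * (1 + t\<^sup>2 * r\<^sup>2) = 4 * H\<^sup>2 + c * (1 - t\<^sup>2)"
      using e by (simp add: r2 field_simps) (simp add: e_def algebra_simps)
    ultimately show ?thesis unfolding eq by simp
  next
    case 2
    have eq: "height_fun c H = (\<lambda>t. t / H)" using 2 by (auto simp: height_fun_def)
    have "((\<lambda>t. t / H) has_real_derivative 1 / H) (at t)" using H by (auto intro!: derivative_eq_intros)
    then show ?thesis unfolding eq using H 2 by (simp add: power2_eq_square)
  next
    case 3
    define r where "r = sqrt c / sqrt e"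
    have r2: "r\<^sup>2 = c / e" using 3 e by (simp add: r_def power_divide)
    have "sqrt (4 * c * H\<^sup>2 + c\<^sup>2) = sqrt (c * e)" by (simp add: e_def algebra_simps power2_eq_square)
    also have "\<dots> = sqrt c * (e / sqrt e)" unfolding real_sqrt_mult using e by (simp add: real_div_sqrt)
    also have "\<dots> = r * e" by (simp add: r_def)
    finally have sq: "sqrt (4 * c * H\<^sup>2 + c\<^sup>2) = r * e" .
    have r: "r > 0" using 3 e by (simp add: r_def)
    have eq: "height_fun c H = (\<lambda>t. 4 * H / (r * e) * artanh (t * r))"
      using 3 sq by (auto simp: height_fun_def r_def e_def)
    \<comment> \<open>That the argument lies in the domain of \<open>artanh\<close> is exactly the
      positivity of \<open>4 * H\<^sup>2 + c * (1 - t\<^sup>2)\<close>.\<close>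
    have "(t * r)\<^sup>2 < 1" using pos e by (simp add: power_mult_distrib r2 field_simps)
    then have lt: "\<bar>t * r\<bar> < 1" by (simp add: abs_square_less_1)
    have "((\<lambda>t. 4 * H / (r * e) * artanh (t * r)) has_real_derivative 4 * H / (r * e) * (1 / (1 - (t * r)\<^sup>2) * r)) (at t)"
      by (rule DERIV_cmult[OF DERIV_chain2[where g = "\<lambda>t. t * r" and x = t, OF artanh_real_has_field_derivative[OF lt, of UNIV]]])
        (auto intro!: derivative_eq_intros)
    moreover have "4 * H / (r * e) * (1 / (1 - (t * r)\<^sup>2) * r) = 4 * H / (e * (1 - t\<^sup>2 * r\<^sup>2))"
      using r e by (simp add: power_mult_distrib)
    moreover have "e * (1 - t\<^sup>2 * r\<^sup>2) = 4 * H\<^sup>2 + c * (1 - t\<^sup>2)"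
      using e by (simp add: r2 field_simps) (simp add: e_def algebra_simps)
    ultimately show ?thesis unfolding eq by simp
  qed
qed

lemma artanh_minus: "artanh (- x) = - artanh x" for x :: real
proof -
  have "(1 + - x) / (1 - - x) = inverse ((1 + x) / (1 - x))" by simp
  then show ?thesis unfolding artanh_def
    by (simp only: ln_inverse)
qed

text \<open>Oddness of the antiderivative turns the sum into a difference. The value at -1 is the
  one needed at points with \<nu> = -1, where the maximum principle gives nothing.\<close>

lemma height_const_eq: "height_const c H \<nu>0 = height_fun c H \<nu>0 - height_fun c H (- 1)"
  by (simp add: height_const_def height_fun_def arctan_minus artanh_minus add_divide_distrib algebra_simps)

section \<open>The product with a line\<close>

lemma prod_line_simps [simp]:
  "charts (prod_line M) = charts M" "chart_dom (prod_line M) i = chart_dom M i \<times> UNIV"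
  "coord (prod_line M) i = (\<lambda>(p, t). (coord M i p, t))"
  "metric (prod_line M) i (x, t) (v, a) (w, b) = metric M i x v w + a * b"
  by (simp_all add: prod_line_def)

lemma metric_prod_line: "metric (prod_line M) i z v w = metric M i (fst z) (fst v) (fst w) + snd v * snd w"
  by (simp add: prod_line_def split_def)

text \<open>The vertical factor is flat and the metric does not depend on the height. The definite
  description is checked directly, because \<open>riem_chart\<close> concerns planar charts and the
  product is three-dimensional.\<close>

lemma (in riem_chart) christoffel_prod_line:
  assumes x: "x \<in> V"
  shows "christoffel (prod_line M) i (x, t) v w = (\<Gamma> x (fst v) (fst w), 0)"
proof -
  have d: "fd (\<lambda>z. metric (prod_line M) i z w y) (x, t) v = fd (\<lambda>x. g x (fst w) (fst y)) x (fst v)" for w y v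
  proof -
    have "((\<lambda>z. g (fst z) (fst w) (fst y) + snd w * snd y) has_derivative
        (\<lambda>v. fd (\<lambda>x. g x (fst w) (fst y)) x (fst v) + 0)) (at (x, t))"
    proof -
      have "((\<lambda>x. g x (fst w) (fst y)) has_derivative fd (\<lambda>x. g x (fst w) (fst y)) x) (at (fst (x, t)))"
        by (simp add: fd_has_derivative g_differentiable x)
      from has_derivative_add[OF has_derivative_compose[OF has_derivative_fst[OF has_derivative_ident] this]
          has_derivative_const[of "snd w * snd y"]]
      show ?thesis by simp
    qed
    then show ?thesis by (simp add: metric_prod_line fd_eq)
  qed
  show ?thesis
    unfolding christoffel_def[of "prod_line M"] d
  proof (rule the_equality)
    show "\<forall>y. 2 * metric (prod_line M) i (x, t) (\<Gamma> x (fst v) (fst w), 0) y =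
        fd (\<lambda>x. g x (fst w) (fst y)) x (fst v) + fd (\<lambda>x. g x (fst v) (fst y)) x (fst w) -
        fd (\<lambda>x. g x (fst v) (fst w)) x (fst y)"
      by (simp add: metric_prod_line g_christoffel x koszul_def)
    fix z
    assume *: "\<forall>y. 2 * metric (prod_line M) i (x, t) z y =
        fd (\<lambda>x. g x (fst w) (fst y)) x (fst v) + fd (\<lambda>x. g x (fst v) (fst y)) x (fst w) -
        fd (\<lambda>x. g x (fst v) (fst w)) x (fst y)"
    have "fst z = \<Gamma> x (fst v) (fst w)"
    proof (rule g_nondegenerate[OF x])
      show "g x (fst z) y = g x (\<Gamma> x (fst v) (fst w)) y" for y
        using *[rule_format, of "(y, 0)"] by (simp add: metric_prod_line g_christoffel x koszul_def)
    qed
    moreover have "snd z = 0"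
    proof -
      have "linear (fd (\<lambda>x. g x (fst v) (fst w)) x)" by (rule fd_linear[OF g_differentiable[OF x]])
      moreover have "fd (\<lambda>x. g x v 0) x u = 0" for v u
        using bilinear_rzero[OF fd_g_bilinear[OF x]] .
      ultimately show ?thesis
        using *[rule_format, of "(0, 1)"] by (simp add: metric_prod_line g_zero_right x linear_0)
    qed
    ultimately show "z = (\<Gamma> x (fst v) (fst w), 0)" by (simp add: prod_eq_iff)
  qed
qed

lemma fd_Pair:
  assumes "f differentiable (at x)" "h differentiable (at x)"
  shows "fd (\<lambda>x. (f x, h x)) x v = (fd f x v, fd h x v)"
  using has_derivative_Pair[OF fd_has_derivative[OF assms(1)] fd_has_derivative[OF assms(2)]]
  by (simp add: fd_eq)

context
  fixes M :: "('a::{second_countable_topology,t2_space}, real^2, 'i) riem"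
  assumes M: "riemannian_manifold M"
begin

lemma param_prod_line:
  assumes "i \<in> charts M" "x \<in> chart_im M i"
  shows "param (prod_line M) i (x, t) = (param M i x, t)"
proof -
  have inj: "inj_on (coord M i) (chart_dom M i)"
    by (rule inj_on_inverseI[where g = "param M i"]) (simp add: param_coord[OF M assms(1)])
  have "inj_on (coord (prod_line M) i) (chart_dom (prod_line M) i)"
    using inj by (auto simp: inj_on_def)
  from inv_into_f_f[OF this, of "(param M i x, t)"] show ?thesis
    using assms by (simp add: param_def[of "prod_line M"] param_in_dom[OF M] coord_param[OF M])
qed

lemma snd_fd_transition:
  assumes ij: "i \<in> charts M" "j \<in> charts M" and q: "fst q \<in> chart_dom M i" "fst q \<in> chart_dom M j"
  shows "snd (fd (transition (prod_line M) i j) (coord (prod_line M) i q) v) = snd v"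
proof -
  let ?U = "coord M i ` (chart_dom M i \<inter> chart_dom M j)"
  have op: "open (?U \<times> (UNIV::real set))"
    by (intro open_Times open_coord_image[OF M ij(1) open_chart_dom[OF M ij(2)]]) auto
  have q': "coord (prod_line M) i q \<in> ?U \<times> UNIV" using q by (auto simp: split_def)
  have sm: "(transition M i j) differentiable (at (coord M i (fst q)))"
    by (rule smooth_on_differentiable[OF transition_smooth[OF M ij]]) (use q in auto)
  have "((\<lambda>z. (transition M i j (fst z), snd z)) has_derivative (\<lambda>v. (fd (transition M i j) (coord M i (fst q)) (fst v), snd v)))
      (at (coord (prod_line M) i q))"
  proof -
    have "(transition M i j has_derivative fd (transition M i j) (coord M i (fst q))) (at (fst (coord (prod_line M) i q)))"
      using fd_has_derivative[OF sm] by (simp add: split_def)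
    from has_derivative_Pair[OF has_derivative_compose[OF has_derivative_fst[OF has_derivative_ident] this]
        has_derivative_snd[OF has_derivative_ident]]
    show ?thesis .
  qed
  then have "(transition (prod_line M) i j has_derivative (\<lambda>v. (fd (transition M i j) (coord M i (fst q)) (fst v), snd v)))
      (at (coord (prod_line M) i q))"
    by (rule has_derivative_transform_within_open[OF _ op q'])
      (use ij in \<open>auto simp: transition_def param_prod_line coord_in_im[OF M]\<close>)
  then show ?thesis by (simp add: fd_eq)
qed

text \<open>Transition maps of the product do not change vertical components, so any chart around
  the point may replace the chosen one.\<close>

lemma angle_function_eq:
  assumes N: "unit_normal_field (prod_line M) S B N" and q: "q \<in> S" and i: "i \<in> charts M" "fst q \<in> chart_dom M i"
  shows "angle_function M N q = snd (N i q)"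
proof -
  let ?j = "chart_at (prod_line M) q"
  have "\<exists>i. i \<in> charts (prod_line M) \<and> q \<in> chart_dom (prod_line M) i"
    using i by (auto simp: mem_Times_iff)
  from someI_ex[OF this] have j: "?j \<in> charts M" "fst q \<in> chart_dom M ?j"
    unfolding chart_at_def by (auto simp: mem_Times_iff)
  interpret riem_chart M ?j "chart_im M ?j" by (rule riem_chart_manifold[OF M j(1)])
  have "angle_function M N q = snd (N ?j q)"
    using g_zero_right[OF coord_in_im[OF M j]]
    by (simp add: angle_function_def Let_def metric_prod_line split_def)
  moreover have "N ?j q = fd (transition (prod_line M) i ?j) (coord (prod_line M) i q) (N i q)"
  proof -
    have "q \<in> S \<inter> chart_dom (prod_line M) i \<inter> chart_dom (prod_line M) ?j" "i \<in> charts (prod_line M)" "?j \<in> charts (prod_line M)"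
      using q i j by (simp_all add: mem_Times_iff)
    then show ?thesis using N unfolding unit_normal_field_def by blast
  qed
  ultimately show ?thesis using snd_fd_transition[OF i(1) j(1) i(2) j(2)] by simp
qed

end

text \<open>Splits a patch and the normal along it into base and vertical parts. It is applied both
  to the patches of the interior graph and to the half-plane patches at the boundary.\<close>

lemma patch_components:
  fixes M :: "('a::{second_countable_topology,t2_space}, real^2, 'i) riem"
  assumes M: "riemannian_manifold M"
    and patch: "surface_patch (prod_line M) S B Q i W F"
    and N: "unit_normal_field (prod_line M) S B N"
    and mc: "has_constant_mean_curvature (prod_line M) S B N H"
  defines "Fm \<equiv> \<lambda>x. coord M i (fst (F x))" and "Fh \<equiv> \<lambda>x. snd (F x)"
    and "X \<equiv> \<lambda>x. fst (N i (F x))" and "n \<equiv> \<lambda>x. snd (N i (F x))"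
  shows "i \<in> charts M" "open W" "\<And>x. x \<in> W \<Longrightarrow> fst (F x) \<in> chart_dom M i"
    "smooth_on W Fm" "smooth_on W Fh"
    "\<And>x v. x \<in> W \<Longrightarrow> fd Fm x v = 0 \<Longrightarrow> fd Fh x v = 0 \<Longrightarrow> v = 0"
    "continuous_on (W \<inter> Q) X" "continuous_on (W \<inter> Q) n"
    "\<And>x. x \<in> W \<Longrightarrow> x \<in> Q \<Longrightarrow> metric M i (Fm x) (X x) (X x) + (n x)\<^sup>2 = 1"
    "\<And>x v. x \<in> W \<Longrightarrow> x \<in> Q \<Longrightarrow> metric M i (Fm x) (X x) (fd Fm x v) + n x * fd Fh x v = 0"
    "\<And>x. x \<in> W \<Longrightarrow> x \<in> interior Q \<Longrightarrow> \<exists>A. linear A \<and> trace2 A = 2 * H \<and>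
      X differentiable (at x) \<and> n differentiable (at x) \<and>
      (\<forall>v. fd Fm x (A v) = - (fd X x v + christoffel M i (Fm x) (fd Fm x v) (X x)) \<and>
           fd Fh x (A v) = - fd n x v)"
proof -
  have p: "i \<in> charts M" "open W" "F ` W \<subseteq> chart_dom M i \<times> UNIV" "smooth_on W (coord (prod_line M) i \<circ> F)"
    "\<forall>x\<in>W. inj (fd (coord (prod_line M) i \<circ> F) x)"
    "\<exists>U G. open U \<and> homeomorphism (W \<inter> Q) (S \<inter> U) F G \<and> F ` (W \<inter> frontier Q) = B \<inter> U"
    using patch unfolding surface_patch_def by auto
  show i: "i \<in> charts M" and W: "open W" by (fact p(1), fact p(2))
  interpret riem_chart M i "chart_im M i" by (rule riem_chart_manifold[OF M i])
  show dom: "fst (F x) \<in> chart_dom M i" if "x \<in> W" for x using p(3) that by force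
  have FmV: "Fm x \<in> chart_im M i" if "x \<in> W" for x
    unfolding Fm_def by (rule coord_in_im[OF M i dom[OF that]])
  have cF: "coord (prod_line M) i \<circ> F = (\<lambda>x. (Fm x, Fh x))"
    by (auto simp: Fm_def Fh_def split_def)
  have sm: "smooth_on W (\<lambda>x. (Fm x, Fh x))" using p(4) unfolding cF .
  from smooth_on_linear[OF W bounded_linear_fst this] show Fm: "smooth_on W Fm" by simp
  from smooth_on_linear[OF W bounded_linear_snd sm] show Fh: "smooth_on W Fh" by simp
  have fdF: "fd (coord (prod_line M) i \<circ> F) x v = (fd Fm x v, fd Fh x v)" if "x \<in> W" for x v
    unfolding cF using fd_Pair[OF smooth_on_differentiable[OF Fm that] smooth_on_differentiable[OF Fh that]] .
  show "v = 0" if x: "x \<in> W" and v: "fd Fm x v = 0" "fd Fh x v = 0" for x v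
  proof -
    have "fd (coord (prod_line M) i \<circ> F) x v = fd (coord (prod_line M) i \<circ> F) x 0"
      unfolding fdF[OF x] using v linear_0[OF fd_linear[OF smooth_on_differentiable[OF Fm x]]]
        linear_0[OF fd_linear[OF smooth_on_differentiable[OF Fh x]]] by simp
    then show ?thesis using p(5) x injD by metis
  qed
  obtain U G where UG: "homeomorphism (W \<inter> Q) (S \<inter> U) F G" using p(6) by blast
  have FS: "F x \<in> S" if "x \<in> W" "x \<in> Q" for x
    using UG that unfolding homeomorphism_def by blast
  have i': "i \<in> charts (prod_line M)" using i by simp
  have in_dom: "F x \<in> S \<inter> chart_dom (prod_line M) i" if "x \<in> W" "x \<in> Q" for x
    by (simp add: mem_Times_iff FS dom that)
  have "continuous_on (S \<inter> chart_dom (prod_line M) i) (N i)"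
    using N i' unfolding unit_normal_field_def by blast
  moreover have "continuous_on (W \<inter> Q) F" using UG unfolding homeomorphism_def by blast
  ultimately have cN: "continuous_on (W \<inter> Q) (\<lambda>x. N i (F x))"
    by (rule continuous_on_compose2) (use in_dom in blast)
  show "continuous_on (W \<inter> Q) X" "continuous_on (W \<inter> Q) n"
    unfolding X_def n_def by (intro continuous_on_fst continuous_on_snd cN)+
  show "g (Fm x) (X x) (X x) + (n x)\<^sup>2 = 1" if x: "x \<in> W" "x \<in> Q" for x
  proof -
    have "metric (prod_line M) i (coord (prod_line M) i (F x)) (N i (F x)) (N i (F x)) = 1"
      using N i' in_dom[OF x] unfolding unit_normal_field_def by blast
    then show ?thesis by (simp add: metric_prod_line split_def Fm_def X_def n_def power2_eq_square)
  qed
  show "g (Fm x) (X x) (fd Fm x v) + n x * fd Fh x v = 0" if x: "x \<in> W" "x \<in> Q" for x v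
  proof -
    have "metric (prod_line M) i (coord (prod_line M) i (F x)) (N i (F x))
        (fd (coord (prod_line M) i \<circ> F) x v) = 0"
      using N patch x unfolding unit_normal_field_def by blast
    then show ?thesis unfolding fdF[OF x(1)] by (simp add: metric_prod_line split_def Fm_def X_def n_def)
  qed
  show "\<exists>A. linear A \<and> trace2 A = 2 * H \<and>
      X differentiable (at x) \<and> n differentiable (at x) \<and>
      (\<forall>v. fd Fm x (A v) = - (fd X x v + christoffel M i (Fm x) (fd Fm x v) (X x)) \<and>
           fd Fh x (A v) = - fd n x v)" if x: "x \<in> W" "x \<in> interior Q" for x
  proof -
    obtain A where A: "is_shape_operator (prod_line M) N i F x A" "trace (matrix A) / 2 = H"
      using mc patch x unfolding has_constant_mean_curvature_def by blast
    have dN: "(\<lambda>y. N i (F y)) differentiable (at x)" using A(1) by (simp add: is_shape_operator_def)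
    have dX: "X differentiable (at x)" and dn: "n differentiable (at x)"
      using has_derivative_fst[OF fd_has_derivative[OF dN]] has_derivative_snd[OF fd_has_derivative[OF dN]]
      unfolding X_def n_def differentiable_def by blast+
    have fdN: "fd (\<lambda>y. N i (F y)) x v = (fd X x v, fd n x v)" for v
      using fd_Pair[OF dX dn] by (simp add: X_def n_def)
    have "(fd Fm x (A v), fd Fh x (A v)) = - ((fd X x v, fd n x v) + (\<Gamma> (Fm x) (fd Fm x v) (X x), 0))" for v
    proof -
      have "coord (prod_line M) i (F x) = (Fm x, snd (F x))" by (simp add: split_def Fm_def)
      then show ?thesis
        using A(1) unfolding is_shape_operator_def fdF[OF x(1)] fdN
        by (simp add: christoffel_prod_line[OF FmV[OF x(1)]] X_def)
    qed
    then have "\<forall>v. fd Fm x (A v) = - (fd X x v + \<Gamma> (Fm x) (fd Fm x v) (X x)) \<and> fd Fh x (A v) = - fd n x v"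
      by simp
    moreover have "linear A" using A(1) by (simp add: is_shape_operator_def)
    moreover have "trace2 A = 2 * H" using A(2) trace_matrix2[of A] by simp
    ultimately show ?thesis using dX dn by blast
  qed
qed

section \<open>Graphs over a domain\<close>

text \<open>A unit normal field is assumed to be continuous only, but over a graph it is algebraic
  in the gradient \<open>Z\<close> of \<open>w\<close>: \<open>X = - n *\<^sub>R Z\<close>, and the
  unit length determines \<open>n\<close> up to the sign fixed by \<open>\<sigma>\<close>.\<close>

lemma (in riem_chart) graph_normal_smooth:
  assumes U: "open U" "U \<subseteq> V" and w: "smooth_on U w" and \<sigma>: "\<sigma>\<^sup>2 = (1::real)"
    and normal: "\<And>x v. x \<in> U \<Longrightarrow> g x (X x) v + n x * fd w x v = 0"
    and unit: "\<And>x. x \<in> U \<Longrightarrow> g x (X x) (X x) + (n x)\<^sup>2 = 1"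
    and neg: "\<And>x. x \<in> U \<Longrightarrow> \<sigma> * n x < 0"
  shows "smooth_on U X"
proof -
  define Z where "Z x = sharp x (fd w x e\<^sub>1) (fd w x e\<^sub>2)" for x
  define q where "q x = fd w x e\<^sub>1 * (Z x \<bullet> e\<^sub>1) + fd w x e\<^sub>2 * (Z x \<bullet> e\<^sub>2)" for x
  have gZ: "g x (Z x) v = fd w x v" if x: "x \<in> U" for x v
    using g_sharp[of x] U(2) x linear2_expand[OF fd_linear[OF smooth_on_differentiable[OF w x]], of v]
    by (auto simp: Z_def mult.commute)
  have q: "q x = g x (Z x) (Z x)" if x: "x \<in> U" for x
    using g_sharp[of x "fd w x e\<^sub>1" "fd w x e\<^sub>2" "Z x"] U(2) x
    by (auto simp: q_def Z_def inner_axis)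
  have q0: "q x \<ge> 0" if x: "x \<in> U" for x
    using q[OF x] g_nonneg[of x "Z x"] U(2) x by auto
  have XZ: "X x = - n x *\<^sub>R Z x" if x: "x \<in> U" for x
    by (rule g_nondegenerate[of x]) (use U(2) x normal[OF x] gZ[OF x] in \<open>auto simp: g_simps subset_iff eq_neg_iff_add_eq_0\<close>)
  have n2: "(n x)\<^sup>2 * (1 + q x) = 1" if x: "x \<in> U" for x
    using unit[OF x] U(2) x unfolding XZ[OF x] q[OF x]
    by (auto simp: g_simps subset_iff power2_eq_square algebra_simps)
  have n: "n x = - \<sigma> / sqrt (1 + q x)" if x: "x \<in> U" for x
  proof -
    have "(\<sigma> * n x)\<^sup>2 * (1 + q x) = 1" using n2[OF x] \<sigma> by (simp add: power_mult_distrib)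
    then have "(\<sigma> * n x)\<^sup>2 = 1 / (1 + q x)" using q0[OF x] by (simp add: field_simps)
    then have "\<bar>\<sigma> * n x\<bar> = 1 / sqrt (1 + q x)"
      by (metis real_sqrt_abs real_sqrt_divide real_sqrt_one)
    then have "\<sigma> * n x = - (1 / sqrt (1 + q x))" using neg[OF x] by simp
    then have "\<sigma> * (\<sigma> * n x) = \<sigma> * - (1 / sqrt (1 + q x))" by simp
    then show ?thesis using \<sigma> by (simp add: power2_eq_square mult.assoc[symmetric])
  qed
  have smZ: "smooth_on U Z"
    unfolding Z_def by (intro smooth_sharp U smooth_on_fd w)
  have smq: "smooth_on U q"
    unfolding q_def by (intro smooth_intros U w smooth_on_linear[OF U(1) bounded_linear_inner_left smZ])
  have "smooth_on U (\<lambda>x. (\<sigma> / sqrt (1 + q x)) *\<^sub>R Z x)"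
    by (intro smooth_intros U smZ smq) (use q0 in \<open>auto simp: add_pos_nonneg add_nonneg_eq_0_iff\<close>)
  then show ?thesis
    by (rule smooth_on_cong[OF U(1)]) (simp add: XZ n)
qed

locale H_graph_setup =
  fixes M :: "('a::{second_countable_topology,t2_space}, real^2, 'i) riem"
    and \<Omega> :: "'a set" and u :: "'a \<Rightarrow> real"
    and N :: "'i \<Rightarrow> 'a \<times> real \<Rightarrow> (real^2) \<times> real"
    and H \<nu>0 c :: real
  assumes M: "riemannian_manifold M"
    and \<Omega>: "compact_regular_domain M \<Omega>"
    and H: "H > 0"
    and \<Sigma>: "H_graph M H \<Omega> u N"
    and \<nu>0: "-1 < \<nu>0" "\<nu>0 \<le> 0"
    and h_boundary: "\<forall>q\<in>graph_over (frontier \<Omega>) u. height q = 0"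
    and \<nu>_boundary: "\<forall>q\<in>graph_over (frontier \<Omega>) u. angle_function M N q = \<nu>0"
    and c: "c = (INF p\<in>\<Omega>. gauss_curvature M p)" "4 * H\<^sup>2 + c > 0"
begin

abbreviation "S \<equiv> graph_over \<Omega> u"
abbreviation "B \<equiv> graph_over (frontier \<Omega>) u"
abbreviation "P \<equiv> prod_line M"

definition "\<nu> p = angle_function M N (p, u p)"

lemma compact_\<Omega>: "compact \<Omega>" using \<Omega> by (simp add: compact_regular_domain_def)

lemma frontier_sub: "frontier \<Omega> \<subseteq> \<Omega>"
  using compact_imp_closed[OF compact_\<Omega>] by (rule frontier_subset_closed)

lemma \<Omega>_cases: "p \<in> \<Omega> \<Longrightarrow> p \<in> interior \<Omega> \<or> p \<in> frontier \<Omega>"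
  by (simp add: frontier_def compact_imp_closed[OF compact_\<Omega>])

lemma u_frontier: "p \<in> frontier \<Omega> \<Longrightarrow> u p = 0"
  using h_boundary by (auto simp: graph_over_def height_def)

lemma \<nu>_frontier: "p \<in> frontier \<Omega> \<Longrightarrow> \<nu> p = \<nu>0"
  using \<nu>_boundary by (auto simp: graph_over_def \<nu>_def)

lemma u_cont: "continuous_on \<Omega> u"
  and u_smooth: "i \<in> charts M \<Longrightarrow> smooth_on (coord M i ` (chart_dom M i \<inter> interior \<Omega>)) (\<lambda>x. u (param M i x))"
  and surface: "smooth_surface P S B"
  and N: "unit_normal_field P S B N"
  and mc: "has_constant_mean_curvature P S B N H"
  using \<Sigma> unfolding H_graph_def o_def by auto

lemma curvature_ge: "p \<in> \<Omega> \<Longrightarrow> c \<le> gauss_curvature M p"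
  unfolding c(1) by (rule INF_gauss_curvature_le[OF M compact_\<Omega>])

lemma \<nu>_eq: "p \<in> \<Omega> \<Longrightarrow> i \<in> charts M \<Longrightarrow> p \<in> chart_dom M i \<Longrightarrow> \<nu> p = snd (N i (p, u p))"
  unfolding \<nu>_def by (rule angle_function_eq[OF M N]) (auto simp: graph_over_def)

lemma \<nu>_cont: "continuous_on \<Omega> \<nu>"
  unfolding continuous_on_eq_continuous_within
proof
  fix p assume p: "p \<in> \<Omega>"
  let ?i = "chart_at M p"
  note i = chart_at_charts[OF M, of p]
  have i': "?i \<in> charts P" using i by simp
  have "continuous_on (S \<inter> chart_dom P ?i) (N ?i)"
    using N i' unfolding unit_normal_field_def by blast
  then have "continuous_on (\<Omega> \<inter> chart_dom M ?i) (\<lambda>p. N ?i (p, u p))"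
  proof (rule continuous_on_compose2)
    have "continuous_on (\<Omega> \<inter> chart_dom M ?i) u" by (rule continuous_on_subset[OF u_cont]) blast
    then show "continuous_on (\<Omega> \<inter> chart_dom M ?i) (\<lambda>p. (p, u p))"
      by (rule continuous_on_Pair[OF continuous_on_id])
    show "(\<lambda>p. (p, u p)) ` (\<Omega> \<inter> chart_dom M ?i) \<subseteq> S \<inter> chart_dom P ?i"
      by (auto simp: graph_over_def)
  qed
  from continuous_on_snd[OF this] have "continuous_on (\<Omega> \<inter> chart_dom M ?i) \<nu>"
  proof (rule continuous_on_eq)
    show "snd (N ?i (p, u p)) = \<nu> p" if "p \<in> \<Omega> \<inter> chart_dom M ?i" for p
      using \<nu>_eq[OF _ i(1), of p] that by simp
  qed
  then have "continuous (at p within (\<Omega> \<inter> chart_dom M ?i)) \<nu>"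
    using p i by (simp add: continuous_on_eq_continuous_within)
  moreover have "at p within (\<Omega> \<inter> chart_dom M ?i) = at p within \<Omega>"
    by (rule at_within_nhd[OF i(2) open_chart_dom[OF M i(1)]]) auto
  ultimately show "continuous (at p within \<Omega>) \<nu>" by simp
qed

abbreviation "Ui i \<equiv> coord M i ` (chart_dom M i \<inter> interior \<Omega>)"

lemma Ui_open: "i \<in> charts M \<Longrightarrow> open (Ui i)"
  by (rule open_coord_image[OF M _ open_interior])

lemma Ui_im: "i \<in> charts M \<Longrightarrow> x \<in> Ui i \<Longrightarrow> x \<in> chart_im M i"
  by (auto simp: chart_im_def)

lemma Ui_param: "i \<in> charts M \<Longrightarrow> x \<in> Ui i \<Longrightarrow> param M i x \<in> chart_dom M i \<inter> interior \<Omega>"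
  by (auto simp: param_coord[OF M])

text \<open>The conditions on the normal and the mean curvature are quantified over patches; this
  one makes them available for the graph function in coordinates.\<close>

lemma graph_patch:
  assumes i: "i \<in> charts M"
  shows "surface_patch P S B UNIV i (Ui i) (\<lambda>x. (param M i x, u (param M i x)))"
proof -
  let ?F = "\<lambda>x. (param M i x, u (param M i x))"
  note um = u_smooth[OF i]
  have sm: "smooth_on (Ui i) (\<lambda>x. (x, u (param M i x)))"
    by (intro smooth_intros Ui_open i um)
  have eq: "(x, u (param M i x)) = (coord P i \<circ> ?F) x" if "x \<in> Ui i" for x
    using coord_param[OF M i Ui_im[OF i that]] by simp
  have sm': "smooth_on (Ui i) (coord P i \<circ> ?F)"
    by (rule smooth_on_cong[OF Ui_open[OF i] sm eq])
  have fdF: "fd (coord P i \<circ> ?F) x v = (v, fd (\<lambda>x. u (param M i x)) x v)" if x: "x \<in> Ui i" for x v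
  proof -
    have "fd (\<lambda>x. (x, u (param M i x))) x = fd (coord P i \<circ> ?F) x"
      by (rule fd_cong[OF Ui_open[OF i] x eq smooth_on_differentiable[OF sm x]])
    moreover have "fd (\<lambda>x. (x, u (param M i x))) x v = (v, fd (\<lambda>x. u (param M i x)) x v)"
      using fd_Pair[OF differentiable_ident smooth_on_differentiable[OF um x]] by simp
    ultimately show ?thesis by simp
  qed
  have inj: "inj (fd (coord P i \<circ> ?F) x)" if "x \<in> Ui i" for x
    by (rule injI) (simp only: fdF[OF that] prod.inject)
  have p_cont: "continuous_on (Ui i) (param M i)"
    using chart_homeo[OF M i] Ui_im[OF i] unfolding homeomorphism_def
    by (meson continuous_on_subset subsetI)
  let ?U = "(chart_dom M i \<inter> interior \<Omega>) \<times> (UNIV :: real set)"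
  have hom: "homeomorphism (Ui i \<inter> UNIV) (S \<inter> ?U) ?F (\<lambda>q. coord M i (fst q))"
  proof (rule homeomorphismI)
    show "continuous_on (Ui i \<inter> UNIV) ?F"
      using p_cont smooth_on_continuous_on[OF um] by (simp add: continuous_on_Pair)
    have "continuous_on (chart_dom M i) (coord M i)"
      using chart_homeo[OF M i] unfolding homeomorphism_def by blast
    then show "continuous_on (S \<inter> ?U) (\<lambda>q. coord M i (fst q))"
      by (rule continuous_on_compose2) (auto intro!: continuous_intros)
    show "?F ` (Ui i \<inter> UNIV) \<subseteq> S \<inter> ?U"
      using Ui_param[OF i] interior_subset[of \<Omega>] by (auto simp: graph_over_def)
    show "(\<lambda>q. coord M i (fst q)) ` (S \<inter> ?U) \<subseteq> Ui i \<inter> UNIV" by auto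
    show "coord M i (fst (?F x)) = x" if "x \<in> Ui i \<inter> UNIV" for x
      using coord_param[OF M i Ui_im[OF i]] that by simp
    show "?F (coord M i (fst q)) = q" if "q \<in> S \<inter> ?U" for q
      using that by (auto simp: graph_over_def param_coord[OF M i])
  qed
  \<comment> \<open>Both sides are empty: the plane has no frontier, and the boundary of the surface
    does not lie over the interior of the domain.\<close>
  have "?F ` (Ui i \<inter> frontier UNIV) = B \<inter> ?U"
    by (auto simp: graph_over_def frontier_def)
  moreover have "open ?U" by (intro open_Times open_Int open_chart_dom[OF M i]) auto
  ultimately have ex: "\<exists>U G. open U \<and> homeomorphism (Ui i \<inter> UNIV) (S \<inter> U) ?F G \<and> ?F ` (Ui i \<inter> frontier UNIV) = B \<inter> U"
    using hom by blast
  have "?F ` Ui i \<subseteq> chart_dom P i" using Ui_param[OF i] by auto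
  then show ?thesis
    unfolding surface_patch_def using i Ui_open[OF i] sm' inj ex by simp
qed

text \<open>The base component of the graph patch is the identity in coordinates, so the shape
  operator becomes minus the covariant derivative of \<open>X\<close> in the base.\<close>

lemma graph_normal:
  assumes i: "i \<in> charts M" and x: "x \<in> Ui i"
  defines "X \<equiv> \<lambda>x. fst (N i (param M i x, u (param M i x)))"
  shows "metric M i x (X x) (X x) + (\<nu> (param M i x))\<^sup>2 = 1"
    "metric M i x (X x) v + \<nu> (param M i x) * fd (\<lambda>x. u (param M i x)) x v = 0"
    "\<exists>A. trace2 A = 2 * H \<and> X differentiable (at x) \<and>
      ((\<lambda>x. \<nu> (param M i x)) has_derivative (\<lambda>v. - fd (\<lambda>x. u (param M i x)) x (A v))) (at x) \<and>
      (\<forall>v. A v = - (fd X x v + christoffel M i x v (X x)))"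
proof -
  note pc = patch_components[OF M graph_patch[OF i] N mc]
  have cp: "coord M i (param M i x) = x" if "x \<in> Ui i" for x by (rule coord_param[OF M i Ui_im[OF i that]])
  have \<nu>n: "snd (N i (param M i x, u (param M i x))) = \<nu> (param M i x)" if "x \<in> Ui i" for x
    using \<nu>_eq[OF _ i] Ui_param[OF i that] interior_subset by (metis IntE subsetD)
  have fm: "fd (\<lambda>x. coord M i (fst (param M i x, u (param M i x)))) x v = v" for v
  proof -
    have "((\<lambda>x. coord M i (fst (param M i x, u (param M i x)))) has_derivative (\<lambda>v. v)) (at x)"
      by (rule has_derivative_transform_within_open[OF has_derivative_ident Ui_open[OF i] x]) (simp add: cp)
    then show ?thesis by (simp add: fd_eq)
  qed
  show "metric M i x (X x) (X x) + (\<nu> (param M i x))\<^sup>2 = 1"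
    using pc(9)[OF x] cp[OF x] \<nu>n[OF x] by (simp add: X_def)
  show "metric M i x (X x) v + \<nu> (param M i x) * fd (\<lambda>x. u (param M i x)) x v = 0"
    using pc(10)[OF x, of v] cp[OF x] \<nu>n[OF x] unfolding fm by (simp add: X_def)
  have "x \<in> interior UNIV" by simp
  from pc(11)[OF x this] obtain A where A: "trace2 A = 2 * H" "X differentiable (at x)"
    "(\<lambda>x. snd (N i (param M i x, u (param M i x)))) differentiable (at x)"
    and A': "\<forall>v. A v = - (fd X x v + christoffel M i x v (X x)) \<and>
      fd (\<lambda>x. u (param M i x)) x (A v) = - fd (\<lambda>x. snd (N i (param M i x, u (param M i x)))) x v"
    unfolding fm unfolding fst_conv snd_conv cp[OF x] X_def by blast
  have A'': "fd (\<lambda>x. u (param M i x)) x (A v) = - fd (\<lambda>x. snd (N i (param M i x, u (param M i x)))) x v" for v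
    using A' by blast
  have "((\<lambda>x. snd (N i (param M i x, u (param M i x)))) has_derivative (\<lambda>v. - fd (\<lambda>x. u (param M i x)) x (A v))) (at x)"
    using fd_has_derivative[OF A(3)] by (simp add: A'')
  then have "((\<lambda>x. \<nu> (param M i x)) has_derivative (\<lambda>v. - fd (\<lambda>x. u (param M i x)) x (A v))) (at x)"
    by (rule has_derivative_transform_within_open[OF _ Ui_open[OF i] x]) (simp add: \<nu>n)
  then show "\<exists>A. trace2 A = 2 * H \<and> X differentiable (at x) \<and>
      ((\<lambda>x. \<nu> (param M i x)) has_derivative (\<lambda>v. - fd (\<lambda>x. u (param M i x)) x (A v))) (at x) \<and>
      (\<forall>v. A v = - (fd X x v + christoffel M i x v (X x)))"
    using A A' by blast
qed

text \<open>Over the interior the graph function is differentiable, so there is no vertical tangent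
  plane: with \<nu> = 0 the horizontal part of the normal would be a unit vector orthogonal to every
  base vector, including itself.\<close>

lemma \<nu>_nonzero: assumes "p \<in> interior \<Omega>" shows "\<nu> p \<noteq> 0"
proof
  assume \<nu>: "\<nu> p = 0"
  let ?i = "chart_at M p"
  note i = chart_at_charts[OF M, of p]
  interpret riem_chart M ?i "chart_im M ?i" by (rule riem_chart_manifold[OF M i(1)])
  have x: "coord M ?i p \<in> Ui ?i" using assms i by auto
  let ?X = "fst (N ?i (p, u p))"
  have "g (coord M ?i p) ?X ?X = 1" "g (coord M ?i p) ?X ?X = 0"
    using graph_normal(1)[OF i(1) x] graph_normal(2)[OF i(1) x, where v = ?X] \<nu>
    by (simp_all add: param_coord[OF M i])
  then show False by simp
qed

text \<open>
  The sign \<open>\<sigma>\<close> allows for the reflection \<open>t \<mapsto> -t\<close>, needed where \<open>\<nu> > 0\<close> over a vertical boundary.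
\<close>

lemma graph_cmc:
  assumes i: "i \<in> charts M" and \<sigma>: "\<sigma>\<^sup>2 = (1::real)"
  defines "X \<equiv> \<lambda>x. fst (N i (param M i x, u (param M i x)))"
  shows "cmc_graph M i (chart_im M i) {x \<in> Ui i. \<sigma> * \<nu> (param M i x) < 0} (\<lambda>x. \<sigma> * u (param M i x))
    (\<lambda>x. \<sigma> * \<nu> (param M i x)) X H (\<lambda>x v. - (fd X x v + christoffel M i x v (X x)))"
proof -
  interpret riem_chart M i "chart_im M i" by (rule riem_chart_manifold[OF M i])
  let ?w = "\<lambda>x. u (param M i x)" and ?n = "\<lambda>x. \<nu> (param M i x)"
  define U where "U = {x \<in> Ui i. \<sigma> * ?n x < 0}"
  have n_cont: "continuous_on (Ui i) ?n"
    unfolding continuous_on_eq_continuous_within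
    using graph_normal(3)[OF i] has_derivative_continuous continuous_at_imp_continuous_at_within by blast
  have U_eq: "U = Ui i \<inter> (\<lambda>x. \<sigma> * ?n x) -` {..<0}" by (auto simp: U_def)
  have op: "open U"
    unfolding U_eq by (rule continuous_open_preimage[OF continuous_on_mult_left[OF n_cont] Ui_open[OF i]]) simp
  have sub: "U \<subseteq> chart_im M i" using Ui_im[OF i] by (auto simp: U_def)
  have UUi: "x \<in> Ui i" if "x \<in> U" for x using that by (simp add: U_def)
  have w: "smooth_on U ?w" by (rule smooth_on_subset[OF u_smooth[OF i]]) (auto simp: U_def)
  have fdw: "fd (\<lambda>x. \<sigma> * ?w x) x v = \<sigma> * fd ?w x v" if "x \<in> U" for x v
    using fd_eq[OF has_derivative_mult_right[OF smooth_on_has_derivative[OF w that], of \<sigma>]] by simp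
  have X: "smooth_on U X"
    by (rule graph_normal_smooth[OF op sub w \<sigma>, where n = ?n])
      (use graph_normal(1,2)[OF i UUi] in \<open>auto simp: X_def U_def\<close>)
  have "cmc_graph M i (chart_im M i) U (\<lambda>x. \<sigma> * ?w x) (\<lambda>x. \<sigma> * ?n x) X H
      (\<lambda>x v. - (fd X x v + christoffel M i x v (X x)))"
  proof (unfold_locales)
    show "open U" "U \<subseteq> chart_im M i" by (fact op, fact sub)
    show "smooth_on U (\<lambda>x. \<sigma> * ?w x)" by (intro smooth_on_mult smooth_on_const op w)
    show "smooth_on U X" by (fact X)
    fix x assume x: "x \<in> U"
    show "g x (X x) v = - (\<sigma> * ?n x) * fd (\<lambda>x. \<sigma> * ?w x) x v" for v
    proof -
      have "- (\<sigma> * ?n x) * (\<sigma> * fd ?w x v) = - (\<sigma>\<^sup>2 * (?n x * fd ?w x v))" by (simp add: power2_eq_square)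
      also have "\<dots> = - (?n x * fd ?w x v)" by (simp add: \<sigma>)
      finally have "- (\<sigma> * ?n x) * (\<sigma> * fd ?w x v) = - (?n x * fd ?w x v)" .
      moreover have "g x (X x) v + ?n x * fd ?w x v = 0"
        unfolding X_def by (rule graph_normal(2)[OF i UUi[OF x]])
      ultimately show ?thesis unfolding fdw[OF x] by linarith
    qed
    show "g x (X x) (X x) + (\<sigma> * ?n x)\<^sup>2 = 1"
      using graph_normal(1)[OF i UUi[OF x]] \<sigma> by (simp add: power_mult_distrib X_def)
    show "\<sigma> * ?n x < 0" using x by (simp add: U_def)
    obtain A where A: "trace2 A = 2 * H" "(?n has_derivative (\<lambda>v. - fd ?w x (A v))) (at x)"
      "\<And>v. A v = - (fd X x v + christoffel M i x v (X x))"
      using graph_normal(3)[OF i UUi[OF x]] unfolding X_def by blast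
    have A': "(\<lambda>v. - (fd X x v + christoffel M i x v (X x))) = A" using A(3) by auto
    show "trace2 (\<lambda>v. - (fd X x v + christoffel M i x v (X x))) = 2 * H" unfolding A' by (fact A(1))
    show "((\<lambda>x. \<sigma> * ?n x) has_derivative (\<lambda>v. - fd (\<lambda>x. \<sigma> * ?w x) x (- (fd X x v + christoffel M i x v (X x))))) (at x)"
      using has_derivative_mult_right[OF A(2), of \<sigma>] by (simp add: fdw[OF x] A(3))
  qed (rule refl)
  then show ?thesis unfolding U_def .
qed

text \<open>
  As \<open>\<nu>\<close> does not vanish in the interior, the open set where \<open>\<sigma> \<nu> < 0\<close> has all its boundary points
  in \<open>frontier \<Omega>\<close>. This makes any discussion of the components of the interior unnecessary.
\<close>

lemma max_on_half:
  assumes \<psi>: "continuous_on \<Omega> \<psi>" and p: "p \<in> interior \<Omega>" "\<sigma> * \<nu> p < 0"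
    and frontier: "\<And>q. q \<in> frontier \<Omega> \<Longrightarrow> \<psi> q \<le> k"
    and interior: "\<And>i x. i \<in> charts M \<Longrightarrow> x \<in> {x \<in> Ui i. \<sigma> * \<nu> (param M i x) < 0} \<Longrightarrow>
      (\<And>y. y \<in> {x \<in> Ui i. \<sigma> * \<nu> (param M i x) < 0} \<Longrightarrow> \<psi> (param M i y) \<le> \<psi> (param M i x)) \<Longrightarrow>
      \<psi> (param M i x) \<le> (k::real)"
  shows "\<psi> p \<le> k"
proof -
  \<comment> \<open>The weak inequality makes the set compact. The points it adds have \<nu> = 0 and
    therefore lie in the frontier.\<close>
  define K where "K = \<Omega> \<inter> (\<lambda>q. \<sigma> * \<nu> q) -` {..0}"
  have "closedin (top_of_set \<Omega>) K"
    unfolding K_def by (rule continuous_closedin_preimage[OF continuous_on_mult_left[OF \<nu>_cont]]) simp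
  with compact_\<Omega> have K: "compact K" by (rule closedin_compact)
  have sub: "K \<subseteq> \<Omega>" by (auto simp: K_def)
  have pK: "p \<in> K" using p interior_subset[of \<Omega>] by (auto simp: K_def)
  obtain q where q: "q \<in> K" "\<And>y. y \<in> K \<Longrightarrow> \<psi> y \<le> \<psi> q"
    using continuous_attains_sup[OF K _ continuous_on_subset[OF \<psi> sub]] pK by blast
  have "\<psi> q \<le> k"
  proof (cases "q \<in> frontier \<Omega>")
    case False
    then have qi: "q \<in> interior \<Omega>" using \<Omega>_cases q(1) sub by blast
    have \<sigma>q: "\<sigma> * \<nu> q < 0"
      using q(1) \<nu>_nonzero[OF qi] p(2) by (auto simp: K_def less_le)
    let ?i = "chart_at M q"
    note i = chart_at_charts[OF M, of q]
    have x: "coord M ?i q \<in> {x \<in> Ui ?i. \<sigma> * \<nu> (param M ?i x) < 0}"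
      using qi i \<sigma>q by (auto simp: param_coord[OF M i])
    have "\<psi> (param M ?i (coord M ?i q)) \<le> k"
    proof (rule interior[OF i(1) x])
      fix y assume "y \<in> {x \<in> Ui ?i. \<sigma> * \<nu> (param M ?i x) < 0}"
      then have "param M ?i y \<in> K"
        using Ui_param[OF i(1)] interior_subset[of \<Omega>] by (fastforce simp: K_def)
      then show "\<psi> (param M ?i y) \<le> \<psi> (param M ?i (coord M ?i q))"
        using q(2) by (simp add: param_coord[OF M i])
    qed
    then show ?thesis by (simp add: param_coord[OF M i])
  qed (rule frontier)
  then show ?thesis using q(2)[OF pK] by simp
qed

text \<open>The minimum of \<open>\<sigma> * u\<close> is taken over the frontier by
  \<open>no_interior_min\<close>, and the height vanishes there. This supplies
  \<open>h_nonneg\<close> for the boundary patches.\<close>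

lemma height_nonneg:
  assumes \<sigma>: "\<sigma>\<^sup>2 = 1" and p: "p \<in> interior \<Omega>" "\<sigma> * \<nu> p < 0"
  shows "0 \<le> \<sigma> * u p"
proof -
  have "- (\<sigma> * u p) \<le> 0"
  proof (rule max_on_half[OF _ p])
    show "continuous_on \<Omega> (\<lambda>p. - (\<sigma> * u p))" by (intro continuous_intros u_cont)
    show "- (\<sigma> * u q) \<le> 0" if "q \<in> frontier \<Omega>" for q using u_frontier[OF that] by simp
    fix i x assume i: "i \<in> charts M" and x: "x \<in> {x \<in> Ui i. \<sigma> * \<nu> (param M i x) < 0}"
      and max: "\<And>y. y \<in> {x \<in> Ui i. \<sigma> * \<nu> (param M i x) < 0} \<Longrightarrow> - (\<sigma> * u (param M i y)) \<le> - (\<sigma> * u (param M i x))"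
    show "- (\<sigma> * u (param M i x)) \<le> 0"
      using cmc_graph.no_interior_min[OF graph_cmc[OF i \<sigma>] x H] max by simp
  qed
  then show ?thesis by simp
qed

text \<open>The two entries of the maximum belong to the two possible places of a maximum point: the
  frontier, and points with \<open>\<sigma> * \<nu> = -1\<close>, where \<open>X\<close> vanishes.
  The height bound \<open>a\<close> is independent of \<open>m\<close>, so that \<open>m\<close> can
  be varied with \<open>a\<close> fixed.\<close>

lemma subharmonic_bound:
  assumes \<sigma>: "\<sigma>\<^sup>2 = 1" "\<sigma> * \<nu>0 = \<nu>0" and m: "0 < m" "m < 1/2" and p: "p \<in> interior \<Omega>" "\<sigma> * \<nu> p < 0"
    and u: "\<And>q. q \<in> \<Omega> \<Longrightarrow> \<sigma> * u q \<le> a"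
  shows "\<sigma> * u p + m * height_fun c H (\<sigma> * \<nu> p) \<le>
    max (m * height_fun c H \<nu>0) (a + m * height_fun c H (- 1))"
proof -
  let ?f = "\<lambda>t. m * height_fun c H t"
  have df: "(?f has_real_derivative m * (4 * H) / (4 * H\<^sup>2 + c * (1 - t\<^sup>2))) (at t)" if "\<bar>t\<bar> \<le> 1" for t
    using DERIV_cmult[OF height_fun_derivative[OF c(2) H that], of m] by simp
  have f_cont: "continuous_on {-1..1} ?f"
    by (rule DERIV_continuous_on[OF has_field_derivative_at_within[OF df]]) auto
  have \<nu>1: "\<bar>\<sigma> * \<nu> q\<bar> \<le> 1" if q: "q \<in> interior \<Omega>" for q
  proof -
    let ?i = "chart_at M q"
    note i = chart_at_charts[OF M, of q]
    interpret riem_chart M ?i "chart_im M ?i" by (rule riem_chart_manifold[OF M i(1)])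
    have x: "coord M ?i q \<in> Ui ?i" using q i by auto
    have "(\<nu> q)\<^sup>2 \<le> 1"
      using graph_normal(1)[OF i(1) x] g_nonneg[OF Ui_im[OF i(1) x], of "fst (N ?i (q, u q))"]
      by (simp add: param_coord[OF M i])
    then have "(\<sigma> * \<nu> q)\<^sup>2 \<le> 1" using \<sigma> by (simp add: power_mult_distrib)
    then show ?thesis by (simp add: abs_square_le_1)
  qed
  have \<nu>1': "\<bar>\<sigma> * \<nu> q\<bar> \<le> 1" if q: "q \<in> \<Omega>" for q
    using \<Omega>_cases[OF q] \<nu>1 \<nu>_frontier[of q] \<sigma>(2) \<nu>0 by auto
  show ?thesis
  proof (rule max_on_half[where \<psi> = "\<lambda>q. \<sigma> * u q + ?f (\<sigma> * \<nu> q)", OF _ p])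
    have "(\<lambda>q. \<sigma> * \<nu> q) ` \<Omega> \<subseteq> {-1..1}"
      using abs_le_D1[OF \<nu>1'] abs_le_D2[OF \<nu>1'] by (fastforce simp: minus_le_iff)
    from continuous_on_compose2[OF f_cont continuous_on_mult_left[OF \<nu>_cont] this]
    show "continuous_on \<Omega> (\<lambda>q. \<sigma> * u q + ?f (\<sigma> * \<nu> q))"
      by (rule continuous_on_add[OF continuous_on_mult_left[OF u_cont]])
    show "\<sigma> * u q + ?f (\<sigma> * \<nu> q) \<le> max (?f \<nu>0) (a + ?f (- 1))" if "q \<in> frontier \<Omega>" for q
      using u_frontier[OF that] \<nu>_frontier[OF that] \<sigma>(2) by auto
    fix i x assume i: "i \<in> charts M" and x: "x \<in> {x \<in> Ui i. \<sigma> * \<nu> (param M i x) < 0}"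
      and max: "\<And>y. y \<in> {x \<in> Ui i. \<sigma> * \<nu> (param M i x) < 0} \<Longrightarrow>
        \<sigma> * u (param M i y) + ?f (\<sigma> * \<nu> (param M i y)) \<le> \<sigma> * u (param M i x) + ?f (\<sigma> * \<nu> (param M i x))"
    have xU: "x \<in> Ui i" using x by simp
    have px: "param M i x \<in> \<Omega>" using Ui_param[OF i xU] interior_subset by blast
    let ?X = "\<lambda>x. fst (N i (param M i x, u (param M i x)))"
    show "\<sigma> * u (param M i x) + ?f (\<sigma> * \<nu> (param M i x)) \<le> max (?f \<nu>0) (a + ?f (- 1))"
    proof (cases "?X x = 0")
      case True
      interpret riem_chart M i "chart_im M i" by (rule riem_chart_manifold[OF M i])
      have "(\<nu> (param M i x))\<^sup>2 = 1"
        using graph_normal(1)[OF i xU] True g_zero_left[OF Ui_im[OF i xU]] by simp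
      then have "(\<sigma> * \<nu> (param M i x))\<^sup>2 = 1" using \<sigma> by (simp add: power_mult_distrib)
      then have "\<sigma> * \<nu> (param M i x) = - 1" using x by (auto simp: power2_eq_1_iff)
      then show ?thesis using u[OF px] by (simp add: le_max_iff_disj)
    next
      case False
      interpret cmc_graph M i "chart_im M i" "{x \<in> Ui i. \<sigma> * \<nu> (param M i x) < 0}" "\<lambda>x. \<sigma> * u (param M i x)"
        "\<lambda>x. \<sigma> * \<nu> (param M i x)" ?X H "\<lambda>x v. - (fd ?X x v + christoffel M i x v (?X x))"
        by (rule graph_cmc[OF i \<sigma>(1)])
      have "c \<le> K x"
        using curvature_ge[OF px] gauss_curvature_chart[OF M i, of "param M i x"] Ui_param[OF i xU]
          coord_param[OF M i Ui_im[OF i xU]] by (simp add: K_def)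
      from no_interior_max[OF x False H m c(2) this df max] show ?thesis by simp
    qed
  qed
qed

text \<open>The maximum principle is strict only for parameters below 1/2. It is applied to all
  smaller \<open>m'\<close>, with the height bound kept at \<open>m\<close>; as \<open>m'\<close>
  tends to \<open>m\<close> the two entries of the maximum become equal.\<close>

lemma subharmonic_bound_half:
  assumes \<sigma>: "\<sigma>\<^sup>2 = 1" "\<sigma> * \<nu>0 = \<nu>0" and m: "0 < m" "m \<le> 1/2" and p: "p \<in> interior \<Omega>" "\<sigma> * \<nu> p < 0"
    and u: "\<And>q. q \<in> \<Omega> \<Longrightarrow> \<sigma> * u q \<le> m * height_const c H \<nu>0"
  shows "\<sigma> * u p + m * height_fun c H (\<sigma> * \<nu> p) \<le> m * height_fun c H \<nu>0"
proof -
  have ev: "\<forall>\<^sub>F m' in at_left m. \<sigma> * u p + m' * height_fun c H (\<sigma> * \<nu> p) \<le>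
      max (m' * height_fun c H \<nu>0) (m * height_const c H \<nu>0 + m' * height_fun c H (- 1))"
    unfolding eventually_at_left_field
    by (rule exI[of _ 0]) (use m in \<open>auto intro!: subharmonic_bound[OF \<sigma> _ _ p u]\<close>)
  have "\<sigma> * u p + m * height_fun c H (\<sigma> * \<nu> p) \<le>
      max (m * height_fun c H \<nu>0) (m * height_const c H \<nu>0 + m * height_fun c H (- 1))"
    by (rule tendsto_le[OF _ _ _ ev]) (auto intro!: tendsto_intros)
  then show ?thesis by (simp add: height_const_eq algebra_simps)
qed

end

section \<open>Curvature estimates\<close>

text \<open>The geodesic curvature is expressed in one chart and the patch at the boundary point in
  another. Shrinking the patch domain and composing with the transition map brings both into the
  same chart.\<close>

lemma patch_restrict:
  fixes M :: "('a::{second_countable_topology,t2_space}, real^2, 'i) riem"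
  assumes M: "riemannian_manifold M"
    and patch: "surface_patch (prod_line M) S B Q j W F" and i: "i \<in> charts M"
  shows "surface_patch (prod_line M) S B Q i (W \<inter> (\<lambda>x. fst (F x)) -` chart_dom M i) F"
proof -
  have p: "Q \<in> {UNIV, {x. 0 \<le> x $ 1}}" "j \<in> charts M" "open W" "F ` W \<subseteq> chart_dom M j \<times> UNIV"
    "smooth_on W (coord (prod_line M) j \<circ> F)"
    "\<forall>x\<in>W. inj (fd (coord (prod_line M) j \<circ> F) x)"
    "\<exists>U G. open U \<and> homeomorphism (W \<inter> Q) (S \<inter> U) F G \<and> F ` (W \<inter> frontier Q) = B \<inter> U"
    using patch unfolding surface_patch_def by auto
  define Fm where "Fm x = coord M j (fst (F x))" for x
  define Fh where "Fh x = snd (F x)" for x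
  define W' where "W' = W \<inter> (\<lambda>x. fst (F x)) -` chart_dom M i"
  have dom: "fst (F x) \<in> chart_dom M j" if "x \<in> W" for x using p(4) that by force
  have cF: "coord (prod_line M) j \<circ> F = (\<lambda>x. (Fm x, Fh x))"
    by (auto simp: Fm_def Fh_def split_def)
  have sm: "smooth_on W (\<lambda>x. (Fm x, Fh x))" using p(5) unfolding cF .
  from smooth_on_linear[OF p(3) bounded_linear_fst this] have Fm: "smooth_on W Fm" by simp
  from smooth_on_linear[OF p(3) bounded_linear_snd sm] have Fh: "smooth_on W Fh" by simp
  have "continuous_on W (\<lambda>x. param M j (Fm x))"
    by (rule continuous_on_compose2[OF _ smooth_on_continuous_on[OF Fm]])
      (use chart_homeo[OF M p(2)] coord_in_im[OF M p(2) dom] in \<open>auto simp: homeomorphism_def Fm_def\<close>)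
  then have "continuous_on W (\<lambda>x. fst (F x))"
    by (rule continuous_on_eq) (simp add: Fm_def param_coord[OF M p(2) dom])
  then have W': "open W'"
    unfolding W'_def by (rule continuous_open_preimage[OF _ p(3) open_chart_dom[OF M i]])
  have W'W: "W' \<subseteq> W" by (simp add: W'_def)
  interpret C: chart_change M j "chart_im M j" i "chart_im M i" "transition M j i"
    "coord M j ` (chart_dom M j \<inter> chart_dom M i)"
    by (rule chart_change_manifold[OF M p(2) i])
  have FmU: "Fm x \<in> coord M j ` (chart_dom M j \<inter> chart_dom M i)" if "x \<in> W'" for x
    using that dom by (auto simp: Fm_def W'_def)
  have Fm': "smooth_on W' Fm" and Fh': "smooth_on W' Fh"
    using smooth_on_subset[OF Fm W'W] smooth_on_subset[OF Fh W'W] by auto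
  have T: "smooth_on W' (\<lambda>x. transition M j i (Fm x))"
    by (rule smooth_on_compose[OF W' C.open_U Fm' C.\<phi>_smooth]) (use FmU in blast)
  have eq: "(transition M j i (Fm x), Fh x) = (coord (prod_line M) i \<circ> F) x" if "x \<in> W'" for x
    using that param_coord[OF M p(2) dom, of x] by (simp add: W'_def Fm_def Fh_def transition_def split_def)
  have smT: "smooth_on W' (\<lambda>x. (transition M j i (Fm x), Fh x))"
    by (rule smooth_on_Pair[OF W' T Fh'])
  have smF: "smooth_on W' (coord (prod_line M) i \<circ> F)"
    by (rule smooth_on_cong[OF W' smT eq])
  have inj: "inj (fd (coord (prod_line M) i \<circ> F) x)" if x: "x \<in> W'" for x
  proof -
    have injT: "inj (fd (transition M j i) (Fm x))"
      by (rule linear_surjective_imp_injective[OF C.linear_\<phi>[OF FmU[OF x]] C.surj_\<phi>[OF FmU[OF x]]]) simp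
    have "fd (coord (prod_line M) i \<circ> F) x = fd (\<lambda>x. (transition M j i (Fm x), Fh x)) x"
      by (rule fd_cong[OF W' x eq smooth_on_differentiable[OF smT x], symmetric])
    also have "\<dots> = (\<lambda>v. (fd (transition M j i) (Fm x) (fd Fm x v), fd Fh x v))"
      by (rule fd_eq[OF has_derivative_Pair[OF has_derivative_compose[OF
              smooth_on_has_derivative[OF Fm' x] C.d\<phi>[OF FmU[OF x]]] smooth_on_has_derivative[OF Fh' x]]])
    finally have 1: "fd (coord (prod_line M) i \<circ> F) x = (\<lambda>v. (fd (transition M j i) (Fm x) (fd Fm x v), fd Fh x v))" .
    have xW: "x \<in> W" using x W'W by blast
    have 2: "fd (coord (prod_line M) j \<circ> F) x = (\<lambda>v. (fd Fm x v, fd Fh x v))"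
      unfolding cF by (rule fd_eq[OF has_derivative_Pair[OF smooth_on_has_derivative[OF Fm xW] smooth_on_has_derivative[OF Fh xW]]])
    show ?thesis
    proof (rule injI)
      fix v w assume "fd (coord (prod_line M) i \<circ> F) x v = fd (coord (prod_line M) i \<circ> F) x w"
      then have "fd Fm x v = fd Fm x w" "fd Fh x v = fd Fh x w"
        unfolding 1 using injT by (auto dest: injD)
      then have "fd (coord (prod_line M) j \<circ> F) x v = fd (coord (prod_line M) j \<circ> F) x w"
        unfolding 2 by simp
      then show "v = w" using p(6) xW by (metis injD)
    qed
  qed
  obtain U G where UG: "open U" "homeomorphism (W \<inter> Q) (S \<inter> U) F G" "F ` (W \<inter> frontier Q) = B \<inter> U"
    using p(7) by blast
  let ?U = "U \<inter> chart_dom M i \<times> (UNIV :: real set)"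
  have im: "F ` (W \<inter> Q) = S \<inter> U" using UG(2) unfolding homeomorphism_def by blast
  have "F ` (W' \<inter> Q) = S \<inter> ?U"
  proof
    show "F ` (W' \<inter> Q) \<subseteq> S \<inter> ?U"
    proof (rule image_subsetI)
      fix x assume x: "x \<in> W' \<inter> Q"
      then have "F x \<in> S \<inter> U" using im W'W by blast
      then show "F x \<in> S \<inter> ?U" using x by (simp add: W'_def mem_Times_iff)
    qed
    show "S \<inter> ?U \<subseteq> F ` (W' \<inter> Q)"
    proof
      fix q assume q: "q \<in> S \<inter> ?U"
      then obtain x where x: "x \<in> W \<inter> Q" "q = F x" using im by blast
      then have "x \<in> W' \<inter> Q" using q by (simp add: W'_def mem_Times_iff)
      then show "q \<in> F ` (W' \<inter> Q)" using x(2) by blast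
    qed
  qed
  then have hom: "homeomorphism (W' \<inter> Q) (S \<inter> ?U) F G"
    by (intro homeomorphism_of_subsets[OF UG(2)]) (use W'W in blast)+
  have fr: "F ` (W' \<inter> frontier Q) = B \<inter> ?U"
  proof
    show "F ` (W' \<inter> frontier Q) \<subseteq> B \<inter> ?U"
    proof (rule image_subsetI)
      fix x assume x: "x \<in> W' \<inter> frontier Q"
      then have "F x \<in> B \<inter> U" using UG(3) W'W by blast
      then show "F x \<in> B \<inter> ?U" using x by (simp add: W'_def mem_Times_iff)
    qed
    show "B \<inter> ?U \<subseteq> F ` (W' \<inter> frontier Q)"
    proof
      fix q assume q: "q \<in> B \<inter> ?U"
      then obtain x where x: "x \<in> W \<inter> frontier Q" "q = F x" using UG(3) by blast
      then have "x \<in> W' \<inter> frontier Q" using q by (simp add: W'_def mem_Times_iff)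
      then show "q \<in> F ` (W' \<inter> frontier Q)" using x(2) by blast
    qed
  qed
  have "open ?U" by (intro open_Int UG(1) open_Times open_chart_dom[OF M i]) auto
  then have ex: "\<exists>U G. open U \<and> homeomorphism (W' \<inter> Q) (S \<inter> U) F G \<and> F ` (W' \<inter> frontier Q) = B \<inter> U"
    using hom fr by blast
  have "F ` W' \<subseteq> chart_dom (prod_line M) i"
    by (rule image_subsetI) (simp add: W'_def mem_Times_iff)
  then show ?thesis
    unfolding surface_patch_def W'_def[symmetric] using p(1) i W' smF inj ex by simp
qed

lemma (in H_graph_setup) boundary_patch_at:
  assumes p: "p \<in> frontier \<Omega>" and i: "i \<in> charts M" "p \<in> chart_dom M i"
  obtains W F U G x0 where "surface_patch P S B {x. 0 \<le> x $ 1} i W F" "open U"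
    "homeomorphism (W \<inter> {x. 0 \<le> x $ 1}) (S \<inter> U) F G" "F ` (W \<inter> {x. x $ 1 = 0}) = B \<inter> U"
    "x0 \<in> W" "x0 $ 1 = 0" "F x0 = (p, u p)"
proof -
  have qS: "(p, u p) \<in> S" and qB: "(p, u p) \<in> B" using p frontier_sub by (auto simp: graph_over_def)
  obtain Q j W F where patch: "surface_patch P S B Q j W F" and q: "(p, u p) \<in> F ` (W \<inter> Q)"
  proof -
    have "\<forall>q\<in>S. \<exists>Q i W F. surface_patch P S B Q i W F \<and> q \<in> F ` (W \<inter> Q)"
      using surface unfolding smooth_surface_def by (elim conjE)
    from bspec[OF this qS] show thesis using that by (elim exE conjE)
  qed
  note patch' = patch_restrict[OF M patch i(1)]
  let ?W = "W \<inter> (\<lambda>x. fst (F x)) -` chart_dom M i"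
  have Q: "Q \<in> {UNIV, {x. 0 \<le> x $ 1}}"
    using patch' unfolding surface_patch_def by (elim conjE)
  have "\<exists>U G. open U \<and> homeomorphism (?W \<inter> Q) (S \<inter> U) F G \<and> F ` (?W \<inter> frontier Q) = B \<inter> U"
    using patch' unfolding surface_patch_def by (elim conjE)
  then obtain U G where UG: "open U" "homeomorphism (?W \<inter> Q) (S \<inter> U) F G" "F ` (?W \<inter> frontier Q) = B \<inter> U"
    by (elim exE conjE)
  obtain x where x: "x \<in> W \<inter> Q" "F x = (p, u p)" using q by (elim imageE) simp
  then have "x \<in> ?W \<inter> Q" using i by simp
  moreover have "F ` (?W \<inter> Q) = S \<inter> U" using UG(2) unfolding homeomorphism_def by (elim conjE)
  ultimately have "F x \<in> S \<inter> U" by blast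
  then have "(p, u p) \<in> F ` (?W \<inter> frontier Q)" unfolding UG(3) using qB x(2) by simp
  then obtain x0 where x0: "x0 \<in> ?W \<inter> frontier Q" "F x0 = (p, u p)" unfolding image_iff by metis
  \<comment> \<open>A patch on the whole plane has empty frontier, but a point of \<open>B\<close>
    in its range must come from the frontier of \<open>Q\<close>.\<close>
  have "Q \<noteq> UNIV"
  proof
    assume "Q = UNIV"
    then have "frontier Q = {}" by simp
    then show False using x0(1) by blast
  qed
  then have Q': "Q = {x. 0 \<le> x $ 1}" using Q by blast
  have fr: "frontier Q = {x. x $ 1 = 0}"
    unfolding Q' using frontier_halfspace_ge[of e\<^sub>1 0] by (simp add: inner_axis' axis_eq_0_iff)
  show ?thesis
  proof (rule that)
    show "surface_patch P S B {x. 0 \<le> x $ 1} i ?W F" using patch' unfolding Q' .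
    show "open U" by (fact UG(1))
    show "homeomorphism (?W \<inter> {x. 0 \<le> x $ 1}) (S \<inter> U) F G" using UG(2) unfolding Q' .
    show "F ` (?W \<inter> {x. x $ 1 = 0}) = B \<inter> U" using UG(3) unfolding fr .
    show "x0 \<in> ?W" "x0 $ 1 = 0" using x0(1) unfolding fr by blast+
    show "F x0 = (p, u p)" by (fact x0(2))
  qed
qed

lemma velocity_derivatives:
  assumes \<gamma>: "unit_speed_curve M J \<gamma>" and i: "i \<in> charts M" and t: "t \<in> J" "\<gamma> t \<in> chart_dom M i"
    and op: "open (chart_dom M i)"
  shows "((coord M i \<circ> \<gamma>) has_vector_derivative velocity M i \<gamma> t) (at t)"
    "(velocity M i \<gamma> has_vector_derivative vector_derivative (velocity M i \<gamma>) (at t)) (at t)"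
    "metric M i (coord M i (\<gamma> t)) (velocity M i \<gamma> t) (velocity M i \<gamma> t) = 1"
proof -
  let ?J = "J \<inter> \<gamma> -` chart_dom M i"
  have sm: "smooth_on ?J (coord M i \<circ> \<gamma>)" and J: "open J" "continuous_on J \<gamma>"
    using \<gamma> i unfolding unit_speed_curve_def by blast+
  have opJ: "open ?J" by (rule continuous_open_preimage[OF J(2,1) op])
  have v: "((coord M i \<circ> \<gamma>) has_vector_derivative velocity M i \<gamma> s) (at s)" if "s \<in> ?J" for s
    unfolding velocity_def using smooth_on_differentiable[OF sm that] vector_derivative_works by blast
  show "((coord M i \<circ> \<gamma>) has_vector_derivative velocity M i \<gamma> t) (at t)" using v t by blast
  have eq: "fd (coord M i \<circ> \<gamma>) s 1 = velocity M i \<gamma> s" if "s \<in> ?J" for s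
    using fd_eq[OF v[OF that, unfolded has_vector_derivative_def]] by simp
  have "(velocity M i \<gamma>) differentiable (at t)"
    by (rule differentiable_cong_open[OF opJ _ eq smooth_on_differentiable[OF smooth_on_fd[OF sm]]]) (use t in auto)
  then show "(velocity M i \<gamma> has_vector_derivative vector_derivative (velocity M i \<gamma>) (at t)) (at t)"
    using vector_derivative_works by blast
  show "metric M i (coord M i (\<gamma> t)) (velocity M i \<gamma> t) (velocity M i \<gamma> t) = 1"
    using \<gamma> i t unfolding unit_speed_curve_def by blast
qed

text \<open>If \<nu> > 0 near the boundary point, the estimate is derived for the reflected surface,
  whose height is \<open>- u\<close>. This can happen only for \<open>\<nu>0 = 0\<close>; then
  \<open>vertical\<close> either excludes it or provides the height bound for the
  reflection.\<close>

lemma (in H_graph_setup) boundary_estimate: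
  assumes p: "p \<in> frontier \<Omega>" and k: "has_boundary_geodesic_curvature M \<Omega> p k"
    and m: "0 < m" "m \<le> 1/2" and u: "\<And>q. q \<in> \<Omega> \<Longrightarrow> u q \<le> m * height_const c H \<nu>0"
    and vertical: "\<nu>0 = 0 \<Longrightarrow> (\<forall>q\<in>interior \<Omega>. \<nu> q < 0) \<or> (\<forall>q\<in>\<Omega>. - u q \<le> m * height_const c H \<nu>0)"
  shows "(4 * H\<^sup>2 + c * (1 - \<nu>0\<^sup>2)) / (4 * H * m) - 2 * H \<le> sqrt (1 - \<nu>0\<^sup>2) * k"
proof -
  let ?Q = "{x :: real^2. 0 \<le> x $ 1}"
  obtain J \<gamma> t i n where \<gamma>: "unit_speed_curve M J \<gamma>" "\<gamma> ` J \<subseteq> frontier \<Omega>" "t \<in> J" "\<gamma> t = p"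
    and i: "i \<in> charts M" "p \<in> chart_dom M i" and n: "outer_unit_normal M \<Omega> i \<gamma> t n"
    and k_eq: "k = metric M i (coord M i p) (acceleration M i \<gamma> t) n"
    using k unfolding has_boundary_geodesic_curvature_def by blast
  obtain W F U G x0 where patch: "surface_patch P S B ?Q i W F" and U: "open U"
    and hom: "homeomorphism (W \<inter> ?Q) (S \<inter> U) F G" and fr: "F ` (W \<inter> {x. x $ 1 = 0}) = B \<inter> U"
    and x0: "x0 \<in> W" "x0 $ 1 = 0" "F x0 = (p, u p)"
    using boundary_patch_at[OF p i] .
  note pc = patch_components[OF M patch N mc]
  interpret riem_chart M i "chart_im M i" by (rule riem_chart_manifold[OF M i(1)])
  have FS: "F x \<in> S" "F x \<in> U" if "x \<in> W" "0 \<le> x $ 1" for x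
    using hom that unfolding homeomorphism_def by blast+
  have Fu: "fst (F x) \<in> \<Omega>" "snd (F x) = u (fst (F x))" if "x \<in> W" "0 \<le> x $ 1" for x
    using FS(1)[OF that] by (auto simp: graph_over_def)
  have GF: "G (F x) = x" if "x \<in> W" "0 \<le> x $ 1" for x
    using hom that unfolding homeomorphism_def by blast
  have F0: "fst (F x) \<in> frontier \<Omega>" if "x \<in> W" "x $ 1 = 0" for x
  proof -
    have "F x \<in> B" using fr that by blast
    then obtain q where "q \<in> frontier \<Omega>" "F x = (q, u q)" unfolding graph_over_def by blast
    then show ?thesis by simp
  qed
  \<comment> \<open>The points of \<open>B\<close> in the range are already taken by the boundary
    line, so injectivity of the patch keeps the open half disc off the frontier.\<close>
  have Fi: "fst (F x) \<in> interior \<Omega>" if x: "x \<in> W" "0 < x $ 1" for x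
  proof (rule ccontr)
    assume "fst (F x) \<notin> interior \<Omega>"
    then have "fst (F x) \<in> frontier \<Omega>" using \<Omega>_cases[OF Fu(1)[of x]] x by auto
    moreover have "F x = (fst (F x), u (fst (F x)))" using Fu(2)[of x] x by (simp add: prod_eq_iff)
    ultimately have "F x \<in> B" unfolding graph_over_def by (metis imageI)
    then have "F x \<in> F ` (W \<inter> {x. x $ 1 = 0})" unfolding fr using FS(2)[of x] x by simp
    then obtain y where y: "y \<in> W" "y $ 1 = 0" "F x = F y" by blast
    have "x = G (F x)" using GF[of x] x by simp
    also have "\<dots> = y" unfolding y(3) using GF[of y] y(1,2) by simp
    finally have "x = y" .
    then show False using x y by simp
  qed
  define Fm where "Fm = (\<lambda>x. coord M i (fst (F x)))"
  define Fh where "Fh = (\<lambda>x. snd (F x))"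
  define X where "X = (\<lambda>x. fst (N i (F x)))"
  define n' where "n' = (\<lambda>x. snd (N i (F x)))"
  have comp: "smooth_on W Fm" "smooth_on W Fh"
    "\<And>x v. x \<in> W \<Longrightarrow> fd Fm x v = 0 \<Longrightarrow> fd Fh x v = 0 \<Longrightarrow> v = 0"
    "continuous_on (W \<inter> ?Q) X"
    "\<And>x. x \<in> W \<Longrightarrow> x \<in> ?Q \<Longrightarrow> g (Fm x) (X x) (X x) + (n' x)\<^sup>2 = 1"
    "\<And>x v. x \<in> W \<Longrightarrow> x \<in> ?Q \<Longrightarrow> g (Fm x) (X x) (fd Fm x v) + n' x * fd Fh x v = 0"
    "\<And>x. x \<in> W \<Longrightarrow> x \<in> interior ?Q \<Longrightarrow> \<exists>A. linear A \<and> trace2 A = 2 * H \<and>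
      X differentiable (at x) \<and> n' differentiable (at x) \<and>
      (\<forall>v. fd Fm x (A v) = - (fd X x v + \<Gamma> (Fm x) (fd Fm x v) (X x)) \<and> fd Fh x (A v) = - fd n' x v)"
    unfolding Fm_def Fh_def X_def n'_def by (fact pc(4-7,9-11))+
  have n': "n' x = \<nu> (fst (F x))" if x: "x \<in> W" "0 \<le> x $ 1" for x
  proof -
    have "(fst (F x), u (fst (F x))) = F x" using Fu(2)[OF x] by (simp add: prod_eq_iff)
    then show ?thesis using \<nu>_eq[OF Fu(1)[OF x] i(1) pc(3)[OF x(1)]] by (simp add: n'_def)
  qed
  have n'_cont: "continuous_on (W \<inter> ?Q) n'" unfolding n'_def by (fact pc(8))
  obtain r where r: "r > 0" "ball x0 r \<subseteq> W" using pc(2) x0(1) openE by blast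
  \<comment> \<open>Half of a ball is convex, hence connected. As \<nu> is continuous and does not
    vanish over the interior, it has one sign there.\<close>
  define W' where "W' = ball x0 r"
  have W'W: "x \<in> W" if "x \<in> W'" for x using that r(2) by (auto simp: W'_def)
  have hd: "half_disc W' x0"
    by unfold_locales (use r x0 in \<open>auto simp: W'_def\<close>)
  have sub: "W' \<inter> ?Q \<subseteq> W \<inter> ?Q" using W'W by auto
  have one_sign: "(\<forall>x\<in>W'. 0 < x $ 1 \<longrightarrow> n' x < 0) \<or> (\<forall>x\<in>W'. 0 < x $ 1 \<longrightarrow> n' x > 0)"
  proof -
    let ?C = "W' \<inter> {x. 0 < x $ 1}"
    have "{x::real^2. 0 < x $ 1} = {x. inner e\<^sub>1 x > 0}" by (simp add: inner_axis')
    then have "convex ?C"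
      unfolding W'_def by (metis convex_Int convex_ball convex_halfspace_gt)
    then have "connected (n' ` ?C)"
      by (intro connected_continuous_image convex_connected continuous_on_subset[OF n'_cont]) (use W'W in auto)
    note conn = this
    have nz: "n' x \<noteq> 0" if "x \<in> ?C" for x
      using \<nu>_nonzero[OF Fi[OF W'W]] n'[OF W'W] that by simp
    show ?thesis
    proof (rule ccontr)
      assume "\<not> ?thesis"
      then obtain x y where xy: "x \<in> ?C" "y \<in> ?C" "n' x \<ge> 0" "n' y \<le> 0" by (auto simp: not_less)
      then have "0 \<in> n' ` ?C" using connectedD_interval[OF conn, of "n' y" "n' x" 0] by blast
      then show False using nz by (metis (no_types, lifting) imageE)
    qed
  qed
  obtain \<sigma> where \<sigma>: "\<sigma>\<^sup>2 = (1::real)" "\<sigma> * \<nu>0 = \<nu>0" and neg: "\<And>x. x \<in> W' \<Longrightarrow> 0 < x $ 1 \<Longrightarrow> \<sigma> * n' x < 0"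
    and \<sigma>u: "\<And>q. q \<in> \<Omega> \<Longrightarrow> \<sigma> * u q \<le> m * height_const c H \<nu>0"
  proof (cases "\<forall>x\<in>W'. 0 < x $ 1 \<longrightarrow> n' x < 0")
    case True
    then show ?thesis using that[of 1] u by simp
  next
    case False
    then have pos: "\<forall>x\<in>W'. 0 < x $ 1 \<longrightarrow> n' x > 0" using one_sign by blast
    \<comment> \<open>Positive values off the boundary give \<open>\<nu>0 \<ge> 0\<close> by
      continuity. With the hypothesis \<open>\<nu>0 \<le> 0\<close> this leaves
      \<open>\<nu>0 = 0\<close>, which the reflection preserves.\<close>
    have "- n' x0 \<le> 0"
      by (rule half_disc.boundary_le[OF hd continuous_on_minus[OF continuous_on_subset[OF n'_cont sub]]])
        (use pos in \<open>auto simp: less_imp_le\<close>)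
    moreover have "n' x0 = \<nu>0" using n'[of x0] \<nu>_frontier[OF F0[of x0]] x0 by simp
    ultimately have \<nu>00: "\<nu>0 = 0" using \<nu>0 by simp
    obtain x where x: "x \<in> W'" "0 < x $ 1" "\<not> n' x < 0" using False by blast
    have "\<not> (\<forall>q\<in>interior \<Omega>. \<nu> q < 0)"
      using x n'[OF W'W[OF x(1)]] Fi[OF W'W[OF x(1)] x(2)] by auto
    then have low: "- u q \<le> m * height_const c H \<nu>0" if "q \<in> \<Omega>" for q
      using vertical[OF \<nu>00] that by blast
    show ?thesis
    proof (rule that[of "- 1"])
      show "- 1 * \<nu>0 = \<nu>0" using \<nu>00 by simp
      show "- 1 * u q \<le> m * height_const c H \<nu>0" if "q \<in> \<Omega>" for q using low[OF that] by simp
    qed (use pos in auto)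
  qed
  have Fm_sm: "smooth_on W' Fm" and Fh_sm: "smooth_on W' Fh"
    using smooth_on_subset[OF comp(1)] smooth_on_subset[OF comp(2)] W'W by blast+
  have W'_open: "open W'" by (simp add: W'_def)
  have fdFh: "fd (\<lambda>x. \<sigma> * Fh x) x v = \<sigma> * fd Fh x v" if "x \<in> W'" for x v
    using fd_eq[OF has_derivative_mult_right[OF smooth_on_has_derivative[OF Fh_sm that], of \<sigma>]] by simp
  have \<sigma>0: "\<sigma> \<noteq> 0" using \<sigma>(1) by auto
  have ge: "\<sigma> * Fh x \<ge> 0" if x: "x \<in> W'" "0 < x $ 1" for x
    using height_nonneg[OF \<sigma>(1) Fi[OF W'W[OF x(1)] x(2)]] neg[OF x] n'[OF W'W[OF x(1)]] Fu(2)[OF W'W[OF x(1)]] x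
    by (simp add: Fh_def)
  interpret bp: boundary_patch M i "chart_im M i" W' x0 Fm "\<lambda>x. \<sigma> * Fh x" X "\<lambda>x. \<sigma> * n' x" H \<nu>0
  proof (intro boundary_patch.intro boundary_patch_axioms.intro hd)
    show "riem_chart M i (chart_im M i)" by unfold_locales
    show "Fm ` W' \<subseteq> chart_im M i" using coord_in_im[OF M i(1) pc(3)] W'W by (auto simp: Fm_def)
    show "smooth_on W' Fm" by (fact Fm_sm)
    show "smooth_on W' (\<lambda>x. \<sigma> * Fh x)" by (intro smooth_on_mult smooth_on_const W'_open Fh_sm)
    show "v = 0" if "x \<in> W'" "fd Fm x v = 0" "fd (\<lambda>x. \<sigma> * Fh x) x v = 0" for x v
      using comp(3)[OF W'W[OF that(1)] that(2)] that(3) \<sigma>0 by (simp add: fdFh[OF that(1)])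
    show "continuous_on (W' \<inter> ?Q) X" by (rule continuous_on_subset[OF comp(4) sub])
    show "continuous_on (W' \<inter> ?Q) (\<lambda>x. \<sigma> * n' x)"
      by (intro continuous_on_mult_left continuous_on_subset[OF n'_cont sub])
    show "g (Fm x) (X x) (X x) + (\<sigma> * n' x)\<^sup>2 = 1" if "x \<in> W'" "0 \<le> x $ 1" for x
      using comp(5)[OF W'W[OF that(1)]] that(2) \<sigma>(1) by (simp add: power_mult_distrib)
    show "g (Fm x) (X x) (fd Fm x v) + \<sigma> * n' x * fd (\<lambda>x. \<sigma> * Fh x) x v = 0" if "x \<in> W'" "0 \<le> x $ 1" for x v
    proof -
      have "\<sigma> * n' x * (\<sigma> * fd Fh x v) = \<sigma>\<^sup>2 * (n' x * fd Fh x v)" by (simp add: power2_eq_square)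
      also have "\<dots> = n' x * fd Fh x v" by (simp add: \<sigma>(1))
      finally have "\<sigma> * n' x * (\<sigma> * fd Fh x v) = n' x * fd Fh x v" .
      moreover have "x \<in> ?Q" using that(2) by simp
      ultimately show ?thesis
        unfolding fdFh[OF that(1)] using comp(6)[OF W'W[OF that(1)], of v] by linarith
    qed
    show "\<exists>A. linear A \<and> trace2 A = 2 * H \<and> X differentiable (at x) \<and> (\<lambda>x. \<sigma> * n' x) differentiable (at x) \<and>
      (\<forall>v. fd Fm x (A v) = - (fd X x v + \<Gamma> (Fm x) (fd Fm x v) (X x)) \<and>
        fd (\<lambda>x. \<sigma> * Fh x) x (A v) = - fd (\<lambda>x. \<sigma> * n' x) x v)" if x: "x \<in> W'" "0 < x $ 1" for x
    proof -
      have "x \<in> interior ?Q"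
        using x by simp
      from comp(7)[OF W'W[OF x(1)] this]
      obtain A where A: "linear A" "trace2 A = 2 * H" "X differentiable (at x)" "n' differentiable (at x)"
        "\<And>v. fd Fm x (A v) = - (fd X x v + \<Gamma> (Fm x) (fd Fm x v) (X x))" "\<And>v. fd Fh x (A v) = - fd n' x v"
        by blast
      have dn: "((\<lambda>x. \<sigma> * n' x) has_derivative (\<lambda>v. \<sigma> * fd n' x v)) (at x)"
        by (rule has_derivative_mult_right[OF fd_has_derivative[OF A(4)]])
      have "fd (\<lambda>x. \<sigma> * Fh x) x (A v) = - fd (\<lambda>x. \<sigma> * n' x) x v" for v
        using A(6)[of v] by (simp add: fdFh[OF x(1)] fd_eq[OF dn])
      then show ?thesis using A dn unfolding differentiable_def by blast
    qed
    show "\<sigma> * n' x < 0" if "x \<in> W'" "0 < x $ 1" for x by (rule neg[OF that])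
    show "\<sigma> * Fh x = 0" if "x \<in> W'" "x $ 1 = 0" for x
      using Fu(2)[OF W'W[OF that(1)]] u_frontier[OF F0[OF W'W[OF that(1)] that(2)]] that(2) by (simp add: Fh_def)
    show "\<sigma> * n' x = \<nu>0" if "x \<in> W'" "x $ 1 = 0" for x
      using n'[OF W'W[OF that(1)]] \<nu>_frontier[OF F0[OF W'W[OF that(1)] that(2)]] that(2) \<sigma>(2) by simp
    show "0 \<le> \<sigma> * Fh x" if "x \<in> W'" "0 < x $ 1" for x by (rule ge[OF that])
    show "- 1 < \<nu>0" "\<nu>0 \<le> 0" by (fact \<nu>0)+
  qed
  have Fmx0: "Fm x0 = coord M i p" using x0(3) by (simp add: Fm_def)
  define f' where "f' s = m * (4 * H / (4 * H\<^sup>2 + c * (1 - s\<^sup>2)))" for s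
  have den: "4 * H\<^sup>2 + c * (1 - s\<^sup>2) > 0" if "\<bar>s\<bar> \<le> 1" for s
    by (rule height_fun_pos[OF c(2) H that])
  have den0: "4 * H\<^sup>2 + c * (1 - \<nu>0\<^sup>2) > 0" by (rule den) (use \<nu>0 in auto)
  \<comment> \<open>The boundary curve, lifted by the inverse of the patch; the second coordinate is
    0 because the height vanishes over the frontier. \<open>J1\<close> and \<open>J2\<close>
    restrict the parameter so that the lift exists and stays in \<open>W'\<close>.\<close>
  define c' where "c' s = G (\<gamma> s, 0)" for s
  define J1 where "J1 = J \<inter> (\<lambda>s. (\<gamma> s, 0::real)) -` U"
  have J: "open J" "continuous_on J \<gamma>" using \<gamma>(1) unfolding unit_speed_curve_def by blast+
  have J1: "open J1"
    unfolding J1_def by (rule continuous_open_preimage[OF _ J(1) U]) (intro continuous_intros J(2))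
  have \<gamma>B: "(\<gamma> s, 0) \<in> B \<inter> U" if "s \<in> J1" for s
  proof -
    have s: "\<gamma> s \<in> frontier \<Omega>" "(\<gamma> s, 0) \<in> U" using that \<gamma>(2) by (auto simp: J1_def)
    then have "(\<gamma> s, 0) = (\<gamma> s, u (\<gamma> s))" using u_frontier by simp
    then have "(\<gamma> s, 0) \<in> B" using s(1) unfolding graph_over_def by blast
    then show ?thesis using s(2) by blast
  qed
  have c': "c' s \<in> W" "c' s $ 1 = 0" "F (c' s) = (\<gamma> s, 0)" if s: "s \<in> J1" for s
  proof -
    have "(\<gamma> s, 0) \<in> F ` (W \<inter> {x. x $ 1 = 0})" unfolding fr by (rule \<gamma>B[OF s])
    then obtain z where z: "z \<in> W" "z $ 1 = 0" "(\<gamma> s, 0) = F z" by blast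
    have "c' s = z" unfolding c'_def z(3) using GF[of z] z(1,2) by simp
    then show "c' s \<in> W" "c' s $ 1 = 0" "F (c' s) = (\<gamma> s, 0)" using z by auto
  qed
  have "B \<subseteq> S" using frontier_sub by (auto simp: graph_over_def)
  then have c'_cont: "continuous_on J1 c'"
  proof -
    assume "B \<subseteq> S"
    have "continuous_on (S \<inter> U) G" using hom unfolding homeomorphism_def by blast
    then show ?thesis
      unfolding c'_def
    proof (rule continuous_on_compose2)
      show "continuous_on J1 (\<lambda>s. (\<gamma> s, 0::real))"
        by (rule continuous_on_Pair[OF continuous_on_subset[OF J(2)] continuous_on_const]) (simp add: J1_def)
      show "(\<lambda>s. (\<gamma> s, 0)) ` J1 \<subseteq> S \<inter> U" using \<gamma>B \<open>B \<subseteq> S\<close> by blast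
    qed
  qed
  define J2 where "J2 = J1 \<inter> c' -` W'"
  have J2: "open J2" unfolding J2_def by (rule continuous_open_preimage[OF c'_cont J1 W'_open])
  have tB: "(\<gamma> t, 0) \<in> U"
    using FS(2)[of x0] x0 \<gamma>(4) u_frontier[OF p] by simp
  have tJ1: "t \<in> J1" using \<gamma>(3) tB by (simp add: J1_def)
  have c't: "c' t = x0"
    using GF[of x0] x0 \<gamma>(4) u_frontier[OF p] by (simp add: c'_def)
  have tJ2: "t \<in> J2" using tJ1 c't r(1) by (simp add: J2_def W'_def)
  have dom: "\<gamma> s \<in> chart_dom M i" "s \<in> J" if "s \<in> J2" for s
    using pc(3)[OF c'(1)[of s]] c'(3)[of s] that by (auto simp: J2_def J1_def)
  note vel = velocity_derivatives[OF \<gamma>(1) i(1) dom(2) dom(1) open_chart_dom[OF M i(1)]]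
  have "1 / f' \<nu>0 - 2 * H \<le> sqrt (1 - \<nu>0\<^sup>2) * g (Fm x0) (vector_derivative (velocity M i \<gamma>) (at t) +
      \<Gamma> (Fm x0) (velocity M i \<gamma> t) (velocity M i \<gamma> t)) n"
  proof (rule bp.boundary_curvature_bound[where f = "\<lambda>s. m * height_fun c H s" and c = c' and J = J2 and \<gamma> = "coord M i \<circ> \<gamma>" and \<gamma>' = "velocity M i \<gamma>"])
    show "((\<lambda>s. m * height_fun c H s) has_real_derivative f' s) (at s)" if "\<bar>s\<bar> \<le> 1" for s
      unfolding f'_def by (rule DERIV_cmult[OF height_fun_derivative[OF c(2) H that]])
    show "continuous_on {- 1..1} f'"
    proof -
      have "4 * H\<^sup>2 + c * (1 - s\<^sup>2) \<noteq> 0" if "s \<in> {- 1..1}" for s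
      proof -
        have "\<bar>s\<bar> \<le> 1" using that by (simp add: abs_le_iff)
        then show ?thesis using den by force
      qed
      then show ?thesis unfolding f'_def by (intro continuous_intros) blast
    qed
    show "0 < f' \<nu>0" using den0 m H by (simp add: f'_def)
    show "\<sigma> * Fh x + m * height_fun c H (\<sigma> * n' x) \<le> m * height_fun c H \<nu>0" if x: "x \<in> W'" "0 < x $ 1" for x
    proof -
      have "n' x = \<nu> (fst (F x))" "Fh x = u (fst (F x))"
        using n'[OF W'W[OF x(1)]] Fu(2)[OF W'W[OF x(1)]] x(2) by (simp_all add: Fh_def)
      then show ?thesis
        using subharmonic_bound_half[OF \<sigma> m Fi[OF W'W[OF x(1)] x(2)] _ \<sigma>u] neg[OF x] by simp
    qed
    show "open J2" "t \<in> J2" by (fact J2, fact tJ2)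
    show "continuous_on J2 c'" by (rule continuous_on_subset[OF c'_cont]) (auto simp: J2_def)
    show "c' t = x0" by (fact c't)
    show "c' s \<in> W'" "c' s $ 1 = 0" if "s \<in> J2" for s
      using that c'(2)[of s] by (auto simp: J2_def)
    show "(coord M i \<circ> \<gamma>) s = Fm (c' s)" if "s \<in> J2" for s
      using that c'(3)[of s] by (simp add: Fm_def J2_def)
    show "((coord M i \<circ> \<gamma>) has_vector_derivative velocity M i \<gamma> s) (at s)" if "s \<in> J2" for s
      by (rule vel(1)[OF that that])
    show "(velocity M i \<gamma> has_vector_derivative vector_derivative (velocity M i \<gamma>) (at t)) (at t)"
      by (rule vel(2)[OF tJ2 tJ2])
    show "g (Fm x0) (velocity M i \<gamma> t) (velocity M i \<gamma> t) = 1"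
      using vel(3)[OF tJ2 tJ2] by (simp add: Fmx0 \<gamma>(4))
    show "g (Fm x0) n n = 1" "g (Fm x0) n (velocity M i \<gamma> t) = 0"
      using n by (simp_all add: outer_unit_normal_def Fmx0 \<gamma>(4))
    have "\<forall>\<^sub>F s in at_right 0. param M i (coord M i p + s *\<^sub>R n) \<notin> \<Omega>"
      using n by (simp add: outer_unit_normal_def \<gamma>(4))
    then show "\<forall>\<^sub>F s in at_right 0. Fm x0 + s *\<^sub>R n \<notin> Fm ` (W' \<inter> ?Q)"
    proof eventually_elim
      case (elim s)
      show ?case
      proof
        assume "Fm x0 + s *\<^sub>R n \<in> Fm ` (W' \<inter> ?Q)"
        then obtain x where x: "x \<in> W'" "0 \<le> x $ 1" "Fm x0 + s *\<^sub>R n = Fm x" by auto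
        have "param M i (Fm x) \<in> \<Omega>"
          using Fu(1)[OF W'W[OF x(1)] x(2)] param_coord[OF M i(1) pc(3)[OF W'W[OF x(1)]]] by (simp add: Fm_def)
        then show False using elim x(3) by (simp add: Fmx0)
      qed
    qed
  qed
  moreover have "1 / f' \<nu>0 = (4 * H\<^sup>2 + c * (1 - \<nu>0\<^sup>2)) / (4 * H * m)" by (simp add: f'_def)
  ultimately show ?thesis by (simp add: k_eq acceleration_def Fmx0 \<gamma>(4))
qed

lemma (in H_graph_setup) curvature_estimate:
  assumes p: "p \<in> frontier \<Omega>" and k: "has_boundary_geodesic_curvature M \<Omega> p k"
    and m: "0 < m" "m \<le> 1/2" and u: "\<And>q. q \<in> \<Omega> \<Longrightarrow> u q \<le> m * height_const c H \<nu>0"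
    and vertical: "\<nu>0 = 0 \<Longrightarrow> (\<forall>q\<in>interior \<Omega>. \<nu> q < 0) \<or> (\<forall>q\<in>\<Omega>. - u q \<le> m * height_const c H \<nu>0)"
  shows "((4 - 8 * m) * H\<^sup>2 + c * (1 - \<nu>0\<^sup>2)) / (4 * m * H * sqrt (1 - \<nu>0\<^sup>2)) \<le> k"
proof -
  have s: "sqrt (1 - \<nu>0\<^sup>2) > 0" using \<nu>0 by (simp add: abs_square_less_1)
  have "((4 - 8 * m) * H\<^sup>2 + c * (1 - \<nu>0\<^sup>2)) / (4 * m * H) = (4 * H\<^sup>2 + c * (1 - \<nu>0\<^sup>2)) / (4 * H * m) - 2 * H"
    using m H by (simp add: field_simps power2_eq_square)
  then have "((4 - 8 * m) * H\<^sup>2 + c * (1 - \<nu>0\<^sup>2)) / (4 * m * H) \<le> k * sqrt (1 - \<nu>0\<^sup>2)"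
    using boundary_estimate[OF assms] by (simp add: mult.commute)
  then have "((4 - 8 * m) * H\<^sup>2 + c * (1 - \<nu>0\<^sup>2)) / (4 * m * H) / sqrt (1 - \<nu>0\<^sup>2) \<le> k"
    using s by (simp only: pos_divide_le_eq)
  then show ?thesis by (simp only: divide_divide_eq_left)
qed

theorem mainTheorem4:
  fixes M :: "('a::{second_countable_topology,t2_space}, real^2, 'i) riem"
    and \<Omega> :: "'a set" and u :: "'a \<Rightarrow> real"
    and N :: "'i \<Rightarrow> 'a \<times> real \<Rightarrow> (real^2) \<times> real"
    and H \<nu>0 c :: real
  assumes M: "riemannian_manifold M"
    and \<Omega>: "compact_regular_domain M \<Omega>"
    and H: "H > 0"
    and \<Sigma>: "H_graph M H \<Omega> u N"
    and \<nu>0: "-1 < \<nu>0" "\<nu>0 \<le> 0"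
    and h_boundary: "\<forall>q\<in>graph_over (frontier \<Omega>) u. height q = 0"
    and \<nu>_boundary: "\<forall>q\<in>graph_over (frontier \<Omega>) u. angle_function M N q = \<nu>0"
    and c: "c = (INF p\<in>\<Omega>. gauss_curvature M p)" "4 * H\<^sup>2 + c > 0"
  shows
    "(\<forall>m. 0 < m \<and> m \<le> 1/2 \<and>
        (\<forall>q\<in>graph_over \<Omega> u. \<bar>height q\<bar> \<le> m * height_const c H \<nu>0) \<longrightarrow>
        (\<forall>p\<in>frontier \<Omega>. \<forall>k. has_boundary_geodesic_curvature M \<Omega> p k \<longrightarrow>
           k \<ge> ((4 - 8 * m) * H\<^sup>2 + c * (1 - \<nu>0\<^sup>2)) / (4 * m * H * sqrt (1 - \<nu>0\<^sup>2)))) \<and>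
     ((\<nu>0 = 0 \<longrightarrow> (\<forall>q\<in>graph_over (interior \<Omega>) u. angle_function M N q < 0)) \<and>
      ((c \<ge> 0 \<and> (\<forall>q\<in>graph_over \<Omega> u. height q \<le> 1/2 * height_const c H \<nu>0)) \<or>
       (c < 0 \<and> (\<forall>q\<in>graph_over \<Omega> u.
          height q \<le> (4 * H\<^sup>2 + c * (1 - \<nu>0\<^sup>2)) / (8 * H\<^sup>2) * height_const c H \<nu>0))) \<longrightarrow>
        (\<forall>p\<in>frontier \<Omega>. \<forall>k. has_boundary_geodesic_curvature M \<Omega> p k \<longrightarrow> k \<ge> 0))"
proof -
  interpret H_graph_setup M \<Omega> u N H \<nu>0 c
    by (rule H_graph_setup.intro[OF assms])
  have s: "1 - \<nu>0\<^sup>2 > 0" using \<nu>0 by (simp add: abs_square_less_1)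
  have graph: "(\<forall>q\<in>graph_over A u. R (height q)) \<longleftrightarrow> (\<forall>q\<in>A. R (u q))" for A R
    by (auto simp: graph_over_def height_def)
  have angle: "(\<forall>q\<in>graph_over (interior \<Omega>) u. angle_function M N q < 0) \<longleftrightarrow> (\<forall>q\<in>interior \<Omega>. \<nu> q < 0)"
    by (auto simp: graph_over_def \<nu>_def)
  show ?thesis
  proof (intro conjI allI impI ballI)
    fix m p k
    assume "0 < m \<and> m \<le> 1/2 \<and> (\<forall>q\<in>graph_over \<Omega> u. \<bar>height q\<bar> \<le> m * height_const c H \<nu>0)"
    then have m: "0 < m" "m \<le> 1/2" and u: "\<And>q. q \<in> \<Omega> \<Longrightarrow> \<bar>u q\<bar> \<le> m * height_const c H \<nu>0"
      using graph[of \<Omega> "\<lambda>t. \<bar>t\<bar> \<le> m * height_const c H \<nu>0"] by auto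
    assume "p \<in> frontier \<Omega>" "has_boundary_geodesic_curvature M \<Omega> p k"
    then show "k \<ge> ((4 - 8 * m) * H\<^sup>2 + c * (1 - \<nu>0\<^sup>2)) / (4 * m * H * sqrt (1 - \<nu>0\<^sup>2))"
    proof (rule curvature_estimate[OF _ _ m])
      show "u q \<le> m * height_const c H \<nu>0" if "q \<in> \<Omega>" for q using abs_le_D1[OF u[OF that]] .
      \<comment> \<open>The two-sided height bound provides the second alternative, so the sign of
        \<nu> may be arbitrary here.\<close>
      show "(\<forall>q\<in>interior \<Omega>. \<nu> q < 0) \<or> (\<forall>q\<in>\<Omega>. - u q \<le> m * height_const c H \<nu>0)"
        using abs_le_D2[OF u] by blast
    qed
  next
    fix p k
    assume hyp: "(\<nu>0 = 0 \<longrightarrow> (\<forall>q\<in>graph_over (interior \<Omega>) u. angle_function M N q < 0)) \<and>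
      ((c \<ge> 0 \<and> (\<forall>q\<in>graph_over \<Omega> u. height q \<le> 1/2 * height_const c H \<nu>0)) \<or>
       (c < 0 \<and> (\<forall>q\<in>graph_over \<Omega> u.
          height q \<le> (4 * H\<^sup>2 + c * (1 - \<nu>0\<^sup>2)) / (8 * H\<^sup>2) * height_const c H \<nu>0)))"
      and p: "p \<in> frontier \<Omega>" "has_boundary_geodesic_curvature M \<Omega> p k"
    \<comment> \<open>For c < 0 this is the value at which the numerator of the curvature bound is
      zero. For c \<ge> 0 it is the largest admissible value, and the numerator is
      \<open>c * (1 - \<nu>0\<^sup>2)\<close>.\<close>
    define m where "m = (if c \<ge> 0 then 1/2 else (4 * H\<^sup>2 + c * (1 - \<nu>0\<^sup>2)) / (8 * H\<^sup>2))"
    have pos: "4 * H\<^sup>2 + c * (1 - \<nu>0\<^sup>2) > 0"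
      by (rule height_fun_pos[OF c(2) H]) (use \<nu>0 in auto)
    have m: "0 < m" "m \<le> 1/2"
      using pos H s by (auto simp: m_def field_simps mult_le_0_iff not_le)
    have u: "u q \<le> m * height_const c H \<nu>0" if "q \<in> \<Omega>" for q
      using hyp that graph[of \<Omega> "\<lambda>t. t \<le> m * height_const c H \<nu>0"] by (auto simp: m_def split: if_splits)
    have "((4 - 8 * m) * H\<^sup>2 + c * (1 - \<nu>0\<^sup>2)) / (4 * m * H * sqrt (1 - \<nu>0\<^sup>2)) \<le> k"
      \<comment> \<open>The height is bounded from above only, so for \<open>\<nu>0 = 0\<close> the
        condition \<open>vertical\<close> comes from the assumed sign of the angle function.\<close>
      by (rule curvature_estimate[OF p m u]) (use hyp angle in auto)
    moreover have "(4 - 8 * m) * H\<^sup>2 + c * (1 - \<nu>0\<^sup>2) \<ge> 0"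
    proof (cases "c \<ge> 0")
      case True
      then have "c * (1 - \<nu>0\<^sup>2) \<ge> 0" using s by (intro mult_nonneg_nonneg) auto
      then show ?thesis using True by (simp add: m_def)
    next
      case False
      then have "8 * m * H\<^sup>2 = 4 * H\<^sup>2 + c * (1 - \<nu>0\<^sup>2)" using H by (simp add: m_def)
      then show ?thesis by (simp add: left_diff_distrib)
    qed
    ultimately show "k \<ge> 0" using m H s
      by (smt (verit, best) divide_nonneg_pos mult_pos_pos real_sqrt_gt_0_iff)
  qed
qed

end
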